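(* Let $M$ be a smooth Riemannian manifold, let $X_0,X_1$ be z-KROK random fields on $M$ with values in $\mathbb{R}^k$, let $t\in[0,1]$, and let $\epsilon$ be a random variable with values in $\{0,1\}$, independent of $X_0$ and $X_1$, such that $\epsilon=0$ with probability $t$ and $\epsilon=1$ with probability $1-t$. Assume in addition that there is no point $p\in M$ such that $\rho_{X_i(p)}(0)=0$ for both $i=0,1$. Let $X_t:=\epsilon X_0+(1-\epsilon)X_1$. Then $X_t$ is z-KROK and for all $p\in M$ $$\zeta_{X_t}(p)=(1-t)\,\zeta_{X_0}(p)+t\,\zeta_{X_1}(p)$$ (Minkowski sum).
   Context: Random fields. $M$ is a smooth manifold, possibly non-compact, with Riemannian metric $g$. $C^1(M,\mathbb{R}^k)$ carries the weak Whitney topology; a random field $X$ is a measurable map from a probability space into it; $[Y]$ denotes the law of a random element $Y$. For $f\in C^1(M,\mathbb{R}^k)$ let $J_pf:=\|d_pf^1\wedge\cdots\wedge d_pf^k\|$, with the norm on $\Lambda^kT^*_pM$ induced by $g$ through $\langle v_1\wedge\dots\wedge v_k,w_1\wedge\dots\wedge w_k\rangle=\det(\langle v_i,w_j\rangle)_{i,j}$. A regular conditional probability of $X$ given $X(p)$ is a map $(x,B)\mapsto\mu(p,x)(B)$ ($x\in\mathbb{R}^k$, $B\subset C^1(M,\mathbb{R}^k)$ Borel) such that each $\mu(p,x)$ is a Borel probability measure, $x\mapsto\mu(p,x)(B)$ is Borel, and $\mathbb{P}\{X\in B,\,X(p)\in V\}=\int_V\mu(p,x)(B)\,d[X(p)](x)$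 for all Borel $B$ and $V\subset\mathbb{R}^k$. $X$ is z-KROK if: (i) $X$ is a random element of $C^1(M,\mathbb{R}^k)$; (ii) almost surely $0$ is a regular value of $X$; (iii) for every $p\in M$ the law of $X(p)$ is absolutely continuous with density $\rho_{X(p)}:\mathbb{R}^k\to[0,+\infty)$; (iv) $(p,x)\mapsto\rho_{X(p)}(x)$ on $M\times\mathbb{R}^k$ is continuous at $(p,0)$ for all $p\in M$; (v) there are regular conditional probabilities $\mu(p,\cdot)$ of $X$ given $X(p)$, $p\in M$, such that the measures $J_p\cdot\mu(p,x)$, $B\mapsto\int_BJ_pf\,d\mu(p,x)(f)$, are finite and $(p,x)\mapsto J_p\cdot\mu(p,x)$, with values in the finite positive Borel measures on $C^1(M,\mathbb{R}^k)$ with the weak topology (tested on bounded continuous functions), is continuous at $(p,0)$ for all $p\in M$. With this $\mu$, write $\mathbb{E}\{\Phi(X)\,|\,X(p)=0\}:=\int\Phi\,d\mu(p,0)$. Zonoid section. A convex body $K$ is determined by its support function $h_K(u)=\sup_{x\in K}\langle u,x\rangle$. $\zeta_X(p):=\mathbb{E}\{[0,d_pX^1\wedge\cdots\wedge d_pX^k]\,|\,X(p)=0\}\,\rho_{X(p)}(0)$ is the zonoid (Hausdorff limit of finite Minkowski sums of segments) in $\Lambda^kT_p^*M$ with support function $u\mapsto\rho_{X(p)}(0)\,\mathbb{E}\{\max\{0,\langle d_pX^1\wedge\cdots\wedge d_pX^k,u\rangle\}\,|\,X(p)=0\}$, $u\in\Lambda^kT_pM$. *)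

theory Defs
  imports "HOL-Probability.Probability"
begin

section \<open>Smooth manifolds\<close>

text \<open>
  The total derivative of \<open>f\<close> is continuous on the open set \<open>S\<close> iff all its values on constant
  vectors are, because the domain is finite-dimensional; this allows iterating with the type of
  \<open>f\<close> unchanged.
\<close>

primrec Ck_on :: "nat \<Rightarrow> ('a::euclidean_space \<Rightarrow> 'b::real_normed_vector) \<Rightarrow> 'a set \<Rightarrow> bool" where
  "Ck_on 0 f S \<longleftrightarrow> continuous_on S f"
| "Ck_on (Suc n) f S \<longleftrightarrow>
     (\<forall>x\<in>S. f differentiable (at x)) \<and>
     (\<forall>v. Ck_on n (\<lambda>x. frechet_derivative f (at x) v) S)"

definition smooth_on :: "'a::euclidean_space set \<Rightarrow> ('a \<Rightarrow> 'b::real_normed_vector) \<Rightarrow> bool" where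
  "smooth_on S f \<longleftrightarrow> (\<forall>n. Ck_on n f S)"

text \<open>
  A chart is a pair \<open>(U, \<phi>)\<close>; only the values of \<open>\<phi>\<close> on \<open>U\<close> matter. The manifold is the whole
  type \<open>'m\<close>, its dimension is \<open>DIM('e)\<close>, and its smooth structure is given by any smooth atlas
  (not necessarily maximal).
\<close>

type_synonym ('m, 'e) chart = "'m set \<times> ('m \<Rightarrow> 'e)"

definition chart_inv :: "('m, 'e) chart \<Rightarrow> 'e \<Rightarrow> 'm" where
  "chart_inv c = inv_into (fst c) (snd c)"

definition smooth_atlas ::
  "('m::{t2_space,second_countable_topology}, 'e::euclidean_space) chart set \<Rightarrow> bool" where
  "smooth_atlas A \<longleftrightarrow>
     (\<Union>c\<in>A. fst c) = UNIV \<and>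
     (\<forall>c\<in>A. open (fst c) \<and> open (snd c ` fst c) \<and>
        homeomorphism (fst c) (snd c ` fst c) (snd c) (chart_inv c)) \<and>
     (\<forall>c\<in>A. \<forall>d\<in>A. smooth_on (snd c ` (fst c \<inter> fst d)) (snd d \<circ> chart_inv c))"

definition charts_at :: "('m, 'e) chart set \<Rightarrow> 'm \<Rightarrow> ('m, 'e) chart set" where
  "charts_at A p = {c \<in> A. p \<in> fst c}"

definition transition_deriv ::
  "('m, 'e::euclidean_space) chart \<Rightarrow> ('m, 'e) chart \<Rightarrow> 'm \<Rightarrow> 'e \<Rightarrow> 'e" where
  "transition_deriv c d p = frechet_derivative (snd d \<circ> chart_inv c) (at (snd c p))"

text \<open>
  A tangent vector at \<open>p\<close> is the family of its coordinate representations in all charts around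
  \<open>p\<close>, which transform by the derivatives of the transition maps. The family is set to \<open>0\<close> at
  all other charts, so that equality of tangent vectors is equality of functions. Vector space
  operations are pointwise.
\<close>

type_synonym ('m, 'e) tvec = "('m, 'e) chart \<Rightarrow> 'e"

definition tangent_space ::
  "('m, 'e::euclidean_space) chart set \<Rightarrow> 'm \<Rightarrow> ('m, 'e) tvec set" where
  "tangent_space A p =
     {v. (\<forall>c. c \<notin> charts_at A p \<longrightarrow> v c = 0) \<and>
         (\<forall>c\<in>charts_at A p. \<forall>d\<in>charts_at A p. v d = transition_deriv c d p (v c))}"

definition tvec_comb ::
  "real \<Rightarrow> ('m, 'e::real_vector) tvec \<Rightarrow> real \<Rightarrow> ('m, 'e) tvec \<Rightarrow> ('m, 'e) tvec" where
  "tvec_comb a v b w = (\<lambda>c. a *\<^sub>R v c + b *\<^sub>R w c)"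

text \<open>The tangent vector at \<open>p\<close> whose coordinates in the chart \<open>c\<close> are \<open>a\<close>.\<close>

definition coord_tvec ::
  "('m, 'e::euclidean_space) chart set \<Rightarrow> ('m, 'e) chart \<Rightarrow> 'm \<Rightarrow> 'e \<Rightarrow> ('m, 'e) tvec" where
  "coord_tvec A c p a = (\<lambda>d. if d \<in> charts_at A p then transition_deriv c d p a else 0)"

text \<open>
  The differential; by the chain rule it does not depend on the chart chosen for its evaluation.
\<close>

definition differential ::
  "('m, 'e::euclidean_space) chart set \<Rightarrow> 'm \<Rightarrow> ('m \<Rightarrow> 'b::real_normed_vector) \<Rightarrow> ('m, 'e) tvec \<Rightarrow> 'b" where
  "differential A p f v =
     (let c = (SOME c. c \<in> charts_at A p)
      in frechet_derivative (f \<circ> chart_inv c) (at (snd c p)) (v c))"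

definition regular_value ::
  "('m, 'e::euclidean_space) chart set \<Rightarrow> ('m \<Rightarrow> 'b::real_normed_vector) \<Rightarrow> 'b \<Rightarrow> bool" where
  "regular_value A f y \<longleftrightarrow> (\<forall>p. f p = y \<longrightarrow> differential A p f ` tangent_space A p = UNIV)"


section \<open>Riemannian metrics and the Jacobian\<close>

definition riemannian_metric ::
  "('m, 'e::euclidean_space) chart set \<Rightarrow> ('m \<Rightarrow> ('m, 'e) tvec \<Rightarrow> ('m, 'e) tvec \<Rightarrow> real) \<Rightarrow> bool" where
  "riemannian_metric A g \<longleftrightarrow>
     (\<forall>p. \<forall>u\<in>tangent_space A p. \<forall>v\<in>tangent_space A p. \<forall>w\<in>tangent_space A p.
        g p v w = g p w v \<and>
        (\<forall>a b. g p (tvec_comb a u b v) w = a * g p u w + b * g p v w) \<and>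
        (v \<noteq> (\<lambda>_. 0) \<longrightarrow> g p v v > 0)) \<and>
     (\<forall>c\<in>A. \<forall>a b. smooth_on (snd c ` fst c)
        (\<lambda>y. g (chart_inv c y) (coord_tvec A c (chart_inv c y) a) (coord_tvec A c (chart_inv c y) b)))"

text \<open>The inner product induced by \<open>g\<close> on the cotangent space, via the musical isomorphism.\<close>

definition sharp ::
  "('m, 'e::euclidean_space) chart set \<Rightarrow> ('m \<Rightarrow> ('m, 'e) tvec \<Rightarrow> ('m, 'e) tvec \<Rightarrow> real) \<Rightarrow> 'm \<Rightarrow>
   (('m, 'e) tvec \<Rightarrow> real) \<Rightarrow> ('m, 'e) tvec" where
  "sharp A g p \<alpha> = (THE v. v \<in> tangent_space A p \<and> (\<forall>w\<in>tangent_space A p. g p v w = \<alpha> w))"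

definition cometric ::
  "('m, 'e::euclidean_space) chart set \<Rightarrow> ('m \<Rightarrow> ('m, 'e) tvec \<Rightarrow> ('m, 'e) tvec \<Rightarrow> real) \<Rightarrow> 'm \<Rightarrow>
   (('m, 'e) tvec \<Rightarrow> real) \<Rightarrow> (('m, 'e) tvec \<Rightarrow> real) \<Rightarrow> real" where
  "cometric A g p \<alpha> \<beta> = g p (sharp A g p \<alpha>) (sharp A g p \<beta>)"

text \<open>
  \<open>decomposable_inner A g p \<alpha> \<beta>\<close> is the inner product of the decomposable forms
  \<open>\<alpha>\<^sub>1 \<and> \<dots> \<and> \<alpha>\<^sub>k\<close> and \<open>\<beta>\<^sub>1 \<and> \<dots> \<and> \<beta>\<^sub>k\<close>, and \<open>jacobian A g p f\<close> is the norm of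
  \<open>d\<^sub>pf\<^sup>1 \<and> \<dots> \<and> d\<^sub>pf\<^sup>k\<close>.
\<close>

definition decomposable_inner ::
  "('m, 'e::euclidean_space) chart set \<Rightarrow> ('m \<Rightarrow> ('m, 'e) tvec \<Rightarrow> ('m, 'e) tvec \<Rightarrow> real) \<Rightarrow> 'm \<Rightarrow>
   ('k::finite \<Rightarrow> ('m, 'e) tvec \<Rightarrow> real) \<Rightarrow> ('k \<Rightarrow> ('m, 'e) tvec \<Rightarrow> real) \<Rightarrow> real" where
  "decomposable_inner A g p \<alpha> \<beta> = det ((\<chi> i j. cometric A g p (\<alpha> i) (\<beta> j)) :: real^'k^'k)"

definition d_component ::
  "('m, 'e::euclidean_space) chart set \<Rightarrow> 'm \<Rightarrow> ('m \<Rightarrow> real^'k) \<Rightarrow> 'k \<Rightarrow> ('m, 'e) tvec \<Rightarrow> real" where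
  "d_component A p f i = differential A p (\<lambda>q. f q $ i)"

definition jacobian ::
  "('m, 'e::euclidean_space) chart set \<Rightarrow> ('m \<Rightarrow> ('m, 'e) tvec \<Rightarrow> ('m, 'e) tvec \<Rightarrow> real) \<Rightarrow> 'm \<Rightarrow>
   ('m \<Rightarrow> real^'k) \<Rightarrow> real" where
  "jacobian A g p f = sqrt (decomposable_inner A g p (d_component A p f) (d_component A p f))"


section \<open>Exterior powers and convex bodies\<close>

text \<open>
  The exterior power of the cotangent space is realised as the space of alternating multilinear
  forms on the tangent space, extended by \<open>0\<close> outside it. The arguments of a form are indexed by
  the same finite type \<open>'k\<close> as the components of the field, so no order of the indices is needed.
\<close>

type_synonym ('m, 'e, 'k) kform = "('k \<Rightarrow> ('m, 'e) tvec) \<Rightarrow> real"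

definition alternating_forms ::
  "('m, 'e::euclidean_space) chart set \<Rightarrow> 'm \<Rightarrow> ('m, 'e, 'k) kform set" where
  "alternating_forms A p =
     {\<omega>. (\<forall>v. \<not> range v \<subseteq> tangent_space A p \<longrightarrow> \<omega> v = 0) \<and>
         (\<forall>v i x y a b. range v \<subseteq> tangent_space A p \<and> x \<in> tangent_space A p \<and> y \<in> tangent_space A p \<longrightarrow>
            \<omega> (v(i := tvec_comb a x b y)) = a * \<omega> (v(i := x)) + b * \<omega> (v(i := y))) \<and>
         (\<forall>v i j. i \<noteq> j \<and> v i = v j \<longrightarrow> \<omega> v = 0)}"

definition wedge ::
  "('m, 'e::euclidean_space) chart set \<Rightarrow> 'm \<Rightarrow> ('k::finite \<Rightarrow> ('m, 'e) tvec \<Rightarrow> real) \<Rightarrow>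
   ('m, 'e, 'k) kform" where
  "wedge A p \<alpha> =
     (\<lambda>v. if range v \<subseteq> tangent_space A p then det ((\<chi> i j. \<alpha> i (v j)) :: real^'k^'k) else 0)"

text \<open>
  The exterior power of the tangent space, identified with the dual of the space of alternating
  forms: \<open>v\<^sub>1 \<and> \<dots> \<and> v\<^sub>k\<close> is the evaluation at \<open>(v\<^sub>1, \<dots>, v\<^sub>k)\<close>, a general element is a finite
  linear combination of such elements, and the pairing \<open>\<langle>\<omega>, u\<rangle>\<close> is \<open>u \<omega>\<close>.
\<close>

definition multivectors ::
  "('m, 'e::euclidean_space) chart set \<Rightarrow> 'm \<Rightarrow> (('m, 'e, 'k) kform \<Rightarrow> real) set" where
  "multivectors A p =
     {u. \<exists>(n::nat) (a::nat \<Rightarrow> real) v. (\<forall>l<n. range (v l) \<subseteq> tangent_space A p) \<and>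
         u = (\<lambda>\<omega>. if \<omega> \<in> alternating_forms A p then \<Sum>l<n. a l * \<omega> (v l) else 0)}"

text \<open>
  The topology of pointwise convergence of forms induces the usual topology on the
  finite-dimensional space of alternating forms, so \<open>compact\<close> has its usual meaning.
\<close>

definition convex_body ::
  "('m, 'e::euclidean_space) chart set \<Rightarrow> 'm \<Rightarrow> ('m, 'e, 'k) kform set \<Rightarrow> bool" where
  "convex_body A p K \<longleftrightarrow>
     K \<noteq> {} \<and> K \<subseteq> alternating_forms A p \<and> compact K \<and>
     (\<forall>\<alpha>\<in>K. \<forall>\<beta>\<in>K. \<forall>s\<in>{0..1}. (\<lambda>v. (1 - s) * \<alpha> v + s * \<beta> v) \<in> K)"

definition support_function ::
  "('m, 'e, 'k) kform set \<Rightarrow> (('m, 'e, 'k) kform \<Rightarrow> real) \<Rightarrow> real" where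
  "support_function K u = (SUP \<omega>\<in>K. u \<omega>)"

definition minkowski_sum ::
  "('m, 'e, 'k) kform set \<Rightarrow> ('m, 'e, 'k) kform set \<Rightarrow> ('m, 'e, 'k) kform set" where
  "minkowski_sum K L = {\<lambda>v. \<alpha> v + \<beta> v | \<alpha> \<beta>. \<alpha> \<in> K \<and> \<beta> \<in> L}"

definition dilate :: "real \<Rightarrow> ('m, 'e, 'k) kform set \<Rightarrow> ('m, 'e, 'k) kform set" where
  "dilate s K = {\<lambda>v. s * \<alpha> v | \<alpha>. \<alpha> \<in> K}"


section \<open>The space of continuously differentiable maps\<close>

definition C1_maps ::
  "('m, 'e::euclidean_space) chart set \<Rightarrow> ('m \<Rightarrow> real^'k) set" where
  "C1_maps A = {f. \<forall>c\<in>A. Ck_on 1 (f \<circ> chart_inv c) (snd c ` fst c)}"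

text \<open>The weak Whitney topology; its underlying set is \<open>C1_maps A\<close>.\<close>

definition weak_C1_nbhd ::
  "('m::topological_space, 'e::euclidean_space) chart set \<Rightarrow> ('m \<Rightarrow> real^'k) \<Rightarrow> ('m, 'e) chart \<Rightarrow>
   'm set \<Rightarrow> real \<Rightarrow> ('m \<Rightarrow> real^'k) set" where
  "weak_C1_nbhd A f c K r =
     {h \<in> C1_maps A. \<forall>x\<in>K.
        norm (h x - f x) < r \<and>
        onorm (\<lambda>v. frechet_derivative (h \<circ> chart_inv c) (at (snd c x)) v
                 - frechet_derivative (f \<circ> chart_inv c) (at (snd c x)) v) < r}"

definition weak_C1_topology ::
  "('m::topological_space, 'e::euclidean_space) chart set \<Rightarrow> ('m \<Rightarrow> real^'k) topology" where
  "weak_C1_topology A = topology_generated_by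
     {weak_C1_nbhd A f c K r | f c K r.
        f \<in> C1_maps A \<and> c \<in> A \<and> compact K \<and> K \<subseteq> fst c \<and> 0 < r}"

definition C1_borel ::
  "('m::topological_space, 'e::euclidean_space) chart set \<Rightarrow> ('m \<Rightarrow> real^'k) measure" where
  "C1_borel A = sigma (C1_maps A) {U. openin (weak_C1_topology A) U}"


section \<open>z-KROK random fields and the zonoid section\<close>

definition regular_cond_prob ::
  "('m::topological_space, 'e::euclidean_space) chart set \<Rightarrow> 'w measure \<Rightarrow>
   ('w \<Rightarrow> 'm \<Rightarrow> real^'k) \<Rightarrow> 'm \<Rightarrow> (real^'k \<Rightarrow> ('m \<Rightarrow> real^'k) measure) \<Rightarrow> bool" where
  "regular_cond_prob A P X p \<mu> \<longleftrightarrow>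
     (\<forall>x. prob_space (\<mu> x) \<and> sets (\<mu> x) = sets (C1_borel A)) \<and>
     (\<forall>B\<in>sets (C1_borel A). (\<lambda>x. emeasure (\<mu> x) B) \<in> borel_measurable borel) \<and>
     (\<forall>B\<in>sets (C1_borel A). \<forall>V\<in>sets borel.
        emeasure P {w \<in> space P. X w \<in> B \<and> X w p \<in> V} =
        (\<integral>\<^sup>+x\<in>V. emeasure (\<mu> x) B \<partial>distr P borel (\<lambda>w. X w p)))"

definition J_measure ::
  "('m, 'e::euclidean_space) chart set \<Rightarrow> ('m \<Rightarrow> ('m, 'e) tvec \<Rightarrow> ('m, 'e) tvec \<Rightarrow> real) \<Rightarrow> 'm \<Rightarrow>
   ('m \<Rightarrow> real^'k) measure \<Rightarrow> ('m \<Rightarrow> real^'k) measure" where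
  "J_measure A g p \<mu> = density \<mu> (\<lambda>f. ennreal (jacobian A g p f))"

text \<open>
  \<open>zKROK_with A g P X \<rho> \<mu>\<close>: the field \<open>X\<close> is z-KROK, as witnessed by the densities \<open>\<rho> p\<close> of
  \<open>X(p)\<close> and the regular conditional probabilities \<open>\<mu> p\<close> of \<open>X\<close> given \<open>X(p)\<close>.
\<close>

definition zKROK_with ::
  "('m::{t2_space,second_countable_topology}, 'e::euclidean_space) chart set \<Rightarrow>
   ('m \<Rightarrow> ('m, 'e) tvec \<Rightarrow> ('m, 'e) tvec \<Rightarrow> real) \<Rightarrow> 'w measure \<Rightarrow> ('w \<Rightarrow> 'm \<Rightarrow> real^'k) \<Rightarrow>
   ('m \<Rightarrow> real^'k \<Rightarrow> real) \<Rightarrow> ('m \<Rightarrow> real^'k \<Rightarrow> ('m \<Rightarrow> real^'k) measure) \<Rightarrow> bool" where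
  "zKROK_with A g P X \<rho> \<mu> \<longleftrightarrow>
     X \<in> measurable P (C1_borel A) \<and>
     (AE w in P. regular_value A (X w) 0) \<and>
     (\<forall>p. (\<forall>x. 0 \<le> \<rho> p x) \<and> distributed P lborel (\<lambda>w. X w p) (\<lambda>x. ennreal (\<rho> p x))) \<and>
     (\<forall>p. isCont (\<lambda>(q, x). \<rho> q x) (p, 0)) \<and>
     (\<forall>p. regular_cond_prob A P X p (\<mu> p)) \<and>
     (\<forall>p x. finite_measure (J_measure A g p (\<mu> p x))) \<and>
     (\<forall>\<Psi>. continuous_map (weak_C1_topology A) euclideanreal \<Psi> \<and> bounded (\<Psi> ` C1_maps A) \<longrightarrow>
        (\<forall>p. isCont (\<lambda>(q, x). \<integral>f. \<Psi> f \<partial>J_measure A g q (\<mu> q x)) (p, 0)))"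

definition zKROK ::
  "('m::{t2_space,second_countable_topology}, 'e::euclidean_space) chart set \<Rightarrow>
   ('m \<Rightarrow> ('m, 'e) tvec \<Rightarrow> ('m, 'e) tvec \<Rightarrow> real) \<Rightarrow> 'w measure \<Rightarrow> ('w \<Rightarrow> 'm \<Rightarrow> real^'k) \<Rightarrow> bool" where
  "zKROK A g P X \<longleftrightarrow> (\<exists>\<rho> \<mu>. zKROK_with A g P X \<rho> \<mu>)"

text \<open>
  The zonoid section depends on the field only through the densities \<open>\<rho>\<close> and the conditional
  probabilities \<open>\<mu>\<close>.
\<close>

definition zonoid_section ::
  "('m, 'e::euclidean_space) chart set \<Rightarrow> ('m \<Rightarrow> real^'k \<Rightarrow> real) \<Rightarrow>
   ('m \<Rightarrow> real^'k \<Rightarrow> ('m \<Rightarrow> real^'k) measure) \<Rightarrow> 'm \<Rightarrow> ('m, 'e, 'k) kform set" where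
  "zonoid_section A \<rho> \<mu> p =
     (THE K. convex_body A p K \<and>
        (\<forall>u\<in>multivectors A p. support_function K u =
           \<rho> p 0 * (\<integral>f. max 0 (u (wedge A p (d_component A p f))) \<partial>\<mu> p 0)))"

definition independent_of ::
  "'w measure \<Rightarrow> ('w \<Rightarrow> 'a) \<Rightarrow> 'a measure \<Rightarrow> ('w \<Rightarrow> 'b) \<Rightarrow> 'b measure \<Rightarrow> bool" where
  "independent_of P Y M Z N \<longleftrightarrow>
     prob_space.indep_set P (sets (vimage_algebra (space P) Y M)) (sets (vimage_algebra (space P) Z N))"

end

theory Submission
  imports Defs
begin

text \<open>
  Since \<open>\<epsilon>\<close> is independent of the fields, the law of \<open>X\<^sub>t\<close> is the mixture of the laws of \<open>X\<^sub>0\<close> and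
  \<open>X\<^sub>1\<close> with weights \<open>1 - t\<close> and \<open>t\<close>. Hence \<open>X\<^sub>t(p)\<close> has density \<open>\<rho>\<^sub>t = (1 - t) \<rho>\<^sub>0 + t \<rho>\<^sub>1\<close>, and by
  Bayes' formula the conditional law of \<open>X\<^sub>t\<close> is \<open>a \<mu>\<^sub>0 + (1 - a) \<mu>\<^sub>1\<close> with \<open>a \<rho>\<^sub>t = (1 - t) \<rho>\<^sub>0\<close>; the
  weight \<open>a\<close> is continuous at \<open>(p, 0)\<close> because \<open>\<rho>\<^sub>0\<close> and \<open>\<rho>\<^sub>1\<close> have no common zero there.

  Conditional laws are unique up to null sets, so for two witnesses of the z-KROK property the
  integrals of \<open>J\<^sub>p\<close> times a bounded continuous function agree where the density is positive, first
  for almost every value of the field and then, by continuity, at \<open>0\<close>. The integrands \<open>max {0, \<langle>d\<^sub>pf\<^sup>1 \<and> \<dots> \<and> d\<^sub>pf\<^sup>k, u\<rangle>}\<close> are continuous and bounded by a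
  multiple of \<open>J\<^sub>p\<close> (Cauchy-Schwarz for Gram determinants), hence they are limits of such test
  functions. The support function of the zonoid section is therefore independent of the witness and
  additive under mixing, and a convex body is determined by its support function.
\<close>

subsection \<open>Convex bodies of alternating forms\<close>

text \<open>The event that \<open>X(p)\<close> equals 0 is null, so the conditional law at 0 has a
  meaning only through the continuity required of a witness; where the density vanishes at 0 it need
  not be determined. This is why the conclusion speaks of every witness for the mixed field, and why
  uniqueness of the integrals is stated for their products with \<open>\<rho> p 0\<close>. Such
  zeros can occur for t in {0, 1}, where one component alone decides. Zonoid sections are given by a
  definite description, so a convex body with the prescribed support function must be constructed
  before anything can be computed. Forms live in a function type with pointwise convergence and not
  in a Euclidean type; Tychonoff's theorem and separation in finitely many coordinates take the
  place of finite-dimensional convex geometry. The only integrability provided by a witness is that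
  of the Jacobian, so every integrand has to be dominated by it.\<close>

lemma alternating_formsD:
  assumes "\<omega> \<in> alternating_forms A p"
  shows "\<not> range v \<subseteq> tangent_space A p \<Longrightarrow> \<omega> v = 0"
    and "range v \<subseteq> tangent_space A p \<Longrightarrow> x \<in> tangent_space A p \<Longrightarrow> y \<in> tangent_space A p \<Longrightarrow>
      \<omega> (v(i := tvec_comb a x b y)) = a * \<omega> (v(i := x)) + b * \<omega> (v(i := y))"
    and "i \<noteq> j \<Longrightarrow> v i = v j \<Longrightarrow> \<omega> v = 0"
  using assms unfolding alternating_forms_def mem_Collect_eq by metis+

lemma alternating_forms_comb:
  assumes "\<alpha> \<in> alternating_forms A p" "\<beta> \<in> alternating_forms A p"
  shows "(\<lambda>v. s * \<alpha> v + r * \<beta> v) \<in> alternating_forms A p"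
  unfolding alternating_forms_def
  by (auto simp: alternating_formsD[OF assms(1)] alternating_formsD[OF assms(2)] algebra_simps
      intro: alternating_formsD(3)[OF assms(1)] alternating_formsD(3)[OF assms(2)])

lemma multivectors_comb:
  assumes "u \<in> multivectors A p" "\<alpha> \<in> alternating_forms A p" "\<beta> \<in> alternating_forms A p"
  shows "u (\<lambda>v. s * \<alpha> v + r * \<beta> v) = s * u \<alpha> + r * u \<beta>"
proof -
  obtain n :: nat and a :: "nat \<Rightarrow> real" and v
    where u: "u = (\<lambda>\<omega>. if \<omega> \<in> alternating_forms A p then \<Sum>l<n. a l * \<omega> (v l) else 0)"
    using assms(1) unfolding multivectors_def by blast
  show ?thesis
    using assms alternating_forms_comb[OF assms(2,3), of s r]
    by (simp add: u sum.distrib sum_distrib_left algebra_simps)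
qed

lemma multivectors_continuous_on:
  assumes "u \<in> multivectors A p"
  shows "continuous_on (alternating_forms A p) u"
proof -
  obtain n :: nat and a :: "nat \<Rightarrow> real" and v
    where u: "u = (\<lambda>\<omega>. if \<omega> \<in> alternating_forms A p then \<Sum>l<n. a l * \<omega> (v l) else 0)"
    using assms(1) unfolding multivectors_def by blast
  have "continuous_on (alternating_forms A p) (\<lambda>\<omega>. \<Sum>l<n. a l * \<omega> (v l))"
    by (intro continuous_intros continuous_on_subset[OF continuous_on_product_coordinates]) auto
  then show ?thesis
    by (rule continuous_on_eq) (simp add: u)
qed

text \<open>The sums in \<open>multivectors\<close> are indexed by \<open>l < n\<close>; an
  enumeration carries over to them a sum over a finite set of tuples.\<close>

lemma multivectors_finite_sum:
  fixes V :: "('k \<Rightarrow> ('m, 'e::euclidean_space) tvec) set" and a :: "('k \<Rightarrow> ('m, 'e) tvec) \<Rightarrow> real"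
  assumes "finite V" "\<And>v. v \<in> V \<Longrightarrow> range v \<subseteq> tangent_space A p"
  shows "\<exists>u\<in>multivectors A p. \<forall>\<omega>\<in>alternating_forms A p. u \<omega> = (\<Sum>v\<in>V. a v * \<omega> v)"
proof -
  obtain h where h: "bij_betw h {..<card V} V"
    using ex_bij_betw_nat_finite[OF assms(1)] by (auto simp: atLeast0LessThan)
  define u where "u = (\<lambda>\<omega>. if \<omega> \<in> alternating_forms A p then \<Sum>l<card V. a (h l) * \<omega> (h l) else 0)"
  have "u \<in> multivectors A p"
    unfolding multivectors_def mem_Collect_eq u_def
    by (intro exI[of _ "card V"] exI[of _ "a \<circ> h"] exI[of _ h] conjI)
       (use h assms(2) in \<open>auto simp: bij_betw_def\<close>)
  moreover have "u \<omega> = (\<Sum>v\<in>V. a v * \<omega> v)" if "\<omega> \<in> alternating_forms A p" for \<omega>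
    using that sum.reindex_bij_betw[OF h, of "\<lambda>v. a v * \<omega> v"] by (simp add: u_def)
  ultimately show ?thesis by blast
qed

lemma multivector_evaluation:
  fixes v :: "'k \<Rightarrow> ('m, 'e::euclidean_space) tvec"
  assumes "range v \<subseteq> tangent_space A p"
  shows "\<exists>u\<in>multivectors A p. \<forall>\<omega>\<in>alternating_forms A p. u \<omega> = c * \<omega> v"
  using multivectors_finite_sum[of "{v}" A p "\<lambda>_. c"] assms by auto

section \<open>Support functions of convex bodies\<close>

lemma convex_bodyD:
  assumes "convex_body A p K"
  shows "K \<noteq> {}" "K \<subseteq> alternating_forms A p" "compact K"
    "\<alpha> \<in> K \<Longrightarrow> \<beta> \<in> K \<Longrightarrow> s \<in> {0..1} \<Longrightarrow> (\<lambda>v. (1 - s) * \<alpha> v + s * \<beta> v) \<in> K"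
  using assms unfolding convex_body_def by blast+

text \<open>Compactness bounds \<open>u\<close> on \<open>K\<close>; without an upper bound the real
  \<open>SUP\<close> in \<open>support_function\<close> would carry no information.\<close>

lemma support_function_upper:
  assumes "convex_body A p K" "u \<in> multivectors A p" "\<omega> \<in> K"
  shows "u \<omega> \<le> support_function K u"
proof -
  have "compact (u ` K)"
    by (intro compact_continuous_image convex_bodyD(3)[OF assms(1)]
        continuous_on_subset[OF multivectors_continuous_on[OF assms(2)] convex_bodyD(2)[OF assms(1)]])
  then have "bdd_above (u ` K)"
    by (intro bounded_imp_bdd_above compact_imp_bounded)
  then show ?thesis
    unfolding support_function_def using assms(3) by (intro cSUP_upper)
qed

lemma support_function_least:
  assumes "convex_body A p K" "\<And>\<omega>. \<omega> \<in> K \<Longrightarrow> u \<omega> \<le> b"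
  shows "support_function K u \<le> b"
  unfolding support_function_def by (intro cSUP_least convex_bodyD(1)[OF assms(1)] assms(2))

text \<open>
  If \<open>\<omega> \<notin> L\<close>, compactness yields finitely many coordinates \<open>V\<close> that already separate \<open>\<omega>\<close> from
  every point of \<open>L\<close>; the multivector separating \<open>\<omega>\<close> from its \<open>V\<close>-nearest point in \<open>L\<close> replaces
  the Hahn-Banach theorem.
\<close>

lemma convex_body_subset:
  assumes K: "convex_body A p K" and L: "convex_body A p L"
    and le: "\<And>u. u \<in> multivectors A p \<Longrightarrow> support_function K u \<le> support_function L u"
  shows "K \<subseteq> L"
proof (rule ccontr)
  assume "\<not> K \<subseteq> L"
  then obtain \<omega> where \<omega>: "\<omega> \<in> K" "\<omega> \<notin> L" by blast
  have \<omega>A: "\<omega> \<in> alternating_forms A p" and LA: "L \<subseteq> alternating_forms A p"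
    using \<omega>(1) convex_bodyD(2)[OF K] convex_bodyD(2)[OF L] by blast+
  have op: "open {\<eta>. \<eta> v \<noteq> \<omega> v}" for v
  proof -
    have "{\<eta>. \<eta> v \<noteq> \<omega> v} = (\<lambda>\<eta>. \<eta> v) -` (- {\<omega> v})" by auto
    then show ?thesis
      using open_vimage[OF _ continuous_on_product_coordinates, of "- {\<omega> v}" v] by auto
  qed
  have cov: "L \<subseteq> (\<Union>v\<in>UNIV. {\<eta>. \<eta> v \<noteq> \<omega> v})"
  proof
    fix \<eta> assume "\<eta> \<in> L"
    then have "\<eta> \<noteq> \<omega>" using \<omega>(2) by blast
    then show "\<eta> \<in> (\<Union>v\<in>UNIV. {\<eta>. \<eta> v \<noteq> \<omega> v})" by (auto simp: fun_eq_iff)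
  qed
  have cL: "compact L" "L \<noteq> {}" using convex_bodyD(3)[OF L] convex_bodyD(1)[OF L] .
  obtain W where W: "finite W" "L \<subseteq> (\<Union>v\<in>W. {\<eta>. \<eta> v \<noteq> \<omega> v})"
    by (rule compactE_image[OF cL(1) op cov])
  define V where "V = {v\<in>W. range v \<subseteq> tangent_space A p}"
  have V: "finite V" "\<And>v. v \<in> V \<Longrightarrow> range v \<subseteq> tangent_space A p"
    using W by (auto simp: V_def)
  define Q where "Q \<eta> = (\<Sum>v\<in>V. (\<eta> v - \<omega> v)\<^sup>2)" for \<eta>
  have Qpos: "Q \<eta> > 0" if \<eta>L: "\<eta> \<in> L" for \<eta>
  proof -
    obtain v where v: "v \<in> W" "\<eta> v \<noteq> \<omega> v" using subsetD[OF W(2) \<eta>L] by blast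
    have "range v \<subseteq> tangent_space A p"
      using v(2) alternating_formsD(1)[OF \<omega>A, of v] alternating_formsD(1)[OF subsetD[OF LA \<eta>L], of v]
      by metis
    then have "v \<in> V" using v by (simp add: V_def)
    moreover have "(\<eta> v - \<omega> v)\<^sup>2 > 0" using v by simp
    ultimately show ?thesis
      unfolding Q_def using V(1) by (intro sum_pos2[of _ v]) auto
  qed
  have "continuous_on L Q"
    unfolding Q_def
    by (intro continuous_intros continuous_on_subset[OF continuous_on_product_coordinates]) auto
  then obtain \<theta> where \<theta>: "\<theta> \<in> L" "\<And>\<eta>. \<eta> \<in> L \<Longrightarrow> Q \<theta> \<le> Q \<eta>"
    using continuous_attains_inf[OF cL] by blast
  obtain u where u: "u \<in> multivectors A p"
    "\<And>\<alpha>. \<alpha> \<in> alternating_forms A p \<Longrightarrow> u \<alpha> = (\<Sum>v\<in>V. (\<omega> v - \<theta> v) * \<alpha> v)"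
    using multivectors_finite_sum[OF V, of "\<lambda>v. \<omega> v - \<theta> v"] by blast
  \<comment> \<open>First-order optimality of the nearest point \<theta>: a point of
    \<open>L\<close> with larger \<open>u\<close> would allow a small move from \<theta> that
    decreases \<open>Q\<close>.\<close>
  have "u \<eta> \<le> u \<theta>" if \<eta>: "\<eta> \<in> L" for \<eta>
  proof (rule ccontr)
    assume "\<not> u \<eta> \<le> u \<theta>"
    define d where "d = u \<eta> - u \<theta>"
    have d: "d > 0" using \<open>\<not> u \<eta> \<le> u \<theta>\<close> by (simp add: d_def)
    define R where "R = (\<Sum>v\<in>V. (\<eta> v - \<theta> v)\<^sup>2)"
    have R: "R \<ge> 0" unfolding R_def by (intro sum_nonneg) auto
    \<comment> \<open>Moving by \<open>s\<close> changes \<open>Q\<close> by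
      \<open>s\<^sup>2 * R - 2 * s * d\<close>, which is negative once \<open>s * R \<le> d\<close>.
      The summand 1 covers \<open>R = 0\<close>, and the cap 1 keeps the moved point in
      \<open>L\<close>.\<close>
    define s where "s = min 1 (d / (R + 1))"
    have "s * (R + 1) \<le> d / (R + 1) * (R + 1)"
      using R unfolding s_def by (intro mult_right_mono) auto
    then have s: "0 < s" "s \<le> 1" "s * (R + 1) \<le> d"
      using d R by (auto simp: s_def)
    have "(\<lambda>v. (1 - s) * \<theta> v + s * \<eta> v) \<in> L"
      using convex_bodyD(4)[OF L \<theta>(1) \<eta>, of s] s by auto
    then have "Q \<theta> \<le> Q (\<lambda>v. (1 - s) * \<theta> v + s * \<eta> v)" by (rule \<theta>(2))
    also have "\<dots> = Q \<theta> - 2 * s * (\<Sum>v\<in>V. (\<omega> v - \<theta> v) * (\<eta> v - \<theta> v)) + s\<^sup>2 * R"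
      unfolding Q_def R_def sum_distrib_left sum_subtractf[symmetric] sum.distrib[symmetric]
      by (intro sum.cong refl) (simp add: power2_eq_square algebra_simps)
    also have "(\<Sum>v\<in>V. (\<omega> v - \<theta> v) * (\<eta> v - \<theta> v)) = d"
      unfolding d_def u(2)[OF subsetD[OF LA \<eta>]] u(2)[OF subsetD[OF LA \<theta>(1)]]
      by (simp add: sum_subtractf right_diff_distrib)
    finally have "s * (2 * d) \<le> s * (s * R)" by (simp add: power2_eq_square)
    then have "2 * d \<le> s * R" using s(1) by (rule mult_left_le_imp_le)
    then show False using s d by (simp add: distrib_left)
  qed
  then have "support_function L u \<le> u \<theta>" by (rule support_function_least[OF L])
  also have "u \<theta> = u \<omega> - Q \<theta>"
    unfolding u(2)[OF \<omega>A] u(2)[OF subsetD[OF LA \<theta>(1)]] Q_def sum_subtractf[symmetric]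
    by (intro sum.cong refl) (simp add: power2_eq_square algebra_simps)
  also have "\<dots> < u \<omega>" using Qpos[OF \<theta>(1)] by simp
  also have "\<dots> \<le> support_function K u" by (rule support_function_upper[OF K u(1) \<omega>(1)])
  also have "\<dots> \<le> support_function L u" by (rule le[OF u(1)])
  finally show False by simp
qed

lemma convex_body_eqI:
  assumes "convex_body A p K" "convex_body A p L"
    and "\<And>u. u \<in> multivectors A p \<Longrightarrow> support_function K u = support_function L u"
  shows "K = L"
  using assms convex_body_subset[of A p K L] convex_body_subset[of A p L K] by auto

text \<open>Written as an image, the combination is compact because the map is continuous on the
  compact product.\<close>

lemma minkowski_comb_eq:
  "minkowski_sum (dilate s K) (dilate r L) = (\<lambda>(\<alpha>, \<beta>) v. s * \<alpha> v + r * \<beta> v) ` (K \<times> L)"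
  unfolding minkowski_sum_def dilate_def by (force simp: image_iff)

lemma convex_body_minkowski_comb:
  assumes K: "convex_body A p K" and L: "convex_body A p L"
  shows "convex_body A p (minkowski_sum (dilate s K) (dilate r L))"
  unfolding convex_body_def minkowski_comb_eq
proof (intro conjI ballI)
  let ?F = "\<lambda>(\<alpha>, \<beta>) v. s * \<alpha> v + r * \<beta> v"
  show "?F ` (K \<times> L) \<noteq> {}"
    using convex_bodyD(1)[OF K] convex_bodyD(1)[OF L] by blast
  show "?F ` (K \<times> L) \<subseteq> alternating_forms A p"
  proof (clarify, rule alternating_forms_comb)
    fix \<alpha> \<beta> assume "\<alpha> \<in> K" "\<beta> \<in> L"
    then show "\<alpha> \<in> alternating_forms A p" "\<beta> \<in> alternating_forms A p"
      using convex_bodyD(2)[OF K] convex_bodyD(2)[OF L] by blast+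
  qed
  have coord: "continuous_on (K \<times> L) (\<lambda>x. fst x v)" "continuous_on (K \<times> L) (\<lambda>x. snd x v)" for v
    by (rule continuous_on_compose2[OF continuous_on_product_coordinates[of v]];
        (intro continuous_intros | simp))+
  have "continuous_on (K \<times> L) ?F"
    unfolding split_beta
    by (intro continuous_on_coordinatewise_then_product continuous_on_add continuous_on_mult
        continuous_on_const coord)
  then show "compact (?F ` (K \<times> L))"
    by (intro compact_continuous_image compact_Times convex_bodyD(3)[OF K] convex_bodyD(3)[OF L])
  fix x y and q :: real
  assume "x \<in> ?F ` (K \<times> L)" "y \<in> ?F ` (K \<times> L)" and q: "q \<in> {0..1}"
  then obtain \<alpha> \<beta> \<alpha>' \<beta>' where
    x: "x = (\<lambda>v. s * \<alpha> v + r * \<beta> v)" "\<alpha> \<in> K" "\<beta> \<in> L" and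
    y: "y = (\<lambda>v. s * \<alpha>' v + r * \<beta>' v)" "\<alpha>' \<in> K" "\<beta>' \<in> L" by (auto elim!: imageE)
  have "(\<lambda>v. (1 - q) * \<alpha> v + q * \<alpha>' v) \<in> K" "(\<lambda>v. (1 - q) * \<beta> v + q * \<beta>' v) \<in> L"
    using convex_bodyD(4)[OF K x(2) y(2) q] convex_bodyD(4)[OF L x(3) y(3) q] .
  then have "((\<lambda>v. (1 - q) * \<alpha> v + q * \<alpha>' v), (\<lambda>v. (1 - q) * \<beta> v + q * \<beta>' v)) \<in> K \<times> L"
    by blast
  moreover have "(\<lambda>v. (1 - q) * x v + q * y v) =
    ?F ((\<lambda>v. (1 - q) * \<alpha> v + q * \<alpha>' v), (\<lambda>v. (1 - q) * \<beta> v + q * \<beta>' v))"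
    by (simp add: x(1) y(1) algebra_simps)
  ultimately show "(\<lambda>v. (1 - q) * x v + q * y v) \<in> ?F ` (K \<times> L)"
    by (rule rev_image_eqI)
qed

lemma support_function_attained:
  assumes "convex_body A p K" "u \<in> multivectors A p"
  obtains \<omega> where "\<omega> \<in> K" "support_function K u = u \<omega>"
proof -
  have "\<exists>\<omega>\<in>K. \<forall>\<eta>\<in>K. u \<eta> \<le> u \<omega>"
    by (intro continuous_attains_sup convex_bodyD[OF assms(1)]
        continuous_on_subset[OF multivectors_continuous_on[OF assms(2)] convex_bodyD(2)[OF assms(1)]])
  then obtain \<omega> where \<omega>: "\<omega> \<in> K" "\<And>\<eta>. \<eta> \<in> K \<Longrightarrow> u \<eta> \<le> u \<omega>" by auto
  have "support_function K u = u \<omega>"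
    by (intro order_antisym support_function_least[OF assms(1)] support_function_upper[OF assms] \<omega>)
  with \<omega>(1) show thesis by (rule that)
qed

text \<open>The points of \<open>K\<close> and \<open>L\<close> are chosen independently,
  \<open>u\<close> is linear on forms, and nonnegative factors preserve the order. For the lower
  bound, the two maximisers are combined.\<close>

lemma support_function_minkowski_comb:
  assumes K: "convex_body A p K" and L: "convex_body A p L" and u: "u \<in> multivectors A p"
    and nn: "0 \<le> s" "0 \<le> r"
  shows "support_function (minkowski_sum (dilate s K) (dilate r L)) u
    = s * support_function K u + r * support_function L u"
proof (rule order_antisym)
  note M = convex_body_minkowski_comb[OF K L, of s r]
  have alt: "K \<subseteq> alternating_forms A p" "L \<subseteq> alternating_forms A p"
    using convex_bodyD(2)[OF K] convex_bodyD(2)[OF L] .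
  show "support_function (minkowski_sum (dilate s K) (dilate r L)) u
    \<le> s * support_function K u + r * support_function L u"
  proof (rule support_function_least[OF M])
    fix \<omega> assume "\<omega> \<in> minkowski_sum (dilate s K) (dilate r L)"
    then obtain \<alpha> \<beta> where \<omega>: "\<omega> = (\<lambda>v. s * \<alpha> v + r * \<beta> v)" and \<alpha>: "\<alpha> \<in> K" and \<beta>: "\<beta> \<in> L"
      unfolding minkowski_comb_eq by (auto elim!: imageE)
    show "u \<omega> \<le> s * support_function K u + r * support_function L u"
      unfolding \<omega> multivectors_comb[OF u subsetD[OF alt(1) \<alpha>] subsetD[OF alt(2) \<beta>]]
      by (intro add_mono mult_left_mono nn support_function_upper[OF K u \<alpha>] support_function_upper[OF L u \<beta>])
  qed
  obtain \<alpha> where \<alpha>: "\<alpha> \<in> K" "support_function K u = u \<alpha>"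
    by (rule support_function_attained[OF K u])
  obtain \<beta> where \<beta>: "\<beta> \<in> L" "support_function L u = u \<beta>"
    by (rule support_function_attained[OF L u])
  have "(\<lambda>v. s * \<alpha> v + r * \<beta> v) \<in> minkowski_sum (dilate s K) (dilate r L)"
    unfolding minkowski_comb_eq by (rule rev_image_eqI[OF SigmaI[OF \<alpha>(1) \<beta>(1)]]) simp
  from support_function_upper[OF M u this]
  show "s * support_function K u + r * support_function L u
    \<le> support_function (minkowski_sum (dilate s K) (dilate r L)) u"
    unfolding \<alpha>(2) \<beta>(2) multivectors_comb[OF u subsetD[OF alt(1) \<alpha>(1)] subsetD[OF alt(2) \<beta>(1)]] .
qed

text \<open>Multilinearity in one slot and vanishing at a tuple are both relations of this shape
  among coordinates, so the alternating forms are an intersection of closed sets.\<close>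

lemma closed_linear_relation: "closed {\<omega>. \<omega> v = a * \<omega> w + b * (\<omega> z :: real)}"
  by (intro closed_Collect_eq continuous_on_add continuous_on_mult continuous_on_const
      continuous_on_product_coordinates)

lemma closed_alternating_forms: "closed (alternating_forms A p)"
proof -
  have z: "closed {\<omega>. \<omega> v = (0::real)}" for v :: "'k \<Rightarrow> ('m, 'e::euclidean_space) tvec"
    using closed_linear_relation[of v 0 v 0 v] by simp
  have imp: "closed {\<omega> :: ('m, 'e, 'k) kform. Q \<longrightarrow> R \<omega>}" if "closed {\<omega>. R \<omega>}" for Q R
    using that by (cases Q) auto
  show ?thesis
    unfolding alternating_forms_def
    by (rule closed_Collect_conj closed_Collect_all imp z closed_linear_relation)+
qed

text \<open>
  The zonoid is the body cut out by all inequalities \<open>u \<omega> \<le> h u\<close>; the bound in direction \<open>u\<close>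
  is attained at the average of \<open>\<omega> f\<close> over the half space \<open>{u > 0}\<close>.
\<close>

lemma zonoid_exists:
  fixes \<omega> :: "'f \<Rightarrow> ('m, 'e::euclidean_space, 'k) kform"
  assumes alt: "\<And>f. f \<in> space M \<Longrightarrow> \<omega> f \<in> alternating_forms A p"
    and int: "\<And>v. integrable M (\<lambda>f. \<omega> f v)" and c: "0 \<le> c"
  shows "\<exists>K. convex_body A p K \<and>
    (\<forall>u\<in>multivectors A p. support_function K u = c * (\<integral>f. max 0 (u (\<omega> f)) \<partial>M))"
proof -
  define h where "h u = c * (\<integral>f. max 0 (u (\<omega> f)) \<partial>M)" for u :: "('m, 'e, 'k) kform \<Rightarrow> real"
  define K where "K = {\<eta> \<in> alternating_forms A p. \<forall>u\<in>multivectors A p. u \<eta> \<le> h u}"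
  \<comment> \<open>\<open>ct u\<close> is the point where the body is to touch its supporting
    hyperplane in direction \<open>u\<close>.\<close>
  define ct where "ct u v = c * (\<integral>f. (if u (\<omega> f) > 0 then \<omega> f v else 0) \<partial>M)"
    for u :: "('m, 'e, 'k) kform \<Rightarrow> real" and v
  have intu: "integrable M (\<lambda>f. u (\<omega> f))" if u: "u \<in> multivectors A p" for u
  proof -
    obtain n :: nat and a :: "nat \<Rightarrow> real" and v
      where U: "u = (\<lambda>\<omega>. if \<omega> \<in> alternating_forms A p then \<Sum>l<n. a l * \<omega> (v l) else 0)"
      using u unfolding multivectors_def by blast
    have "integrable M (\<lambda>f. \<Sum>l<n. a l * \<omega> f (v l))"
      by (intro Bochner_Integration.integrable_sum integrable_mult_right int)
    moreover have "integrable M (\<lambda>f. u (\<omega> f)) = integrable M (\<lambda>f. \<Sum>l<n. a l * \<omega> f (v l))"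
      by (rule Bochner_Integration.integrable_cong) (simp_all add: U alt)
    ultimately show ?thesis by simp
  qed
  have intt: "integrable M (\<lambda>f. if u (\<omega> f) > 0 then \<phi> f else 0)"
    if u: "u \<in> multivectors A p" and \<phi>: "integrable M \<phi>" for u and \<phi> :: "'f \<Rightarrow> real"
  proof -
    have [measurable]: "(\<lambda>f. u (\<omega> f)) \<in> borel_measurable M" "\<phi> \<in> borel_measurable M"
      using intu[OF u] \<phi> by auto
    show ?thesis by (rule Bochner_Integration.integrable_bound[OF \<phi>]) auto
  qed
  have ctA: "ct u \<in> alternating_forms A p" if u: "u \<in> multivectors A p" for u
    unfolding alternating_forms_def mem_Collect_eq
  proof (intro conjI allI impI)
    fix v :: "'k \<Rightarrow> ('m, 'e) tvec" assume v: "\<not> range v \<subseteq> tangent_space A p"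
    have "(\<integral>f. (if u (\<omega> f) > 0 then \<omega> f v else 0) \<partial>M) = (\<integral>f. 0 \<partial>M)"
      by (rule Bochner_Integration.integral_cong) (simp_all add: alternating_formsD(1)[OF alt v])
    then show "ct u v = 0" by (simp add: ct_def)
  next
    fix v :: "'k \<Rightarrow> ('m, 'e) tvec" and i x y a b
    assume H: "range v \<subseteq> tangent_space A p \<and> x \<in> tangent_space A p \<and> y \<in> tangent_space A p"
    have "ct u (v(i := tvec_comb a x b y)) =
      c * (\<integral>f. a * (if u (\<omega> f) > 0 then \<omega> f (v(i := x)) else 0) + b * (if u (\<omega> f) > 0 then \<omega> f (v(i := y)) else 0) \<partial>M)"
      unfolding ct_def using H
      by (intro arg_cong[where f = "(*) c"] Bochner_Integration.integral_cong refl)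
         (simp add: alternating_formsD(2)[OF alt])
    also have "\<dots> = a * ct u (v(i := x)) + b * ct u (v(i := y))"
      unfolding ct_def
      by (subst Bochner_Integration.integral_add)
         (simp_all add: intt[OF u int] algebra_simps)
    finally show "ct u (v(i := tvec_comb a x b y)) = a * ct u (v(i := x)) + b * ct u (v(i := y))" .
  next
    fix v :: "'k \<Rightarrow> ('m, 'e) tvec" and i j :: 'k assume ij: "i \<noteq> j \<and> v i = v j"
    have "(\<integral>f. (if u (\<omega> f) > 0 then \<omega> f v else 0) \<partial>M) = (\<integral>f. 0 \<partial>M)"
      using ij by (intro Bochner_Integration.integral_cong refl)
        (simp add: alternating_formsD(3)[OF alt, of _ i j v])
    then show "ct u v = 0" by (simp add: ct_def)
  qed
  have ct_eval: "u' (ct u) = c * (\<integral>f. (if u (\<omega> f) > 0 then u' (\<omega> f) else 0) \<partial>M)"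
    if u: "u \<in> multivectors A p" and u': "u' \<in> multivectors A p" for u u'
  proof -
    obtain n :: nat and a :: "nat \<Rightarrow> real" and v
      where U: "u' = (\<lambda>\<omega>. if \<omega> \<in> alternating_forms A p then \<Sum>l<n. a l * \<omega> (v l) else 0)"
      using u' unfolding multivectors_def by blast
    have "u' (ct u) = (\<Sum>l<n. a l * ct u (v l))" unfolding U by (simp add: ctA[OF u])
    also have "\<dots> = c * (\<integral>f. (\<Sum>l<n. a l * (if u (\<omega> f) > 0 then \<omega> f (v l) else 0)) \<partial>M)"
      by (subst Bochner_Integration.integral_sum)
         (simp_all add: intt[OF u int] ct_def sum_distrib_left mult_ac)
    also have "(\<integral>f. (\<Sum>l<n. a l * (if u (\<omega> f) > 0 then \<omega> f (v l) else 0)) \<partial>M)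
      = (\<integral>f. (if u (\<omega> f) > 0 then u' (\<omega> f) else 0) \<partial>M)"
      unfolding U by (intro Bochner_Integration.integral_cong refl) (simp add: alt)
    finally show ?thesis .
  qed
  have intm: "integrable M (\<lambda>f. max 0 (u (\<omega> f)))" if "u \<in> multivectors A p" for u
    by (rule Bochner_Integration.integrable_max[OF Bochner_Integration.integrable_zero intu[OF that]])
  have ctK: "ct u \<in> K" if u: "u \<in> multivectors A p" for u
  proof -
    \<comment> \<open>Restricting \<open>u'\<close> to any set, here to \<open>u > 0\<close>, leaves
      a function below its positive part; for \<open>u' = u\<close> the two agree, which gives
      \<open>cth\<close>.\<close>
    have "u' (ct u) \<le> h u'" if u': "u' \<in> multivectors A p" for u'
      unfolding ct_eval[OF u u'] h_def
      by (intro mult_left_mono c integral_mono intt[OF u intu[OF u']] intm[OF u']) auto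
    then show ?thesis using ctA[OF u] by (auto simp: K_def)
  qed
  have cth: "u (ct u) = h u" if u: "u \<in> multivectors A p" for u
    unfolding ct_eval[OF u u] h_def
    by (intro arg_cong[where f = "(*) c"] Bochner_Integration.integral_cong) auto
  have body: "convex_body A p K"
    unfolding convex_body_def
  proof (intro conjI ballI)
    \<comment> \<open>The empty sum is a multivector, so at least one contact point is
      available.\<close>
    obtain u0 :: "('m, 'e, 'k) kform \<Rightarrow> real" where "u0 \<in> multivectors A p"
      using bexE[OF multivectors_finite_sum[OF finite.emptyI, of A p "\<lambda>_. 0"]] by (metis empty_iff)
    then show "K \<noteq> {}" using ctK by auto
    show KA: "K \<subseteq> alternating_forms A p" by (auto simp: K_def)
    show "(\<lambda>v. (1 - s) * \<alpha> v + s * \<beta> v) \<in> K" if "\<alpha> \<in> K" "\<beta> \<in> K" "s \<in> {0..1}" for \<alpha> \<beta> s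
    proof -
      have "u (\<lambda>v. (1 - s) * \<alpha> v + s * \<beta> v) \<le> h u" if "u \<in> multivectors A p" for u
      proof -
        have "u (\<lambda>v. (1 - s) * \<alpha> v + s * \<beta> v) = (1 - s) * u \<alpha> + s * u \<beta>"
          using \<open>\<alpha> \<in> K\<close> \<open>\<beta> \<in> K\<close> KA that by (intro multivectors_comb) auto
        also have "\<dots> \<le> (1 - s) * h u + s * h u"
          using \<open>\<alpha> \<in> K\<close> \<open>\<beta> \<in> K\<close> \<open>s \<in> {0..1}\<close> that
          by (intro add_mono mult_left_mono) (auto simp: K_def)
        finally show ?thesis by (simp add: algebra_simps)
      qed
      then show ?thesis
        using that KA alternating_forms_comb[of \<alpha> A p \<beta> "1 - s" s] by (auto simp: K_def)
    qed
    \<comment> \<open>Evaluation at \<open>v\<close> and its negative are both multivectors, so two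
      of the defining inequalities bound the coordinate; outside the tangent space it is 0.\<close>
    have bnd: "\<exists>b. \<forall>\<eta>\<in>K. \<bar>\<eta> v\<bar> \<le> b" for v
    proof (cases "range v \<subseteq> tangent_space A p")
      case True
      obtain u where u: "u \<in> multivectors A p"
        "\<And>\<omega>. \<omega> \<in> alternating_forms A p \<Longrightarrow> u \<omega> = 1 * \<omega> v"
        using multivector_evaluation[OF True] by blast
      obtain u' where u': "u' \<in> multivectors A p"
        "\<And>\<omega>. \<omega> \<in> alternating_forms A p \<Longrightarrow> u' \<omega> = -1 * \<omega> v"
        using multivector_evaluation[OF True] by blast
      have "\<bar>\<eta> v\<bar> \<le> max (h u) (h u')" if "\<eta> \<in> K" for \<eta>
      proof -
        have "\<eta> \<in> alternating_forms A p" "u \<eta> \<le> h u" "u' \<eta> \<le> h u'"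
          using that u(1) u'(1) unfolding K_def by blast+
        then show ?thesis using u(2)[of \<eta>] u'(2)[of \<eta>] by simp
      qed
      then show ?thesis by blast
    next
      case False
      then have "\<eta> v = 0" if "\<eta> \<in> K" for \<eta>
        using alternating_formsD(1)[OF subsetD[OF KA that]] by simp
      then show ?thesis by (intro exI[of _ 0]) simp
    qed
    then obtain b where b: "\<And>v \<eta>. \<eta> \<in> K \<Longrightarrow> \<bar>\<eta> v\<bar> \<le> b v" by metis
    \<comment> \<open>Tychonoff: the product of these intervals is compact for pointwise
      convergence, and \<open>K\<close> is a closed subset of it.\<close>
    define box where "box = (\<Pi>\<^sub>E v\<in>UNIV. {- b v..b v})"
    have "compact box"
      using compactin_PiE[of "\<lambda>_. euclideanreal" UNIV "\<lambda>v. {- b v..b v}"]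
      by (simp add: box_def euclidean_product_topology)
    moreover have "closed K"
    proof -
      have "K = alternating_forms A p \<inter>
        (\<Inter>u\<in>multivectors A p. {\<eta> \<in> alternating_forms A p. u \<eta> \<le> h u})"
        by (auto simp: K_def)
      moreover have "closed {\<eta> \<in> alternating_forms A p. u \<eta> \<le> h u}" if "u \<in> multivectors A p" for u
      proof -
        have "closed (alternating_forms A p \<inter> u -` {..h u})"
          by (intro continuous_closed_preimage multivectors_continuous_on that
              closed_alternating_forms closed_atMost)
        moreover have "{\<eta> \<in> alternating_forms A p. u \<eta> \<le> h u} = alternating_forms A p \<inter> u -` {..h u}"
          by auto
        ultimately show ?thesis by simp
      qed
      ultimately show ?thesis
        by (simp only:) (intro closed_Int closed_alternating_forms closed_INT, auto)
    qed
    moreover have "K \<subseteq> box"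
      using b by (force simp: box_def abs_le_iff)
    ultimately show "compact K"
      using compact_Int_closed[of box K] by (simp add: inf.absorb2)
  qed
  have "support_function K u = h u" if u: "u \<in> multivectors A p" for u
  proof (rule order_antisym)
    show "support_function K u \<le> h u"
      by (rule support_function_least[OF body]) (use u in \<open>auto simp: K_def\<close>)
    show "h u \<le> support_function K u"
      using support_function_upper[OF body u ctK[OF u]] cth[OF u] by simp
  qed
  then show ?thesis using body by (auto simp: h_def)
qed

subsection \<open>Gram determinants and orthonormal bases\<close>

text \<open>Multilinearity in the rows: \<phi> chooses one summand in each row, its coefficients
  come out as a product, and the rows \<open>b j (\<phi> i)\<close> remain.\<close>

lemma det_sum_expansion:
  fixes a b :: "'k::finite \<Rightarrow> 'b \<Rightarrow> real"
  assumes "finite S"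
  shows "det ((\<chi> i j. \<Sum>e\<in>S. a i e * b j e) :: real^'k^'k) =
    (\<Sum>\<phi>\<in>UNIV \<rightarrow>\<^sub>E S. (\<Prod>i\<in>UNIV. a i (\<phi> i)) * det ((\<chi> i j. b j (\<phi> i)) :: real^'k^'k))"
proof -
  have "det ((\<chi> i j. \<Sum>e\<in>S. a i e * b j e) :: real^'k^'k) =
    (\<Sum>q | q permutes UNIV. of_int (sign q) * (\<Prod>i\<in>UNIV. \<Sum>e\<in>S. a i e * b (q i) e))"
    by (simp add: det_def)
  also have "\<dots> = (\<Sum>q | q permutes (UNIV :: 'k set). \<Sum>\<phi>\<in>UNIV \<rightarrow>\<^sub>E S.
      (\<Prod>i\<in>UNIV. a i (\<phi> i)) * (of_int (sign q) * (\<Prod>i\<in>UNIV. b (q i) (\<phi> i))))"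
    by (simp add: prod_sum_PiE[OF finite assms] sum_distrib_left prod.distrib mult_ac)
  also have "\<dots> = (\<Sum>\<phi>\<in>UNIV \<rightarrow>\<^sub>E S. \<Sum>q | q permutes (UNIV :: 'k set).
      (\<Prod>i\<in>UNIV. a i (\<phi> i)) * (of_int (sign q) * (\<Prod>i\<in>UNIV. b (q i) (\<phi> i))))"
    by (rule sum.swap)
  finally show ?thesis by (simp add: det_def sum_distrib_left)
qed

text \<open>The sum runs over all index tuples, not only the increasing ones; hence the factorial.\<close>

lemma cauchy_binet:
  fixes a b :: "'k::finite \<Rightarrow> 'b \<Rightarrow> real"
  assumes S: "finite S"
  shows "fact CARD('k) * det ((\<chi> i j. \<Sum>e\<in>S. a i e * b j e) :: real^'k^'k) =
    (\<Sum>\<phi>\<in>UNIV \<rightarrow>\<^sub>E S. det ((\<chi> i j. a i (\<phi> j)) :: real^'k^'k) * det ((\<chi> i j. b i (\<phi> j)) :: real^'k^'k))"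
proof -
  let ?G = "det ((\<chi> i j. \<Sum>e\<in>S. a i e * b j e) :: real^'k^'k)"
  let ?b = "\<lambda>\<phi>. det ((\<chi> i j. b j (\<phi> i)) :: real^'k^'k)"
  let ?Q = "{q. q permutes (UNIV :: 'k set)}"
  \<comment> \<open>Replacing \<phi> by \<open>\<phi> \<circ> q\<close> permutes the rows of the
    second determinant and costs \<open>sign q\<close>; summing these identities over all
    \<open>q\<close> completes the product of the \<open>a\<close> to a determinant.\<close>
  have perm: "?G = (\<Sum>\<phi>\<in>UNIV \<rightarrow>\<^sub>E S. of_int (sign q) * (\<Prod>i\<in>UNIV. a i (\<phi> (q i))) * ?b \<phi>)"
    if q: "q permutes (UNIV :: 'k set)" for q
  proof -
    have bij: "bij_betw (\<lambda>\<phi>. \<phi> \<circ> q) (UNIV \<rightarrow>\<^sub>E S) (UNIV \<rightarrow>\<^sub>E S)"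
    proof (rule bij_betw_byWitness[where f' = "\<lambda>\<phi>. \<phi> \<circ> inv q"])
      show "\<forall>\<phi>\<in>UNIV \<rightarrow>\<^sub>E S. (\<phi> \<circ> q) \<circ> inv q = \<phi>" "\<forall>\<phi>\<in>UNIV \<rightarrow>\<^sub>E S. (\<phi> \<circ> inv q) \<circ> q = \<phi>"
        by (simp_all add: comp_assoc permutes_inv_o[OF q])
    qed (simp_all add: image_subset_iff PiE_iff)
    have sg: "det ((\<chi> i j. b j (\<phi> (q i))) :: real^'k^'k) = of_int (sign q) * ?b \<phi>" for \<phi>
      using det_permute_rows[OF q, of "(\<chi> i j. b j (\<phi> i)) :: real^'k^'k"] by simp
    show ?thesis
      unfolding det_sum_expansion[OF S]
      by (subst sum.reindex_bij_betw[OF bij, symmetric]) (simp add: sg mult_ac)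
  qed
  have "fact CARD('k) * ?G = (\<Sum>q\<in>?Q. ?G)"
    by (simp add: card_permutations[OF refl finite])
  also have "\<dots> = (\<Sum>q\<in>?Q. \<Sum>\<phi>\<in>UNIV \<rightarrow>\<^sub>E S. of_int (sign q) * (\<Prod>i\<in>UNIV. a i (\<phi> (q i))) * ?b \<phi>)"
    by (rule sum.cong[OF refl], rule perm) simp
  also have "\<dots> = (\<Sum>\<phi>\<in>UNIV \<rightarrow>\<^sub>E S. \<Sum>q\<in>?Q. of_int (sign q) * (\<Prod>i\<in>UNIV. a i (\<phi> (q i))) * ?b \<phi>)"
    by (rule sum.swap)
  also have "\<dots> = (\<Sum>\<phi>\<in>UNIV \<rightarrow>\<^sub>E S. det ((\<chi> i j. a i (\<phi> j)) :: real^'k^'k) * ?b \<phi>)"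
    by (simp add: det_def[of "(\<chi> i j. a i (_ j))"] sum_distrib_right)
  finally show ?thesis
    using det_transpose[of "(\<chi> i j. b i (_ j)) :: real^'k^'k"] by (simp add: transpose_def)
qed

text \<open>For equal families Cauchy-Binet yields a sum of squares, and the positive factorial can
  be divided out.\<close>

lemma det_gram_nonneg:
  fixes a :: "'k::finite \<Rightarrow> 'b \<Rightarrow> real"
  assumes "finite S"
  shows "0 \<le> det ((\<chi> i j. \<Sum>e\<in>S. a i e * a j e) :: real^'k^'k)"
proof -
  have "0 \<le> fact CARD('k) * det ((\<chi> i j. \<Sum>e\<in>S. a i e * a j e) :: real^'k^'k)"
    unfolding cauchy_binet[OF assms] by (intro sum_nonneg) simp
  then show ?thesis
    using fact_gt_zero[of "CARD('k)", where 'a = real] by (auto simp: zero_le_mult_iff)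
qed

text \<open>By Cauchy-Binet the three determinants are, up to the same factorial, inner products of
  the families of maximal minors of \<open>a\<close> and \<open>b\<close>; the claim is
  Cauchy-Schwarz for these families.\<close>

lemma det_cauchy_schwarz:
  fixes a b :: "'k::finite \<Rightarrow> 'b \<Rightarrow> real"
  assumes S: "finite S"
  shows "\<bar>det ((\<chi> i j. \<Sum>e\<in>S. a i e * b j e) :: real^'k^'k)\<bar> \<le>
    sqrt (det ((\<chi> i j. \<Sum>e\<in>S. a i e * a j e) :: real^'k^'k)) *
    sqrt (det ((\<chi> i j. \<Sum>e\<in>S. b i e * b j e) :: real^'k^'k))"
proof -
  let ?d = "\<lambda>a b. det ((\<chi> i j. \<Sum>e\<in>S. a i e * b j e) :: real^'k^'k)"
  have "(fact CARD('k) * ?d a b)\<^sup>2 \<le> (fact CARD('k) * ?d a a) * (fact CARD('k) * ?d b b)"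
    unfolding cauchy_binet[OF S] power2_eq_square[symmetric] by (rule Cauchy_Schwarz_ineq_sum)
  then have "(fact CARD('k))\<^sup>2 * (?d a b)\<^sup>2 \<le> (fact CARD('k))\<^sup>2 * (?d a a * ?d b b)"
    by (simp add: power2_eq_square mult_ac)
  then have "(?d a b)\<^sup>2 \<le> ?d a a * ?d b b"
    by (rule mult_left_le_imp_le) simp
  then have "sqrt ((?d a b)\<^sup>2) \<le> sqrt (?d a a * ?d b b)" by (rule real_sqrt_le_mono)
  then show ?thesis by (simp add: real_sqrt_mult)
qed

text \<open>A maximal orthonormal family replaces the Gram-Schmidt recursion: orthonormal sets are
  independent, so their size is bounded, and a nonzero remainder of some \<open>x\<close> after
  subtracting its expansion could be normalised and added. The assumptions on \<open>B\<close> are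
  relative to \<open>S\<close> because the metric is an inner product only on tangent
  vectors.\<close>

lemma orthonormal_basis_exists:
  fixes B :: "'e::euclidean_space \<Rightarrow> 'e \<Rightarrow> real"
  assumes S: "subspace S"
    and lin: "\<And>x y z a b. x \<in> S \<Longrightarrow> y \<in> S \<Longrightarrow> z \<in> S \<Longrightarrow> B (a *\<^sub>R x + b *\<^sub>R y) z = a * B x z + b * B y z"
    and sym: "\<And>x y. x \<in> S \<Longrightarrow> y \<in> S \<Longrightarrow> B x y = B y x"
    and pos: "\<And>x. x \<in> S \<Longrightarrow> x \<noteq> 0 \<Longrightarrow> B x x > 0"
  shows "\<exists>E. finite E \<and> E \<subseteq> S \<and> (\<forall>e\<in>E. \<forall>f\<in>E. B e f = (if e = f then 1 else 0)) \<and>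
    (\<forall>x\<in>S. x = (\<Sum>e\<in>E. B x e *\<^sub>R e))"
proof -
  have B0: "B 0 z = 0" if "z \<in> S" for z
    using lin[of 0 0 z 0 0] subspace_0[OF S] that by simp
  have Bsum: "B (\<Sum>e\<in>E. c e *\<^sub>R e) z = (\<Sum>e\<in>E. c e * B e z)"
    if "finite E" "E \<subseteq> S" "z \<in> S" for E c z
    using that
  proof (induction E rule: finite_induct)
    case empty
    then show ?case by (simp add: B0)
  next
    case (insert e E)
    have "(\<Sum>e\<in>E. c e *\<^sub>R e) \<in> S"
      using insert.prems by (intro subspace_sum[OF S] subspace_scale[OF S]) auto
    then show ?case
      using insert lin[of e "\<Sum>e\<in>E. c e *\<^sub>R e" z "c e" 1] by simp
  qed
  define ON where "ON E \<longleftrightarrow> finite E \<and> E \<subseteq> S \<and> (\<forall>e\<in>E. \<forall>f\<in>E. B e f = (if e = f then 1 else 0))" for E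
  have coef: "B (\<Sum>e\<in>E. c e *\<^sub>R e) f = c f" if E: "ON E" and f: "f \<in> E" for E c f
  proof -
    have "B (\<Sum>e\<in>E. c e *\<^sub>R e) f = (\<Sum>e\<in>E. c e * B e f)"
      using E f by (intro Bsum) (auto simp: ON_def)
    also have "\<dots> = (\<Sum>e\<in>E. if e = f then c e else 0)"
      using E f by (intro sum.cong refl) (auto simp: ON_def)
    also have "\<dots> = c f" using E f by (simp add: ON_def)
    finally show ?thesis .
  qed
  have "card E < Suc DIM('e)" if E: "ON E" for E
  proof -
    have "independent E"
    proof (rule independent_if_scalars_zero)
      show "finite E" using E by (simp add: ON_def)
      fix c f assume "(\<Sum>e\<in>E. c e *\<^sub>R e) = 0" "f \<in> E"
      then show "c f = 0" using coef[OF E, of f c] B0 E by (auto simp: ON_def)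
    qed
    then show ?thesis using independent_bound[of E] by simp
  qed
  moreover have "ON {}" by (simp add: ON_def)
  ultimately obtain E where E: "ON E" and max: "\<And>F. ON F \<Longrightarrow> card F \<le> card E"
    using ex_has_greatest_nat[of ON "{}" card "Suc DIM('e)"] by blast
  have ES: "E \<subseteq> S" "finite E" using E by (auto simp: ON_def)
  have "x = (\<Sum>e\<in>E. B x e *\<^sub>R e)" if x: "x \<in> S" for x
  proof (rule ccontr)
    assume ne: "x \<noteq> (\<Sum>e\<in>E. B x e *\<^sub>R e)"
    define y where "y = x - (\<Sum>e\<in>E. B x e *\<^sub>R e)"
    have sS: "(\<Sum>e\<in>E. B x e *\<^sub>R e) \<in> S"
      using ES by (intro subspace_sum[OF S] subspace_scale[OF S]) auto
    have y: "y \<in> S" "y \<noteq> 0" using ne x sS subspace_diff[OF S] by (auto simp: y_def)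
    have yE: "B y f = 0" if "f \<in> E" for f
      using lin[OF x sS, of f 1 "-1"] coef[OF E that, of "B x"] that ES by (auto simp: y_def)
    define z where "z = (1 / sqrt (B y y)) *\<^sub>R y"
    have py: "B y y > 0" by (rule pos[OF y])
    have zS: "z \<in> S" unfolding z_def by (rule subspace_scale[OF S y(1)])
    have zl: "B z w = B y w / sqrt (B y y)" if "w \<in> S" for w
      using lin[OF y(1) y(1) that, of "1 / sqrt (B y y)" 0] by (simp add: z_def)
    have zE: "B z f = 0" "B f z = 0" if "f \<in> E" for f
      using zl[of f] yE[OF that] sym[of f z] zS that ES by auto
    have "B z z = B y z / sqrt (B y y)" by (rule zl[OF zS])
    also have "B y z = B z y" by (rule sym[OF y(1) zS])
    also have "\<dots> = B y y / sqrt (B y y)" by (rule zl[OF y(1)])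
    finally have zz: "B z z = 1" using py by (simp add: field_simps)
    have "z \<notin> E" using zE(1) zz by force
    moreover have "ON (insert z E)"
      using E zS zz zE \<open>z \<notin> E\<close> by (auto simp: ON_def)
    ultimately show False using max[of "insert z E"] ES by simp
  qed
  then have "\<forall>x\<in>S. x = (\<Sum>e\<in>E. B x e *\<^sub>R e)" by (rule ballI)
  moreover have "\<forall>e\<in>E. \<forall>f\<in>E. B e f = (if e = f then 1 else 0)" using E by (simp add: ON_def)
  ultimately show ?thesis by (intro exI[of _ E] conjI ES)
qed

subsection \<open>The Jacobian in coordinates\<close>

lemma some_chart_at:
  assumes "smooth_atlas A"
  shows "(SOME c. c \<in> charts_at A p) \<in> charts_at A p"
proof -
  have "\<exists>c. c \<in> charts_at A p"
    using assms unfolding smooth_atlas_def charts_at_def by (metis (mono_tags, lifting) UNIV_I UN_E mem_Collect_eq)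
  then show ?thesis by (rule someI_ex)
qed

lemma smooth_atlas_transition:
  assumes "smooth_atlas A" "c \<in> A" "d \<in> A"
  shows "smooth_on (snd c ` (fst c \<inter> fst d)) (snd d \<circ> chart_inv c)"
  using assms unfolding smooth_atlas_def by blast

lemma linear_transition_deriv:
  assumes "smooth_atlas A" "c \<in> charts_at A p" "d \<in> charts_at A p"
  shows "linear (transition_deriv c d p)"
proof -
  have "smooth_on (snd c ` (fst c \<inter> fst d)) (snd d \<circ> chart_inv c)"
    using assms smooth_atlas_transition[OF assms(1)] by (simp add: charts_at_def)
  then have "Ck_on (Suc 0) (snd d \<circ> chart_inv c) (snd c ` (fst c \<inter> fst d))"
    unfolding smooth_on_def by blast
  then have "(snd d \<circ> chart_inv c) differentiable (at (snd c p))"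
    using assms(2,3) by (simp add: charts_at_def)
  then show ?thesis
    unfolding transition_deriv_def by (rule linear_frechet_derivative)
qed

lemma tangent_space_comb:
  assumes A: "smooth_atlas A" and v: "v \<in> tangent_space A p" and w: "w \<in> tangent_space A p"
  shows "tvec_comb a v b w \<in> tangent_space A p"
proof -
  have "v d = 0" "w d = 0" if "d \<notin> charts_at A p" for d
    using v w that unfolding tangent_space_def by blast+
  then have "\<forall>d. d \<notin> charts_at A p \<longrightarrow> a *\<^sub>R v d + b *\<^sub>R w d = 0" by simp
  moreover have "a *\<^sub>R v d + b *\<^sub>R w d = transition_deriv c d p (a *\<^sub>R v c + b *\<^sub>R w c)"
    if c: "c \<in> charts_at A p" and d: "d \<in> charts_at A p" for c d
  proof -
    have "v d = transition_deriv c d p (v c)" "w d = transition_deriv c d p (w c)"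
      using v w c d unfolding tangent_space_def by blast+
    then show ?thesis
      using linear_transition_deriv[OF A c d] by (simp add: linear_add linear_scale)
  qed
  ultimately show ?thesis
    unfolding tangent_space_def tvec_comb_def mem_Collect_eq by blast
qed

lemma coord_tvec_chart:
  assumes "v \<in> tangent_space A p" "c \<in> charts_at A p"
  shows "coord_tvec A c p (v c) = v"
proof
  fix d
  have "d \<notin> charts_at A p \<Longrightarrow> v d = 0" "d \<in> charts_at A p \<Longrightarrow> v d = transition_deriv c d p (v c)"
    using assms unfolding tangent_space_def by blast+
  then show "coord_tvec A c p (v c) d = v d" by (simp add: coord_tvec_def)
qed

lemma tangent_space_zero:
  assumes A: "smooth_atlas A"
  shows "(\<lambda>_. 0) \<in> tangent_space A p"
  unfolding tangent_space_def using linear_0[OF linear_transition_deriv[OF A]] by auto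

lemma riemannian_metricD:
  assumes g: "riemannian_metric A g"
    and uvw: "u \<in> tangent_space A p" "v \<in> tangent_space A p" "w \<in> tangent_space A p"
  shows "g p v w = g p w v"
    and "g p (tvec_comb a u b v) w = a * g p u w + b * g p v w"
    and "v \<noteq> (\<lambda>_. 0) \<Longrightarrow> g p v v > 0"
  using g uvw unfolding riemannian_metric_def by blast+

text \<open>Tangent vectors are functions on charts; their coordinates in the single chart
  \<open>c\<close> form a subspace of \<open>'e\<close>, to which the metric is transported and
  where \<open>E\<close> is an orthonormal basis. The three conclusions are the lifting back to
  tangent vectors, the basis expansion, and the linearity of the pairing.\<close>

lemma tangent_orthonormal_basis:
  fixes A :: "('m::{t2_space,second_countable_topology}, 'e::euclidean_space) chart set"
  assumes A: "smooth_atlas A" and g: "riemannian_metric A g" and c: "c \<in> charts_at A p"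
  shows "\<exists>E. finite E \<and> (\<forall>x\<in>span E. coord_tvec A c p x \<in> tangent_space A p \<and> coord_tvec A c p x c = x) \<and>
    (\<forall>v\<in>tangent_space A p. v c = (\<Sum>e\<in>E. g p v (coord_tvec A c p e) *\<^sub>R e)) \<and>
    (\<forall>l. \<forall>v\<in>tangent_space A p.
       g p (coord_tvec A c p (\<Sum>e\<in>E. l e *\<^sub>R e)) v = (\<Sum>e\<in>E. l e * g p v (coord_tvec A c p e)))"
proof -
  let ?T = "tangent_space A p" and ?L = "coord_tvec A c p"
  define S where "S = (\<lambda>v. v c) ` ?T"
  define B where "B x y = g p (?L x) (?L y)" for x y
  have LT: "?L x \<in> ?T" "?L x c = x" if "x \<in> S" for x
    using that coord_tvec_chart[OF _ c] by (auto simp: S_def)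
  have SL: "v c \<in> S" "?L (v c) = v" if "v \<in> ?T" for v
    using that coord_tvec_chart[OF that c] by (auto simp: S_def)
  have comb: "a *\<^sub>R x + b *\<^sub>R y \<in> S \<and> ?L (a *\<^sub>R x + b *\<^sub>R y) = tvec_comb a (?L x) b (?L y)"
    if "x \<in> S" "y \<in> S" for a b x y
  proof -
    have "tvec_comb a (?L x) b (?L y) \<in> ?T"
      by (intro tangent_space_comb A LT that)
    moreover have "tvec_comb a (?L x) b (?L y) c = a *\<^sub>R x + b *\<^sub>R y"
      using LT that by (simp add: tvec_comb_def)
    ultimately show ?thesis using SL by metis
  qed
  have S: "subspace S"
  proof (rule subspaceI)
    show "0 \<in> S" using SL(1)[OF tangent_space_zero[OF A]] .
    show "x + y \<in> S" if "x \<in> S" "y \<in> S" for x y using comb[OF that, of 1 1] by simp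
    show "r *\<^sub>R x \<in> S" if "x \<in> S" for r x using comb[OF that that, of r 0] by simp
  qed
  have lin: "B (a *\<^sub>R x + b *\<^sub>R y) z = a * B x z + b * B y z"
    if "x \<in> S" "y \<in> S" "z \<in> S" for x y z a b
    using comb[OF that(1,2), of a b] riemannian_metricD(2)[OF g LT(1)[OF that(1)] LT(1)[OF that(2)] LT(1)[OF that(3)]]
    by (simp add: B_def)
  have sym: "B x y = B y x" if "x \<in> S" "y \<in> S" for x y
    unfolding B_def by (rule riemannian_metricD(1)[OF g LT(1)[OF that(1)] LT(1)[OF that(1)] LT(1)[OF that(2)]])
  have pos: "B x x > 0" if "x \<in> S" "x \<noteq> 0" for x
    unfolding B_def
  proof (rule riemannian_metricD(3)[OF g])
    show "?L x \<in> ?T" "?L x \<in> ?T" "?L x \<in> ?T" by (rule LT(1)[OF that(1)])+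
    show "?L x \<noteq> (\<lambda>_. 0)" using LT(2)[OF that(1)] that(2) by auto
  qed
  obtain E where E: "finite E" "E \<subseteq> S" and ON: "\<forall>e\<in>E. \<forall>f\<in>E. B e f = (if e = f then 1 else 0)"
    and rep: "\<forall>x\<in>S. x = (\<Sum>e\<in>E. B x e *\<^sub>R e)"
    using orthonormal_basis_exists[OF S lin sym pos] by blast
  have spE: "span E \<subseteq> S" by (rule span_minimal[OF E(2) S])
  have P1: "\<forall>x\<in>span E. ?L x \<in> ?T \<and> ?L x c = x"
    using LT spE by (meson subsetD)
  have P2: "\<forall>v\<in>?T. v c = (\<Sum>e\<in>E. g p v (?L e) *\<^sub>R e)"
  proof
    fix v assume v: "v \<in> ?T"
    have "v c = (\<Sum>e\<in>E. B (v c) e *\<^sub>R e)" using bspec[OF rep SL(1)[OF v]] .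
    then show "v c = (\<Sum>e\<in>E. g p v (?L e) *\<^sub>R e)" by (simp only: B_def SL(2)[OF v])
  qed
  have P3: "g p (?L (\<Sum>e\<in>E. l e *\<^sub>R e)) v = (\<Sum>e\<in>E. l e * g p v (?L e))" if v: "v \<in> ?T" for l v
  proof -
    have "B (\<Sum>e\<in>F. l e *\<^sub>R e) (v c) = (\<Sum>e\<in>F. l e * B e (v c))" if "finite F" "F \<subseteq> S" for F
      using that
    proof (induction F rule: finite_induct)
      case empty
      then show ?case using lin[of 0 0 "v c" 0 0] subspace_0[OF S] SL(1)[OF v] by simp
    next
      case (insert e F)
      have "(\<Sum>e\<in>F. l e *\<^sub>R e) \<in> S"
        using insert.prems by (intro subspace_sum[OF S] subspace_scale[OF S]) auto
      then show ?case
        using insert lin[of e "\<Sum>e\<in>F. l e *\<^sub>R e" "v c" "l e" 1] SL(1)[OF v] by simp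
    qed
    from this[OF E] have "B (\<Sum>e\<in>E. l e *\<^sub>R e) (v c) = (\<Sum>e\<in>E. l e * B (v c) e)"
      using sym SL(1)[OF v] E(2) by (simp add: subset_iff)
    then show ?thesis by (simp only: B_def SL(2)[OF v])
  qed
  show ?thesis by (intro exI[of _ E] conjI E P1 P2 allI ballI P3)
qed

text \<open>In an orthonormal basis the vector representing a linear form has the values of the form
  on the basis as coefficients, so the induced inner product is the sum of products of these
  values.\<close>

lemma cometric_sum:
  fixes A :: "('m::{t2_space,second_countable_topology}, 'e::euclidean_space) chart set"
  assumes E: "finite E" and
    P1: "\<forall>x\<in>span E. coord_tvec A c p x \<in> tangent_space A p \<and> coord_tvec A c p x c = x" and
    P2: "\<forall>v\<in>tangent_space A p. v c = (\<Sum>e\<in>E. g p v (coord_tvec A c p e) *\<^sub>R e)" and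
    P3: "\<forall>l. \<forall>v\<in>tangent_space A p.
       g p (coord_tvec A c p (\<Sum>e\<in>E. l e *\<^sub>R e)) v = (\<Sum>e\<in>E. l e * g p v (coord_tvec A c p e))"
    and c: "c \<in> charts_at A p"
    and l: "linear l" "\<And>v. v \<in> tangent_space A p \<Longrightarrow> \<alpha> v = l (v c)"
    and m: "linear m" "\<And>v. v \<in> tangent_space A p \<Longrightarrow> \<beta> v = m (v c)"
  shows "cometric A g p \<alpha> \<beta> = (\<Sum>e\<in>E. l e * m e :: real)"
proof -
  let ?T = "tangent_space A p" and ?L = "coord_tvec A c p"
  have LE: "?L e \<in> ?T" "?L e c = e" if "e \<in> E" for e using P1 span_base[OF that] by blast+
  have sharp: "sharp A g p \<gamma> = ?L (\<Sum>e\<in>E. n e *\<^sub>R e) \<and> ?L (\<Sum>e\<in>E. n e *\<^sub>R e) \<in> ?T \<and>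
      (\<forall>w\<in>?T. g p (?L (\<Sum>e\<in>E. n e *\<^sub>R e)) w = n (w c))"
    if n: "linear n" "\<And>v. v \<in> ?T \<Longrightarrow> \<gamma> v = n (v c)" for \<gamma> and n :: "'e \<Rightarrow> real"
  proof -
    let ?x = "\<Sum>e\<in>E. n e *\<^sub>R e"
    have "?x \<in> span E" by (intro span_sum span_scale span_base)
    then have xT: "?L ?x \<in> ?T" using P1 by blast
    have ev: "g p (?L ?x) w = n (w c)" if w: "w \<in> ?T" for w
    proof -
      have "n (w c) = n (\<Sum>e\<in>E. g p w (?L e) *\<^sub>R e)"
        by (rule arg_cong[where f = n]) (rule bspec[OF P2 w])
      also have "\<dots> = (\<Sum>e\<in>E. n e * g p w (?L e))"
        by (simp add: linear_sum[OF n(1)] linear_scale[OF n(1)] mult.commute)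
      also have "\<dots> = g p (?L ?x) w" using P3 w by simp
      finally show ?thesis ..
    qed
    have "sharp A g p \<gamma> = ?L ?x"
      unfolding sharp_def
    proof (rule the_equality)
      show "?L ?x \<in> ?T \<and> (\<forall>w\<in>?T. g p (?L ?x) w = \<gamma> w)" using xT ev n(2) by simp
      \<comment> \<open>Uniqueness for the definite description: the expansion \<open>P2\<close>
        recovers the coordinates of a vector, hence the vector, from its pairings.\<close>
      fix v assume v: "v \<in> ?T \<and> (\<forall>w\<in>?T. g p v w = \<gamma> w)"
      have "v c = (\<Sum>e\<in>E. g p v (?L e) *\<^sub>R e)" using P2 v by blast
      also have "\<dots> = ?x" using v LE n(2) by (intro sum.cong refl) simp
      finally show "v = ?L ?x" using coord_tvec_chart[of v A p c] v c by simp
    qed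
    then show ?thesis using xT ev by blast
  qed
  note sl = sharp[where n = l and \<gamma> = \<alpha>, OF l] and sm = sharp[where n = m and \<gamma> = \<beta>, OF m]
  have "cometric A g p \<alpha> \<beta> = g p (?L (\<Sum>e\<in>E. l e *\<^sub>R e)) (?L (\<Sum>e\<in>E. m e *\<^sub>R e))"
    using sl sm by (simp only: cometric_def)
  also have "\<dots> = (\<Sum>e\<in>E. l e * g p (?L (\<Sum>e\<in>E. m e *\<^sub>R e)) (?L e))"
    using P3 sm by blast
  also have "\<dots> = (\<Sum>e\<in>E. l e * m e)"
    using sm LE by (intro sum.cong refl) simp
  finally show ?thesis .
qed

section \<open>Differentials of maps in one chart\<close>

lemma C1_maps_differentiable:
  assumes "f \<in> C1_maps A" "c \<in> charts_at A p"
  shows "(f \<circ> chart_inv c) differentiable (at (snd c p))"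
  using assms by (auto simp: C1_maps_def charts_at_def)

text \<open>The chart is the one chosen in \<open>differential\<close>, but the derivative is kept
  as one linear map on coordinates with all components together: this is what the neighbourhoods of
  the weak topology control.\<close>

definition chart_deriv ::
  "('m, 'e::euclidean_space) chart set \<Rightarrow> 'm \<Rightarrow> ('m \<Rightarrow> 'b::real_normed_vector) \<Rightarrow> 'e \<Rightarrow> 'b" where
  "chart_deriv A p f = (let c = (SOME c. c \<in> charts_at A p)
     in frechet_derivative (f \<circ> chart_inv c) (at (snd c p)))"

lemma linear_chart_deriv:
  assumes "smooth_atlas A" "f \<in> C1_maps A"
  shows "linear (chart_deriv A p f)"
  unfolding chart_deriv_def Let_def
  by (intro linear_frechet_derivative C1_maps_differentiable[OF assms(2)] some_chart_at[OF assms(1)])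

lemma d_component_chart_deriv:
  assumes "smooth_atlas A" "f \<in> C1_maps A"
  shows "d_component A p f i v = chart_deriv A p f (v (SOME c. c \<in> charts_at A p)) $ i"
proof -
  define c where "c = (SOME c. c \<in> charts_at A p)"
  have "((f \<circ> chart_inv c) has_derivative frechet_derivative (f \<circ> chart_inv c) (at (snd c p))) (at (snd c p))"
    using C1_maps_differentiable[OF assms(2) some_chart_at[OF assms(1)]]
    by (simp add: frechet_derivative_works c_def)
  then have "((\<lambda>x. (f \<circ> chart_inv c) x $ i) has_derivative
      (\<lambda>h. frechet_derivative (f \<circ> chart_inv c) (at (snd c p)) h $ i)) (at (snd c p))"
    by (rule bounded_linear.has_derivative[OF bounded_linear_vec_nth])
  then have "frechet_derivative ((\<lambda>q. f q $ i) \<circ> chart_inv c) (at (snd c p)) =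
      (\<lambda>h. frechet_derivative (f \<circ> chart_inv c) (at (snd c p)) h $ i)"
    by (intro frechet_derivative_at[symmetric]) (simp add: comp_def)
  then show ?thesis
    by (simp add: d_component_def differential_def chart_deriv_def c_def Let_def)
qed

lemma d_component_comb:
  assumes "smooth_atlas A" "f \<in> C1_maps A"
  shows "d_component A p f i (tvec_comb a v b w) = a * d_component A p f i v + b * d_component A p f i w"
  using linear_chart_deriv[OF assms]
  by (simp add: d_component_chart_deriv[OF assms] tvec_comb_def linear_add linear_scale)

lemma wedge_alternating:
  fixes A :: "('m::{t2_space,second_countable_topology}, 'e::euclidean_space) chart set"
    and f :: "'m \<Rightarrow> real^'k::finite"
  assumes A: "smooth_atlas A" and f: "f \<in> C1_maps A"
  shows "wedge A p (d_component A p f) \<in> alternating_forms A p"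
proof -
  let ?d = "d_component A p f"
  \<comment> \<open>The argument \<open>v j\<close> sits in column \<open>j\<close>; after
    transposing, the row rules for determinants express multilinearity and alternation in the
    arguments.\<close>
  have det': "det ((\<chi> i j. ?d i (v j)) :: real^'k^'k) = det ((\<chi> j i. ?d i (v j)) :: real^'k^'k)" for v
    using det_transpose[of "(\<chi> i j. ?d i (v j)) :: real^'k^'k"] by (simp add: transpose_def)
  show ?thesis
    unfolding alternating_forms_def mem_Collect_eq
  proof (intro conjI allI impI)
    show "wedge A p ?d v = 0" if "\<not> range v \<subseteq> tangent_space A p" for v
      using that by (simp add: wedge_def)
  next
    fix v :: "'k \<Rightarrow> ('m, 'e) tvec" and k x y a b
    assume H: "range v \<subseteq> tangent_space A p \<and> x \<in> tangent_space A p \<and> y \<in> tangent_space A p"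
    then have r: "range (v(k := z)) \<subseteq> tangent_space A p" if "z \<in> tangent_space A p" for z
      using that by auto
    have rows: "(\<chi> j i. ?d i ((v(k := z)) j)) = (\<chi> j. if j = k then (\<chi> i. ?d i z) else (\<chi> i. ?d i (v j)))"
      for z by (simp add: vec_eq_iff)
    have "(\<chi> i. ?d i (tvec_comb a x b y)) = a *s (\<chi> i. ?d i x) + b *s (\<chi> i. ?d i y)"
      by (simp add: vec_eq_iff d_component_comb[OF A f])
    note row = this
    have "det ((\<chi> j i. ?d i ((v(k := tvec_comb a x b y)) j)) :: real^'k^'k) =
        a * det ((\<chi> j i. ?d i ((v(k := x)) j)) :: real^'k^'k) + b * det ((\<chi> j i. ?d i ((v(k := y)) j)) :: real^'k^'k)"
      unfolding rows row det_row_add det_row_mul ..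
    then show "wedge A p ?d (v(k := tvec_comb a x b y)) =
        a * wedge A p ?d (v(k := x)) + b * wedge A p ?d (v(k := y))"
      using H r tangent_space_comb[OF A] by (simp add: wedge_def det')
  next
    fix v :: "'k \<Rightarrow> ('m, 'e) tvec" and i j assume "i \<noteq> j \<and> v i = v j"
    then have "det ((\<chi> j i. ?d i (v j)) :: real^'k^'k) = 0"
      by (intro det_identical_rows[of i j]) (auto simp: row_def)
    then show "wedge A p ?d v = 0" by (simp add: wedge_def det')
  qed
qed

text \<open>Both quantities become determinants of sums over the same \<open>E\<close>, the shape
  needed for \<open>det_cauchy_schwarz\<close> and for continuity. The order of quantifiers matters:
  \<open>b\<close> depends on the tuple \<open>v\<close> but not on \<open>f\<close>, so the
  resulting bound is uniform in \<open>f\<close>.\<close>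

lemma jacobian_wedge_coordinates:
  fixes A :: "('m::{t2_space,second_countable_topology}, 'e::euclidean_space) chart set"
  assumes A: "smooth_atlas A" and g: "riemannian_metric A g"
  obtains E where "finite E"
    "\<forall>f\<in>C1_maps A. jacobian A g p f =
       sqrt (det ((\<chi> i j. \<Sum>e\<in>E. chart_deriv A p f e $ i * chart_deriv A p f e $ j) :: real^'k::finite^'k))"
    "\<forall>v. range v \<subseteq> tangent_space A p \<longrightarrow> (\<exists>b. \<forall>f\<in>C1_maps A. wedge A p (d_component A p f) v =
       det ((\<chi> i j. \<Sum>e\<in>E. chart_deriv A p f e $ i * b j e) :: real^'k^'k))"
proof -
  define c where "c = (SOME c. c \<in> charts_at A p)"
  have c: "c \<in> charts_at A p" unfolding c_def by (rule some_chart_at[OF A])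
  obtain E where E: "finite E" and
    P: "\<forall>x\<in>span E. coord_tvec A c p x \<in> tangent_space A p \<and> coord_tvec A c p x c = x"
    "\<forall>v\<in>tangent_space A p. v c = (\<Sum>e\<in>E. g p v (coord_tvec A c p e) *\<^sub>R e)"
    "\<forall>l. \<forall>v\<in>tangent_space A p.
       g p (coord_tvec A c p (\<Sum>e\<in>E. l e *\<^sub>R e)) v = (\<Sum>e\<in>E. l e * g p v (coord_tvec A c p e))"
    using tangent_orthonormal_basis[OF A g c] by blast
  have lin: "linear (\<lambda>x. chart_deriv A p f x $ i)" if "f \<in> C1_maps A" for f :: "'m \<Rightarrow> real^'k" and i
    using linear_chart_deriv[OF A that] by (intro linearI) (simp_all add: linear_add linear_scale)
  have dc: "d_component A p f i v = chart_deriv A p f (v c) $ i" if "f \<in> C1_maps A"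
    for f :: "'m \<Rightarrow> real^'k" and i v
    unfolding c_def by (rule d_component_chart_deriv[OF A that])
  have "jacobian A g p f =
      sqrt (det ((\<chi> i j. \<Sum>e\<in>E. chart_deriv A p f e $ i * chart_deriv A p f e $ j) :: real^'k^'k))"
    if f: "f \<in> C1_maps A" for f
  proof -
    have "cometric A g p (d_component A p f i) (d_component A p f j) =
        (\<Sum>e\<in>E. chart_deriv A p f e $ i * chart_deriv A p f e $ j)" for i j
      by (intro cometric_sum[where A = A and g = g and c = c and p = p and E = E, OF E P c] lin[OF f] dc[OF f])
    then show ?thesis by (simp only: jacobian_def decomposable_inner_def)
  qed
  moreover have "\<exists>b. \<forall>f\<in>C1_maps A. wedge A p (d_component A p f) v =
       det ((\<chi> i j. \<Sum>e\<in>E. chart_deriv A p f e $ i * b j e) :: real^'k^'k)"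
    if v: "range v \<subseteq> tangent_space A p" for v
  proof (intro exI ballI)
    fix f :: "'m \<Rightarrow> real^'k" assume f: "f \<in> C1_maps A"
    have "d_component A p f i (v j) =
        (\<Sum>e\<in>E. chart_deriv A p f e $ i * g p (v j) (coord_tvec A c p e))" for i j
    proof -
      have vj: "v j \<in> tangent_space A p" using v by blast
      have "d_component A p f i (v j) = chart_deriv A p f (v j c) $ i" by (rule dc[OF f])
      also have "\<dots> = chart_deriv A p f (\<Sum>e\<in>E. g p (v j) (coord_tvec A c p e) *\<^sub>R e) $ i"
        by (rule arg_cong[where f = "\<lambda>x. chart_deriv A p f x $ i"]) (rule bspec[OF P(2) vj])
      also have "\<dots> = (\<Sum>e\<in>E. chart_deriv A p f e $ i * g p (v j) (coord_tvec A c p e))"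
        using linear_chart_deriv[OF A f] by (simp add: linear_sum linear_scale mult.commute)
      finally show ?thesis .
    qed
    then show "wedge A p (d_component A p f) v =
        det ((\<chi> i j. \<Sum>e\<in>E. chart_deriv A p f e $ i * g p (v j) (coord_tvec A c p e)) :: real^'k^'k)"
      using v by (simp add: wedge_def)
  qed
  ultimately show thesis by (intro that[OF E] ballI allI impI)
qed

text \<open>The real \<open>sqrt\<close> is odd, hence negative on negative arguments; the sign
  comes from the Gram determinant.\<close>

lemma jacobian_nonneg:
  assumes "smooth_atlas A" "riemannian_metric A g" "f \<in> C1_maps A"
  shows "0 \<le> jacobian A g p f"
proof -
  obtain E :: "'b set" where "finite E" and
    "\<forall>f\<in>C1_maps A. jacobian A g p f =
       sqrt (det ((\<chi> i j. \<Sum>e\<in>E. chart_deriv A p f e $ i * chart_deriv A p f e $ j) :: real^'c^'c))"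
    by (rule jacobian_wedge_coordinates[OF assms(1,2)])
  then show ?thesis using assms(3) det_gram_nonneg[of E] by simp
qed

text \<open>The constant is the square root of the Gram determinant of the coordinates of
  \<open>v\<close>, by Cauchy-Schwarz; if \<open>v\<close> leaves the tangent space the form
  vanishes and 0 serves.\<close>

lemma wedge_le_jacobian:
  fixes v :: "'k::finite \<Rightarrow> ('m::{t2_space,second_countable_topology}, 'e::euclidean_space) tvec"
  assumes A: "smooth_atlas A" and g: "riemannian_metric A g"
  shows "\<exists>C\<ge>0. \<forall>f\<in>C1_maps A. \<bar>wedge A p (d_component A p f) v\<bar> \<le> C * jacobian A g p f"
proof (cases "range v \<subseteq> tangent_space A p")
  case True
  obtain E :: "'e set" where E: "finite E" and
    J: "\<forall>f\<in>C1_maps A. jacobian A g p f =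
       sqrt (det ((\<chi> i j. \<Sum>e\<in>E. chart_deriv A p f e $ i * chart_deriv A p f e $ j) :: real^'k^'k))" and
    W: "\<forall>v. range v \<subseteq> tangent_space A p \<longrightarrow> (\<exists>b. \<forall>f\<in>C1_maps A. wedge A p (d_component A p f) v =
       det ((\<chi> i j. \<Sum>e\<in>E. chart_deriv A p f e $ i * b j e) :: real^'k^'k))"
    by (rule jacobian_wedge_coordinates[OF A g])
  obtain b where b: "\<forall>f\<in>C1_maps A. wedge A p (d_component A p f) v =
       det ((\<chi> i j. \<Sum>e\<in>E. chart_deriv A p f e $ i * b j e) :: real^'k^'k)"
    using W True by blast
  show ?thesis
  proof (intro exI conjI ballI)
    show "0 \<le> sqrt (det ((\<chi> i j. \<Sum>e\<in>E. b i e * b j e) :: real^'k^'k))"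
      using det_gram_nonneg[OF E] by simp
    fix f :: "'m \<Rightarrow> real^'k" assume f: "f \<in> C1_maps A"
    show "\<bar>wedge A p (d_component A p f) v\<bar> \<le>
        sqrt (det ((\<chi> i j. \<Sum>e\<in>E. b i e * b j e) :: real^'k^'k)) * jacobian A g p f"
      using det_cauchy_schwarz[OF E, of "\<lambda>i e. chart_deriv A p f e $ i" b] bspec[OF b f] bspec[OF J f]
      by (simp add: mult.commute)
  qed
next
  case False
  then show ?thesis by (intro exI[of _ 0]) (simp add: wedge_def)
qed

subsection \<open>Continuity in the weak Whitney topology\<close>

lemma openin_weak_C1_nbhd:
  assumes "f \<in> C1_maps A" "c \<in> A" "compact K" "K \<subseteq> fst c" "0 < r"
  shows "openin (weak_C1_topology A) (weak_C1_nbhd A f c K r)"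
  unfolding weak_C1_topology_def using assms by (intro topology_generated_by_Basis) blast

lemma weak_C1_nbhd_self:
  assumes "f \<in> C1_maps A" "0 < r"
  shows "f \<in> weak_C1_nbhd A f c K r"
  using assms by (simp add: weak_C1_nbhd_def onorm_zero)

lemma topspace_weak_C1_topology:
  fixes A :: "('m::{t2_space,second_countable_topology}, 'e::euclidean_space) chart set"
  assumes "smooth_atlas A"
  shows "topspace (weak_C1_topology A :: ('m \<Rightarrow> real^'k) topology) = C1_maps A"
proof
  show "topspace (weak_C1_topology A :: ('m \<Rightarrow> real^'k) topology) \<subseteq> C1_maps A"
    by (auto simp: weak_C1_topology_def weak_C1_nbhd_def)
  show "C1_maps A \<subseteq> topspace (weak_C1_topology A :: ('m \<Rightarrow> real^'k) topology)"
  proof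
    fix f :: "'m \<Rightarrow> real^'k" assume f: "f \<in> C1_maps A"
    obtain c where c: "c \<in> A"
      using some_chart_at[OF assms] unfolding charts_at_def by blast
    \<comment> \<open>For empty \<open>K\<close> the neighbourhood imposes no condition beyond
      membership in \<open>C1_maps A\<close>.\<close>
    have "openin (weak_C1_topology A) (weak_C1_nbhd A f c {} 1)"
      by (intro openin_weak_C1_nbhd f c) auto
    then show "f \<in> topspace (weak_C1_topology A)"
      using subsetD[OF openin_subset weak_C1_nbhd_self[OF f, of 1 c "{}"]] by simp
  qed
qed

text \<open>The generating sets are only given as a subbasis, but one of them suffices for each
  functional to which this is applied, since it looks at a map in one chart and at one
  point.\<close>

lemma weak_C1_continuousI:
  fixes A :: "('m::{t2_space,second_countable_topology}, 'e::euclidean_space) chart set"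
    and \<phi> :: "('m \<Rightarrow> real^'k) \<Rightarrow> 'b::metric_space"
  assumes A: "smooth_atlas A"
    and loc: "\<And>f \<epsilon>. f \<in> C1_maps A \<Longrightarrow> 0 < \<epsilon> \<Longrightarrow> \<exists>c K r. c \<in> A \<and> compact K \<and> K \<subseteq> fst c \<and> 0 < r \<and>
      (\<forall>h\<in>weak_C1_nbhd A f c K r. dist (\<phi> h) (\<phi> f) < \<epsilon>)"
  shows "continuous_map (weak_C1_topology A) euclidean \<phi>"
  unfolding continuous_map_def
proof (intro conjI allI impI)
  show "\<phi> \<in> topspace (weak_C1_topology A) \<rightarrow> topspace euclidean" by simp
  fix U :: "'b set" assume "openin euclidean U"
  then have U: "open U" by simp
  show "openin (weak_C1_topology A) {f \<in> topspace (weak_C1_topology A). \<phi> f \<in> U}"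
  proof (subst openin_subopen, intro ballI)
    fix f assume f: "f \<in> {f \<in> topspace (weak_C1_topology A). \<phi> f \<in> U}"
    then have fC: "f \<in> C1_maps A" by (simp add: topspace_weak_C1_topology[OF A])
    obtain \<epsilon> where \<epsilon>: "0 < \<epsilon>" "\<And>y. dist y (\<phi> f) < \<epsilon> \<Longrightarrow> y \<in> U"
      using U f unfolding open_dist by auto
    obtain c K r where c: "c \<in> A" "compact K" "K \<subseteq> fst c" "0 < r"
      "\<forall>h\<in>weak_C1_nbhd A f c K r. dist (\<phi> h) (\<phi> f) < \<epsilon>"
      using loc[OF fC \<epsilon>(1)] by blast
    have "weak_C1_nbhd A f c K r \<subseteq> {f \<in> topspace (weak_C1_topology A). \<phi> f \<in> U}"
      unfolding topspace_weak_C1_topology[OF A] using c(5) \<epsilon>(2) by (auto simp: weak_C1_nbhd_def)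
    then show "\<exists>T. openin (weak_C1_topology A) T \<and> f \<in> T \<and>
        T \<subseteq> {f \<in> topspace (weak_C1_topology A). \<phi> f \<in> U}"
      using openin_weak_C1_nbhd[OF fC c(1-4)] weak_C1_nbhd_self[OF fC c(4)] by blast
  qed
qed

lemma continuous_map_evaluation:
  fixes A :: "('m::{t2_space,second_countable_topology}, 'e::euclidean_space) chart set"
  assumes A: "smooth_atlas A"
  shows "continuous_map (weak_C1_topology A) euclidean (\<lambda>f. f p :: real^'k)"
proof (rule weak_C1_continuousI[OF A])
  fix f :: "'m \<Rightarrow> real^'k" and \<epsilon> :: real assume "0 < \<epsilon>"
  then show "\<exists>c K r. c \<in> A \<and> compact K \<and> K \<subseteq> fst c \<and> 0 < r \<and>
      (\<forall>h\<in>weak_C1_nbhd A f c K r. dist (h p) (f p) < \<epsilon>)"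
    using some_chart_at[OF A, of p]
    by (intro exI[of _ "SOME c. c \<in> charts_at A p"] exI[of _ "{p}"] exI[of _ \<epsilon>])
       (simp add: charts_at_def weak_C1_nbhd_def dist_norm)
qed

lemma continuous_map_chart_deriv:
  fixes A :: "('m::{t2_space,second_countable_topology}, 'e::euclidean_space) chart set"
  assumes A: "smooth_atlas A"
  shows "continuous_map (weak_C1_topology A) euclideanreal (\<lambda>f. chart_deriv A p f e $ (i :: 'k::finite))"
proof (rule weak_C1_continuousI[OF A])
  fix f :: "'m \<Rightarrow> real^'k" and \<epsilon> :: real assume f: "f \<in> C1_maps A" and \<epsilon>: "0 < \<epsilon>"
  define c where "c = (SOME c. c \<in> charts_at A p)"
  have c: "c \<in> charts_at A p" unfolding c_def by (rule some_chart_at[OF A])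
  \<comment> \<open>The summand 1 permits \<open>e = 0\<close> and makes
    \<open>r * norm e < \<epsilon>\<close> strict.\<close>
  define r where "r = \<epsilon> / (norm e + 1)"
  have r: "0 < r" "r * norm e < \<epsilon>"
  proof -
    show "0 < r" using \<epsilon> by (simp add: r_def add_nonneg_pos)
    have "r * norm e < r * (norm e + 1)" using \<open>0 < r\<close> by simp
    also have "\<dots> = \<epsilon>" unfolding r_def by (simp add: add_nonneg_eq_0_iff)
    finally show "r * norm e < \<epsilon>" .
  qed
  have "dist (chart_deriv A p h e $ i) (chart_deriv A p f e $ i) < \<epsilon>"
    if h: "h \<in> weak_C1_nbhd A f c {p} r" for h
  proof -
    let ?D = "\<lambda>v. chart_deriv A p h v - chart_deriv A p f v"
    have hC: "h \<in> C1_maps A" using h by (simp add: weak_C1_nbhd_def)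
    have on: "onorm ?D < r" using h by (simp add: weak_C1_nbhd_def chart_deriv_def c_def Let_def)
    have bl: "bounded_linear ?D"
      using linear_compose_sub[OF linear_chart_deriv[OF A hC] linear_chart_deriv[OF A f]]
      by (simp add: linear_conv_bounded_linear)
    have "dist (chart_deriv A p h e $ i) (chart_deriv A p f e $ i) = \<bar>?D e $ i\<bar>"
      by (simp add: dist_real_def)
    also have "\<dots> \<le> norm (?D e)" by (rule component_le_norm_cart)
    also have "\<dots> \<le> onorm ?D * norm e" by (rule onorm[OF bl])
    also have "\<dots> \<le> r * norm e" using on by (intro mult_right_mono) auto
    also have "\<dots> < \<epsilon>" by (rule r(2))
    finally show ?thesis .
  qed
  then show "\<exists>c K r. c \<in> A \<and> compact K \<and> K \<subseteq> fst c \<and> 0 < r \<and>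
      (\<forall>h\<in>weak_C1_nbhd A f c K r. dist (chart_deriv A p h e $ i) (chart_deriv A p f e $ i) < \<epsilon>)"
    using c r(1) by (intro exI[of _ c] exI[of _ "{p}"] exI[of _ r]) (simp add: charts_at_def)
qed

lemma continuous_map_det:
  fixes M :: "'a \<Rightarrow> 'k::finite \<Rightarrow> 'k \<Rightarrow> real"
  assumes "\<And>i j. continuous_map T euclideanreal (\<lambda>x. M x i j)"
  shows "continuous_map T euclideanreal (\<lambda>x. det ((\<chi> i j. M x i j) :: real^'k^'k))"
  unfolding det_def
  by (intro continuous_map_sum continuous_map_real_mult continuous_map_prod)
     (simp_all add: assms finite_permutations)

lemma continuous_map_jacobian:
  fixes A :: "('m::{t2_space,second_countable_topology}, 'e::euclidean_space) chart set"
  assumes A: "smooth_atlas A" and g: "riemannian_metric A g"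
  shows "continuous_map (weak_C1_topology A) euclideanreal (jacobian A g p :: ('m \<Rightarrow> real^'k) \<Rightarrow> real)"
proof -
  obtain E :: "'e set" where E: "finite E" and
    J: "\<forall>f\<in>C1_maps A. jacobian A g p f =
       sqrt (det ((\<chi> i j. \<Sum>e\<in>E. chart_deriv A p f e $ i * chart_deriv A p f e $ j) :: real^'k^'k))"
    by (rule jacobian_wedge_coordinates[OF A g])
  have "continuous_map (weak_C1_topology A) euclideanreal
      (sqrt \<circ> (\<lambda>f. det ((\<chi> i j. \<Sum>e\<in>E. chart_deriv A p f e $ i * chart_deriv A p f e $ j) :: real^'k^'k)))"
  proof (rule continuous_map_compose)
    show "continuous_map (weak_C1_topology A) euclideanreal
        (\<lambda>f. det ((\<chi> i j. \<Sum>e\<in>E. chart_deriv A p f e $ i * chart_deriv A p f e $ j) :: real^'k^'k))"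
      by (intro continuous_map_det continuous_map_sum continuous_map_real_mult
          continuous_map_chart_deriv[OF A] E)
    show "continuous_map euclideanreal euclideanreal sqrt"
      by (simp add: continuous_map_iff_continuous2 continuous_on_real_sqrt)
  qed
  then show ?thesis
    by (rule continuous_map_eq) (simp add: topspace_weak_C1_topology[OF A] J)
qed

lemma continuous_map_wedge:
  fixes A :: "('m::{t2_space,second_countable_topology}, 'e::euclidean_space) chart set"
  assumes A: "smooth_atlas A" and g: "riemannian_metric A g"
  shows "continuous_map (weak_C1_topology A) euclideanreal
    (\<lambda>f :: 'm \<Rightarrow> real^'k. wedge A p (d_component A p f) v)"
proof (cases "range v \<subseteq> tangent_space A p")
  case True
  obtain E :: "'e set" where E: "finite E" and
    "\<forall>f\<in>C1_maps A. jacobian A g p f =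
       sqrt (det ((\<chi> i j. \<Sum>e\<in>E. chart_deriv A p f e $ i * chart_deriv A p f e $ j) :: real^'k^'k))" and
    W: "\<forall>v. range v \<subseteq> tangent_space A p \<longrightarrow> (\<exists>b. \<forall>f\<in>C1_maps A. wedge A p (d_component A p f) v =
       det ((\<chi> i j. \<Sum>e\<in>E. chart_deriv A p f e $ i * b j e) :: real^'k^'k))"
    by (rule jacobian_wedge_coordinates[OF A g])
  obtain b where b: "\<forall>f\<in>C1_maps A. wedge A p (d_component A p f) v =
       det ((\<chi> i j. \<Sum>e\<in>E. chart_deriv A p f e $ i * b j e) :: real^'k^'k)"
    using W True by blast
  have "continuous_map (weak_C1_topology A) euclideanreal
      (\<lambda>f. det ((\<chi> i j. \<Sum>e\<in>E. chart_deriv A p f e $ i * b j e) :: real^'k^'k))"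
    by (intro continuous_map_det continuous_map_sum continuous_map_real_mult
        continuous_map_chart_deriv[OF A] E) simp
  then show ?thesis
    by (rule continuous_map_eq) (simp add: topspace_weak_C1_topology[OF A] b)
next
  case False
  then show ?thesis by (simp add: wedge_def)
qed

text \<open>Continuity and domination by the Jacobian are the two conditions that
  \<open>J_dominated_limit\<close> places on an integrand; both pass from single evaluations to
  finite linear combinations.\<close>

lemma multivector_wedge:
  fixes A :: "('m::{t2_space,second_countable_topology}, 'e::euclidean_space) chart set"
    and u :: "('m, 'e, 'k::finite) kform \<Rightarrow> real"
  assumes A: "smooth_atlas A" and g: "riemannian_metric A g" and u: "u \<in> multivectors A p"
  shows "continuous_map (weak_C1_topology A) euclideanreal (\<lambda>f :: 'm \<Rightarrow> real^'k. u (wedge A p (d_component A p f)))"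
    and "\<exists>C\<ge>0. \<forall>f\<in>C1_maps A. \<bar>u (wedge A p (d_component A p f))\<bar> \<le> C * jacobian A g p f"
proof -
  obtain n :: nat and a :: "nat \<Rightarrow> real" and v
    where U: "u = (\<lambda>\<omega>. if \<omega> \<in> alternating_forms A p then \<Sum>l<n. a l * \<omega> (v l) else 0)"
    using u unfolding multivectors_def by blast
  have uw: "u (wedge A p (d_component A p f)) = (\<Sum>l<n. a l * wedge A p (d_component A p f) (v l))"
    if "f \<in> C1_maps A" for f
    unfolding U using wedge_alternating[OF A that] by simp
  have "continuous_map (weak_C1_topology A) euclideanreal
      (\<lambda>f :: 'm \<Rightarrow> real^'k. \<Sum>l<n. a l * wedge A p (d_component A p f) (v l))"
    by (intro continuous_map_sum continuous_map_real_mult continuous_map_wedge[OF A g]) simp_all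
  then show "continuous_map (weak_C1_topology A) euclideanreal (\<lambda>f :: 'm \<Rightarrow> real^'k. u (wedge A p (d_component A p f)))"
    by (rule continuous_map_eq) (simp add: topspace_weak_C1_topology[OF A] uw)
  have "\<forall>l. \<exists>C\<ge>0. \<forall>f\<in>C1_maps A. \<bar>wedge A p (d_component A p f) (v l)\<bar> \<le> C * jacobian A g p f"
    using wedge_le_jacobian[OF A g] by blast
  then obtain C where C: "\<And>l. 0 \<le> C l"
    "\<And>l f. f \<in> C1_maps A \<Longrightarrow> \<bar>wedge A p (d_component A p f) (v l)\<bar> \<le> C l * jacobian A g p f"
    by metis
  show "\<exists>C\<ge>0. \<forall>f\<in>C1_maps A. \<bar>u (wedge A p (d_component A p f))\<bar> \<le> C * jacobian A g p f"
  proof (intro exI conjI ballI)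
    show "0 \<le> (\<Sum>l<n. \<bar>a l\<bar> * C l)" using C(1) by (intro sum_nonneg) simp
    fix f :: "'m \<Rightarrow> real^'k" assume f: "f \<in> C1_maps A"
    have "\<bar>u (wedge A p (d_component A p f))\<bar> \<le> (\<Sum>l<n. \<bar>a l * wedge A p (d_component A p f) (v l)\<bar>)"
      unfolding uw[OF f] by (rule sum_abs)
    also have "\<dots> \<le> (\<Sum>l<n. \<bar>a l\<bar> * (C l * jacobian A g p f))"
      unfolding abs_mult by (intro sum_mono mult_left_mono C(2) f) simp
    finally show "\<bar>u (wedge A p (d_component A p f))\<bar> \<le> (\<Sum>l<n. \<bar>a l\<bar> * C l) * jacobian A g p f"
      by (simp add: sum_distrib_right mult.assoc)
  qed
qed

section \<open>Borel measurability of continuous functionals\<close>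

lemma space_C1_borel:
  fixes A :: "('m::{t2_space,second_countable_topology}, 'e::euclidean_space) chart set"
  assumes "smooth_atlas A"
  shows "space (C1_borel A :: ('m \<Rightarrow> real^'k) measure) = C1_maps A"
  using openin_subset[of "weak_C1_topology A"]
  by (auto simp: C1_borel_def topspace_weak_C1_topology[OF assms] intro!: space_measure_of)

lemma continuous_map_borel_measurable:
  fixes A :: "('m::{t2_space,second_countable_topology}, 'e::euclidean_space) chart set"
    and \<phi> :: "('m \<Rightarrow> real^'k) \<Rightarrow> 'b::topological_space"
  assumes A: "smooth_atlas A" and \<phi>: "continuous_map (weak_C1_topology A) euclidean \<phi>"
  shows "\<phi> \<in> borel_measurable (C1_borel A)"
proof (rule borel_measurableI)
  fix U :: "'b set" assume "open U"
  then have "openin (weak_C1_topology A) {f \<in> topspace (weak_C1_topology A). \<phi> f \<in> U}"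
    using \<phi> by (simp add: continuous_map_def)
  moreover have "{f \<in> topspace (weak_C1_topology A). \<phi> f \<in> U} = \<phi> -` U \<inter> space (C1_borel A)"
    by (auto simp: topspace_weak_C1_topology[OF A] space_C1_borel[OF A])
  moreover have "{U. openin (weak_C1_topology A) U} \<subseteq> Pow (C1_maps A :: ('m \<Rightarrow> real^'k) set)"
    using openin_subset[of "weak_C1_topology A"] by (auto simp: topspace_weak_C1_topology[OF A])
  ultimately show "\<phi> -` U \<inter> space (C1_borel A) \<in> sets (C1_borel A)"
    unfolding C1_borel_def by (simp add: in_measure_of)
qed

subsection \<open>Mixtures and conditional laws\<close>

text \<open>Written as the choice of a measure by a coin with bias \<open>a\<close>, so that
  measurability and integration are instances of the rules for \<open>bind\<close>.\<close>

definition mixture :: "real \<Rightarrow> 'a measure \<Rightarrow> 'a measure \<Rightarrow> 'a measure" where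
  "mixture a M N = measure_pmf (bernoulli_pmf a) \<bind> (\<lambda>b. if b then M else N)"

context
  fixes a :: real and M0 M1 N :: "'a measure"
  assumes a: "0 \<le> a" "a \<le> 1"
    and M: "prob_space M0" "prob_space M1" "sets M0 = sets N" "sets M1 = sets N"
begin

lemma mixture_kernel:
  "(\<lambda>b. if b then M0 else M1) \<in> measurable (measure_pmf (bernoulli_pmf a)) (subprob_algebra N)"
  using M by (auto simp: space_subprob_algebra prob_space_imp_subprob_space)

lemma sets_mixture: "sets (mixture a M0 M1) = sets N"
  unfolding mixture_def by (rule sets_bind) (use M in auto)

lemma nn_integral_mixture:
  assumes "\<phi> \<in> borel_measurable N"
  shows "(\<integral>\<^sup>+f. \<phi> f \<partial>mixture a M0 M1) = ennreal a * (\<integral>\<^sup>+f. \<phi> f \<partial>M0) + ennreal (1 - a) * (\<integral>\<^sup>+f. \<phi> f \<partial>M1)"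
  unfolding mixture_def using a
  by (simp add: nn_integral_bind[OF assms mixture_kernel] mult.commute ennreal_minus)

lemma emeasure_mixture:
  assumes "B \<in> sets N"
  shows "emeasure (mixture a M0 M1) B = ennreal a * emeasure M0 B + ennreal (1 - a) * emeasure M1 B"
  using nn_integral_mixture[of "indicator B"] assms by (simp add: sets_mixture M)

lemma prob_space_mixture: "prob_space (mixture a M0 M1)"
proof
  have sp: "space (mixture a M0 M1) = space N" "space M0 = space N" "space M1 = space N"
    using sets_mixture M by (auto dest: sets_eq_imp_space_eq)
  have "emeasure (mixture a M0 M1) (space N) = ennreal a + ennreal (1 - a)"
    using prob_space.emeasure_space_1[OF M(1)] prob_space.emeasure_space_1[OF M(2)]
    by (simp add: emeasure_mixture sp)
  then show "emeasure (mixture a M0 M1) (space (mixture a M0 M1)) = 1"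
    using a by (simp add: sp flip: ennreal_plus)
qed

lemma integrable_mixture:
  fixes \<phi> :: "'a \<Rightarrow> real"
  assumes "integrable M0 \<phi>" "integrable M1 \<phi>"
  shows "integrable (mixture a M0 M1) \<phi>"
    and "(\<integral>f. \<phi> f \<partial>mixture a M0 M1) = a * (\<integral>f. \<phi> f \<partial>M0) + (1 - a) * (\<integral>f. \<phi> f \<partial>M1)"
proof -
  have \<phi>: "\<phi> \<in> borel_measurable N" "\<phi> \<in> borel_measurable M0"
    using assms(1) measurable_cong_sets[OF M(3) refl] by (auto dest: borel_measurable_integrable)
  have m: "\<phi> \<in> borel_measurable (mixture a M0 M1)"
    using \<phi>(1) measurable_cong_sets[OF sets_mixture refl] by blast
  \<comment> \<open>Applied with \<open>h\<close> the identity and the negation, this gives the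
    positive and the negative part.\<close>
  have nn: "(\<integral>\<^sup>+f. ennreal (h (\<phi> f)) \<partial>mixture a M0 M1) =
      ennreal a * (\<integral>\<^sup>+f. ennreal (h (\<phi> f)) \<partial>M0) + ennreal (1 - a) * (\<integral>\<^sup>+f. ennreal (h (\<phi> f)) \<partial>M1)"
    if "h \<in> borel_measurable borel" for h :: "real \<Rightarrow> real"
    by (rule nn_integral_mixture) (use \<phi>(1) that in measurable)
  have fin0: "(\<integral>\<^sup>+f. ennreal (\<phi> f) \<partial>M0) < \<infinity>" "(\<integral>\<^sup>+f. ennreal (- \<phi> f) \<partial>M0) < \<infinity>"
    and fin1: "(\<integral>\<^sup>+f. ennreal (\<phi> f) \<partial>M1) < \<infinity>" "(\<integral>\<^sup>+f. ennreal (- \<phi> f) \<partial>M1) < \<infinity>"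
    using assms by (auto simp: real_integrable_def less_top)
  note nns = nn[of "\<lambda>x. x", simplified] nn[of "\<lambda>x. - x", simplified]
  show int: "integrable (mixture a M0 M1) \<phi>"
    unfolding real_integrable_def using fin0 fin1 m
    by (simp add: nns ennreal_mult_eq_top_iff less_top)
  \<comment> \<open>\<open>enn2real\<close> sends infinity to 0 and is additive only on finite
    values, hence the bounds.\<close>
  have e2: "enn2real (ennreal a * x + ennreal (1 - a) * y) = a * enn2real x + (1 - a) * enn2real y"
    if "x < \<infinity>" "y < \<infinity>" for x y
    using that a by (simp add: enn2real_plus enn2real_mult ennreal_mult_less_top less_top)
  show "(\<integral>f. \<phi> f \<partial>mixture a M0 M1) = a * (\<integral>f. \<phi> f \<partial>M0) + (1 - a) * (\<integral>f. \<phi> f \<partial>M1)"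
    using fin0 fin1
    by (simp add: real_lebesgue_integral_def int assms nns e2 algebra_simps)
qed

end

text \<open>A single point is Lebesgue null, so an almost everywhere statement alone says nothing at
  \<open>z\<close>. With continuity a nonzero value would persist on a ball, which has positive
  measure.\<close>

lemma isCont_AE_zero:
  fixes h :: "'a::euclidean_space \<Rightarrow> real"
  assumes "isCont h z" and ae: "AE x in lborel. h x = 0"
  shows "h z = 0"
proof (rule ccontr)
  assume "h z \<noteq> 0"
  then have "eventually (\<lambda>x. h x \<noteq> 0) (nhds z)"
    using assms(1) unfolding isCont_def by (intro tendsto_imp_eventually_ne) (auto simp: tendsto_at_iff_tendsto_nhds)
  then obtain e where e: "e > 0" "\<And>x. dist x z < e \<Longrightarrow> h x \<noteq> 0"
    unfolding eventually_nhds_metric by blast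
  have "AE x in lborel. x \<notin> ball z e"
    using ae by eventually_elim (use e(2) in \<open>force simp: dist_commute\<close>)
  then have "emeasure lborel (ball z e) = 0"
    by (simp add: AE_iff_measurable[OF _ refl] ball_def)
  then have "measure lborel (ball z e) = 0" by (simp add: measure_def)
  then show False using content_ball_pos[OF e(1), of z] by (simp add: measure_completion)
qed

section \<open>Regular conditional probabilities: uniqueness and mixing\<close>

lemma measurable_evaluation:
  fixes A :: "('m::{t2_space,second_countable_topology}, 'e::euclidean_space) chart set"
  assumes "smooth_atlas A"
  shows "(\<lambda>f. f p :: real^'k) \<in> borel_measurable (C1_borel A)"
  by (rule continuous_map_borel_measurable[OF assms continuous_map_evaluation[OF assms]])

lemma regular_cond_probD:
  assumes "regular_cond_prob A P X p \<mu>"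
  shows "prob_space (\<mu> x)" "sets (\<mu> x) = sets (C1_borel A)"
    and "B \<in> sets (C1_borel A) \<Longrightarrow> (\<lambda>x. emeasure (\<mu> x) B) \<in> borel_measurable borel"
    and "B \<in> sets (C1_borel A) \<Longrightarrow> V \<in> sets borel \<Longrightarrow> emeasure P {w \<in> space P. X w \<in> B \<and> X w p \<in> V} =
        (\<integral>\<^sup>+x\<in>V. emeasure (\<mu> x) B \<partial>distr P borel (\<lambda>w. X w p))"
  using assms unfolding regular_cond_prob_def by blast+

lemma regular_cond_prob_kernel:
  assumes "regular_cond_prob A P X p \<mu>"
  shows "\<mu> \<in> measurable borel (subprob_algebra (C1_borel A))"
  using regular_cond_probD[OF assms]
  by (intro measurable_subprob_algebra) (auto intro: prob_space_imp_subprob_space)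

text \<open>Composing the law of \<open>X(p)\<close>, restricted to \<open>V\<close>, with either
  kernel gives the same measure, the law of \<open>X\<close> on the event that \<open>X(p)\<close>
  lies in \<open>V\<close>. Integrating \<phi> against it shows that the two conditional integrals,
  as densities, agree on every \<open>V\<close>. The exceptional null set may depend on \<phi>, so
  no countable generator of the Borel sets enters.\<close>

lemma regular_cond_prob_unique:
  fixes A :: "('m::{t2_space,second_countable_topology}, 'e::euclidean_space) chart set"
    and X :: "'w \<Rightarrow> 'm \<Rightarrow> real^'k"
  assumes P: "prob_space P" and X: "(\<lambda>w. X w p) \<in> borel_measurable P"
    and \<mu>: "regular_cond_prob A P X p \<mu>" and \<nu>: "regular_cond_prob A P X p \<nu>"
    and \<phi>: "\<phi> \<in> borel_measurable (C1_borel A)"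
  shows "AE x in distr P borel (\<lambda>w. X w p). (\<integral>\<^sup>+f. \<phi> f \<partial>\<mu> x) = (\<integral>\<^sup>+f. \<phi> f \<partial>\<nu> x)"
proof -
  define L where "L = distr P borel (\<lambda>w. X w p)"
  interpret L: prob_space L
    unfolding L_def by (rule prob_space.prob_space_distr[OF P X])
  have sL: "sets L = sets borel" "space L = UNIV" by (simp_all add: L_def)
  have ker: "\<kappa> \<in> measurable L (subprob_algebra (C1_borel A))" if "regular_cond_prob A P X p \<kappa>" for \<kappa>
    using regular_cond_prob_kernel[OF that] measurable_cong_sets[OF sL(1) refl] by blast
  \<comment> \<open>Multiplying the law by \<open>indicator V\<close> restricts it to
    \<open>V\<close> without changing its measurable sets, so the kernels stay measurable.\<close>
  have kern: "\<kappa> \<in> measurable (density L (indicator V)) (subprob_algebra (C1_borel A))"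
    if "regular_cond_prob A P X p \<kappa>" for \<kappa> V
    using ker[OF that] by simp
  have m: "(\<lambda>x. \<integral>\<^sup>+f. \<phi> f \<partial>\<kappa> x) \<in> borel_measurable L" if "regular_cond_prob A P X p \<kappa>" for \<kappa>
    using measurable_compose[OF ker[OF that] nn_integral_measurable_subprob_algebra[OF \<phi>]] .
  have em: "emeasure (density L (indicator V) \<bind> \<kappa>) B = emeasure P {w \<in> space P. X w \<in> B \<and> X w p \<in> V}"
    if \<kappa>: "regular_cond_prob A P X p \<kappa>" and B: "B \<in> sets (C1_borel A)" and V: "V \<in> sets borel" for \<kappa> B V
  proof -
    have "emeasure (density L (indicator V) \<bind> \<kappa>) B = (\<integral>\<^sup>+x. emeasure (\<kappa> x) B \<partial>density L (indicator V))"
      by (rule emeasure_bind[OF _ kern[OF \<kappa>] B]) (simp add: sL)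
    also have "\<dots> = (\<integral>\<^sup>+x. indicator V x * emeasure (\<kappa> x) B \<partial>L)"
      by (intro nn_integral_density)
         (use V regular_cond_probD(3)[OF \<kappa> B] sL measurable_cong_sets[OF sL(1) refl] in auto)
    also have "\<dots> = emeasure P {w \<in> space P. X w \<in> B \<and> X w p \<in> V}"
      unfolding regular_cond_probD(4)[OF \<kappa> B V] L_def[symmetric] by (simp add: mult.commute)
    finally show ?thesis .
  qed
  have "density L (\<lambda>x. \<integral>\<^sup>+f. \<phi> f \<partial>\<mu> x) = density L (\<lambda>x. \<integral>\<^sup>+f. \<phi> f \<partial>\<nu> x)"
  proof (rule measure_eqI)
    fix V assume "V \<in> sets (density L (\<lambda>x. \<integral>\<^sup>+f. \<phi> f \<partial>\<mu> x))"
    then have V: "V \<in> sets borel" "V \<in> sets L" by (simp_all add: sL)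
    have *: "emeasure (density L (\<lambda>x. \<integral>\<^sup>+f. \<phi> f \<partial>\<kappa> x)) V =
        (\<integral>\<^sup>+f. \<phi> f \<partial>(density L (indicator V) \<bind> \<kappa>))" if \<kappa>: "regular_cond_prob A P X p \<kappa>" for \<kappa>
    proof -
      have "(\<integral>\<^sup>+f. \<phi> f \<partial>(density L (indicator V) \<bind> \<kappa>)) =
          (\<integral>\<^sup>+x. \<integral>\<^sup>+f. \<phi> f \<partial>\<kappa> x \<partial>density L (indicator V))"
        by (rule nn_integral_bind[OF \<phi> kern[OF \<kappa>]])
      also have "\<dots> = (\<integral>\<^sup>+x. indicator V x * (\<integral>\<^sup>+f. \<phi> f \<partial>\<kappa> x) \<partial>L)"
        by (intro nn_integral_density m[OF \<kappa>]) (use V in auto)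
      finally show ?thesis
        using emeasure_density[OF m[OF \<kappa>] V(2)] by (simp add: mult.commute)
    qed
    have "density L (indicator V) \<bind> \<mu> = density L (indicator V) \<bind> \<nu>"
    proof (rule measure_eqI)
      have s: "sets (density L (indicator V) \<bind> \<kappa>) = sets (C1_borel A)"
        if "regular_cond_prob A P X p \<kappa>" for \<kappa>
        by (rule sets_bind) (use regular_cond_probD(2)[OF that] sL in auto)
      show "sets (density L (indicator V) \<bind> \<mu>) = sets (density L (indicator V) \<bind> \<nu>)"
        by (simp only: s[OF \<mu>] s[OF \<nu>])
      fix B assume "B \<in> sets (density L (indicator V) \<bind> \<mu>)"
      then have B: "B \<in> sets (C1_borel A)" by (simp only: s[OF \<mu>])
      show "emeasure (density L (indicator V) \<bind> \<mu>) B = emeasure (density L (indicator V) \<bind> \<nu>) B"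
        by (simp only: em[OF \<mu> B V(1)] em[OF \<nu> B V(1)])
    qed
    then show "emeasure (density L (\<lambda>x. \<integral>\<^sup>+f. \<phi> f \<partial>\<mu> x)) V = emeasure (density L (\<lambda>x. \<integral>\<^sup>+f. \<phi> f \<partial>\<nu> x)) V"
      by (simp only: *[OF \<mu>] *[OF \<nu>])
  qed simp
  then show ?thesis
    unfolding L_def[symmetric] by (rule L.density_unique[OF m[OF \<mu>] m[OF \<nu>]])
qed

lemma nn_integral_distr_density:
  fixes X :: "'w \<Rightarrow> 'b::euclidean_space"
  assumes d: "distributed P lborel X (\<lambda>x. ennreal (\<rho> x))" and \<phi>: "\<phi> \<in> borel_measurable borel"
  shows "(\<integral>\<^sup>+x. \<phi> x \<partial>distr P borel X) = (\<integral>\<^sup>+x. ennreal (\<rho> x) * \<phi> x \<partial>lborel)"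
proof -
  have "distr P borel X = distr P lborel X" by (rule distr_cong) simp_all
  then have "(\<integral>\<^sup>+x. \<phi> x \<partial>distr P borel X) = (\<integral>\<^sup>+x. \<phi> x \<partial>density lborel (\<lambda>x. ennreal (\<rho> x)))"
    using d by (simp add: distributed_def)
  also have "\<dots> = (\<integral>\<^sup>+x. ennreal (\<rho> x) * \<phi> x \<partial>lborel)"
    using d \<phi> by (intro nn_integral_density) (auto simp: distributed_def)
  finally show ?thesis .
qed

lemma AE_distr_density:
  fixes X :: "'w \<Rightarrow> 'b::euclidean_space"
  assumes d: "distributed P lborel X (\<lambda>x. ennreal (\<rho> x))" and ae: "AE x in distr P borel X. Q x"
  shows "AE x in lborel. 0 < \<rho> x \<longrightarrow> Q x"
proof -
  have "distr P borel X = distr P lborel X" by (rule distr_cong) simp_all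
  then have "distr P borel X = density lborel (\<lambda>x. ennreal (\<rho> x))"
    using d by (simp add: distributed_def)
  then have "AE x in density lborel (\<lambda>x. ennreal (\<rho> x)). Q x"
    using ae by (simp only:)
  then have "AE x in lborel. 0 < ennreal (\<rho> x) \<longrightarrow> Q x"
    using d by (subst (asm) AE_density) (auto simp: distributed_def)
  then show ?thesis by simp
qed

text \<open>The joint law of each field and its value at \<open>p\<close> is disintegrated against
  Lebesgue measure, and the two pieces are recombined. Bayes' formula enters in the undivided form
  of the last assumption, so zeros of the mixed density need no separate treatment.\<close>

lemma regular_cond_prob_mixture:
  fixes A :: "('m::{t2_space,second_countable_topology}, 'e::euclidean_space) chart set"
    and X0 X1 Xt :: "'w \<Rightarrow> 'm \<Rightarrow> real^'k"
  assumes A: "smooth_atlas A" and P: "prob_space P"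
    and X: "X0 \<in> measurable P (C1_borel A)" "X1 \<in> measurable P (C1_borel A)" "Xt \<in> measurable P (C1_borel A)"
    and law: "\<And>C. C \<in> sets (C1_borel A) \<Longrightarrow> emeasure P {w \<in> space P. Xt w \<in> C} =
      ennreal (1 - t) * emeasure P {w \<in> space P. X0 w \<in> C} + ennreal t * emeasure P {w \<in> space P. X1 w \<in> C}"
    and t: "0 \<le> t" "t \<le> 1"
    and \<mu>0: "regular_cond_prob A P X0 p \<mu>0" and \<mu>1: "regular_cond_prob A P X1 p \<mu>1"
    and d0: "distributed P lborel (\<lambda>w. X0 w p) (\<lambda>x. ennreal (\<rho>0 x))" "\<And>x. 0 \<le> \<rho>0 x"
    and d1: "distributed P lborel (\<lambda>w. X1 w p) (\<lambda>x. ennreal (\<rho>1 x))" "\<And>x. 0 \<le> \<rho>1 x"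
    and a: "\<And>x. 0 \<le> a x" "\<And>x. a x \<le> 1" "a \<in> borel_measurable borel"
      "\<And>x. a x * ((1 - t) * \<rho>0 x + t * \<rho>1 x) = (1 - t) * \<rho>0 x"
  shows "distributed P lborel (\<lambda>w. Xt w p) (\<lambda>x. ennreal ((1 - t) * \<rho>0 x + t * \<rho>1 x))"
    and "regular_cond_prob A P Xt p (\<lambda>x. mixture (a x) (\<mu>0 x) (\<mu>1 x))"
proof -
  let ?N = "C1_borel A :: ('m \<Rightarrow> real^'k) measure"
  let ?r = "\<lambda>x. (1 - t) * \<rho>0 x + t * \<rho>1 x"
  have ev: "(\<lambda>f. f p) \<in> borel_measurable ?N" by (rule measurable_evaluation[OF A])
  have Xp: "(\<lambda>w. Y w p) \<in> borel_measurable P" if "Y \<in> measurable P ?N" for Y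
    using measurable_compose[OF that ev] .
  have [measurable]: "\<rho>0 \<in> borel_measurable borel" "\<rho>1 \<in> borel_measurable borel"
    using distributed_real_measurable[OF d0(2,1)] distributed_real_measurable[OF d1(2,1)] by auto
  have rn: "0 \<le> ?r x" for x using t d0(2) d1(2) by simp
  \<comment> \<open>A condition on the value at \<open>p\<close> is a Borel condition on the whole
    map, so the mixture formula for the law of \<open>Xt\<close> already covers the joint law with
    the value at \<open>p\<close>.\<close>
  have cyl: "{w \<in> space P. Y w \<in> B \<and> Y w p \<in> V} = {w \<in> space P. Y w \<in> B \<inter> ((\<lambda>f. f p) -` V \<inter> space ?N)}"
    if "Y \<in> measurable P ?N" for Y B V
    using measurable_space[OF that] by auto
  have joint: "emeasure P {w \<in> space P. Xt w \<in> B \<and> Xt w p \<in> V} =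
      (\<integral>\<^sup>+x. ennreal ((1 - t) * \<rho>0 x) * (emeasure (\<mu>0 x) B * indicator V x)
        + ennreal (t * \<rho>1 x) * (emeasure (\<mu>1 x) B * indicator V x) \<partial>lborel)"
    if B: "B \<in> sets ?N" and V: "V \<in> sets borel" for B V
  proof -
    have m: "(\<lambda>x. emeasure (\<mu>0 x) B * indicator V x) \<in> borel_measurable borel"
      "(\<lambda>x. emeasure (\<mu>1 x) B * indicator V x) \<in> borel_measurable borel"
      using regular_cond_probD(3)[OF \<mu>0 B] regular_cond_probD(3)[OF \<mu>1 B] V by auto
    have [measurable]: "(\<lambda>x. emeasure (\<mu>0 x) B * indicator V x) \<in> borel_measurable lborel"
      "(\<lambda>x. emeasure (\<mu>1 x) B * indicator V x) \<in> borel_measurable lborel"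
      using m by simp_all
    have "B \<inter> ((\<lambda>f. f p) -` V \<inter> space ?N) \<in> sets ?N"
      using B measurable_sets[OF ev V] by blast
    then have "emeasure P {w \<in> space P. Xt w \<in> B \<and> Xt w p \<in> V} =
        ennreal (1 - t) * emeasure P {w \<in> space P. X0 w \<in> B \<and> X0 w p \<in> V} +
        ennreal t * emeasure P {w \<in> space P. X1 w \<in> B \<and> X1 w p \<in> V}"
      unfolding cyl[OF X(1)] cyl[OF X(2)] cyl[OF X(3)] by (rule law)
    also have "\<dots> = ennreal (1 - t) * (\<integral>\<^sup>+x. ennreal (\<rho>0 x) * (emeasure (\<mu>0 x) B * indicator V x) \<partial>lborel)
        + ennreal t * (\<integral>\<^sup>+x. ennreal (\<rho>1 x) * (emeasure (\<mu>1 x) B * indicator V x) \<partial>lborel)"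
      unfolding regular_cond_probD(4)[OF \<mu>0 B V] regular_cond_probD(4)[OF \<mu>1 B V]
        nn_integral_distr_density[OF d0(1) m(1)] nn_integral_distr_density[OF d1(1) m(2)] ..
    also have "\<dots> = (\<integral>\<^sup>+x. ennreal (1 - t) * (ennreal (\<rho>0 x) * (emeasure (\<mu>0 x) B * indicator V x))
        + ennreal t * (ennreal (\<rho>1 x) * (emeasure (\<mu>1 x) B * indicator V x)) \<partial>lborel)"
      by (subst nn_integral_add; (simp add: nn_integral_cmult)?; measurable)
    finally show ?thesis
      using t d0(2) d1(2) by (simp add: ennreal_mult' mult.assoc)
  qed
  show D: "distributed P lborel (\<lambda>w. Xt w p) (\<lambda>x. ennreal (?r x))"
    unfolding distributed_def
  proof (intro conjI measure_eqI)
    show "(\<lambda>w. Xt w p) \<in> measurable P lborel" using Xp[OF X(3)] by simp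
    show "(\<lambda>x. ennreal (?r x)) \<in> borel_measurable lborel" by measurable
    fix V assume "V \<in> sets (distr P lborel (\<lambda>w. Xt w p))"
    then have V: "V \<in> sets borel" by simp
    \<comment> \<open>The density is read off from the joint formula with the whole space as
      \<open>B\<close>.\<close>
    have "emeasure (distr P lborel (\<lambda>w. Xt w p)) V = emeasure P {w \<in> space P. Xt w \<in> space ?N \<and> Xt w p \<in> V}"
      using Xp[OF X(3)] V measurable_space[OF X(3)]
      by (subst emeasure_distr) (auto intro!: arg_cong[where f = "emeasure P"])
    also have "\<dots> = (\<integral>\<^sup>+x. ennreal ((1 - t) * \<rho>0 x) * (emeasure (\<mu>0 x) (space ?N) * indicator V x)
        + ennreal (t * \<rho>1 x) * (emeasure (\<mu>1 x) (space ?N) * indicator V x) \<partial>lborel)"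
      by (rule joint[OF sets.top V])
    also have "\<dots> = (\<integral>\<^sup>+x. ennreal (?r x) * indicator V x \<partial>lborel)"
    proof (intro nn_integral_cong)
      fix x
      have "emeasure (\<mu>0 x) (space ?N) = 1" "emeasure (\<mu>1 x) (space ?N) = 1"
        using prob_space.emeasure_space_1[OF regular_cond_probD(1)[OF \<mu>0]]
          prob_space.emeasure_space_1[OF regular_cond_probD(1)[OF \<mu>1]]
          sets_eq_imp_space_eq[OF regular_cond_probD(2)[OF \<mu>0]]
          sets_eq_imp_space_eq[OF regular_cond_probD(2)[OF \<mu>1]] by simp_all
      then show "ennreal ((1 - t) * \<rho>0 x) * (emeasure (\<mu>0 x) (space ?N) * indicator V x)
          + ennreal (t * \<rho>1 x) * (emeasure (\<mu>1 x) (space ?N) * indicator V x) = ennreal (?r x) * indicator V x"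
        using t d0(2) d1(2) by (simp add: ennreal_plus distrib_right)
    qed
    also have "\<dots> = emeasure (density lborel (\<lambda>x. ennreal (?r x))) V"
      using V by (subst emeasure_density) auto
    finally show "emeasure (distr P lborel (\<lambda>w. Xt w p)) V = emeasure (density lborel (\<lambda>x. ennreal (?r x))) V" .
  qed simp
  let ?\<mu> = "\<lambda>x. mixture (a x) (\<mu>0 x) (\<mu>1 x)"
  have emm: "emeasure (?\<mu> x) B = ennreal (a x) * emeasure (\<mu>0 x) B + ennreal (1 - a x) * emeasure (\<mu>1 x) B"
    if "B \<in> sets ?N" for x B
    by (rule emeasure_mixture[OF a(1,2) regular_cond_probD(1)[OF \<mu>0] regular_cond_probD(1)[OF \<mu>1]
          regular_cond_probD(2)[OF \<mu>0] regular_cond_probD(2)[OF \<mu>1] that])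
  have memm: "(\<lambda>x. emeasure (?\<mu> x) B) \<in> borel_measurable borel" if B: "B \<in> sets ?N" for B
    unfolding emm[OF B] using regular_cond_probD(3)[OF \<mu>0 B] regular_cond_probD(3)[OF \<mu>1 B] a(3) by measurable
  show "regular_cond_prob A P Xt p ?\<mu>"
    unfolding regular_cond_prob_def
  proof (intro conjI allI ballI memm)
    show "prob_space (?\<mu> x)" for x
      by (rule prob_space_mixture[OF a(1,2) regular_cond_probD(1)[OF \<mu>0] regular_cond_probD(1)[OF \<mu>1]
          regular_cond_probD(2)[OF \<mu>0] regular_cond_probD(2)[OF \<mu>1]])
    show "sets (?\<mu> x) = sets ?N" for x
      by (rule sets_mixture[OF a(1,2) regular_cond_probD(1)[OF \<mu>0] regular_cond_probD(1)[OF \<mu>1]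
          regular_cond_probD(2)[OF \<mu>0] regular_cond_probD(2)[OF \<mu>1]])
    fix B V assume B: "B \<in> sets ?N" and V: "V \<in> sets (borel :: (real^'k) measure)"
    have "(\<integral>\<^sup>+x\<in>V. emeasure (?\<mu> x) B \<partial>distr P borel (\<lambda>w. Xt w p)) =
        (\<integral>\<^sup>+x. ennreal (?r x) * (emeasure (?\<mu> x) B * indicator V x) \<partial>lborel)"
      by (rule nn_integral_distr_density[OF D]) (use memm[OF B] V in measurable)
    also have "\<dots> = emeasure P {w \<in> space P. Xt w \<in> B \<and> Xt w p \<in> V}"
      unfolding joint[OF B V]
    proof (intro nn_integral_cong)
      fix x
      \<comment> \<open>Subtracting Bayes' identity from the total density gives its mirror image
        for the complementary weight.\<close>
      have "(1 - a x) * ?r x = t * \<rho>1 x" using a(4)[of x] by (simp add: algebra_simps)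
      then have "ennreal (?r x) * ennreal (1 - a x) = ennreal (t * \<rho>1 x)"
        using ennreal_mult[of "?r x" "1 - a x"] rn[of x] a(2)[of x] by (simp add: mult.commute)
      moreover have "ennreal (?r x) * ennreal (a x) = ennreal ((1 - t) * \<rho>0 x)"
        using ennreal_mult[of "?r x" "a x"] rn[of x] a(1,4)[of x] by (simp add: mult.commute)
      ultimately show "ennreal (?r x) * (emeasure (?\<mu> x) B * indicator V x) =
          ennreal ((1 - t) * \<rho>0 x) * (emeasure (\<mu>0 x) B * indicator V x)
        + ennreal (t * \<rho>1 x) * (emeasure (\<mu>1 x) B * indicator V x)"
        unfolding emm[OF B] by (simp only: distrib_left distrib_right mult.assoc[symmetric])
    qed
    finally show "emeasure P {w \<in> space P. Xt w \<in> B \<and> Xt w p \<in> V} =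
        (\<integral>\<^sup>+x\<in>V. emeasure (?\<mu> x) B \<partial>distr P borel (\<lambda>w. Xt w p))" ..
  qed
qed

subsection \<open>Uniqueness of the zonoid section\<close>

lemma zKROK_withD:
  assumes "zKROK_with A g P X \<rho> \<mu>"
  shows "X \<in> measurable P (C1_borel A)" "AE w in P. regular_value A (X w) 0"
    and "0 \<le> \<rho> p x" "distributed P lborel (\<lambda>w. X w p) (\<lambda>x. ennreal (\<rho> p x))"
    and "isCont (\<lambda>(q, x). \<rho> q x) (p, 0)" "regular_cond_prob A P X p (\<mu> p)"
    and "finite_measure (J_measure A g p (\<mu> p x))"
    and "continuous_map (weak_C1_topology A) euclideanreal \<Psi> \<Longrightarrow> bounded (\<Psi> ` C1_maps A) \<Longrightarrow>
      isCont (\<lambda>(q, x). \<integral>f. \<Psi> f \<partial>J_measure A g q (\<mu> q x)) (p, 0)"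
  using assms unfolding zKROK_with_def by blast+

lemma isCont_slice:
  fixes F :: "'a::t2_space \<Rightarrow> 'b::t2_space \<Rightarrow> 'c::topological_space"
  assumes "isCont (\<lambda>(q, x). F q x) (p, z)"
  shows "isCont (F p) z"
proof -
  have "isCont (\<lambda>x. (p, x)) z" by (intro continuous_intros)
  from isCont_o2[OF this, of "\<lambda>(q, x). F q x"] show ?thesis using assms by simp
qed

context
  fixes A :: "('m::{t2_space,second_countable_topology}, 'e::euclidean_space) chart set"
    and g :: "'m \<Rightarrow> ('m, 'e) tvec \<Rightarrow> ('m, 'e) tvec \<Rightarrow> real"
  assumes A: "smooth_atlas A" and g: "riemannian_metric A g"
begin

section \<open>Integration against \<open>J_measure\<close>\<close>

lemma jacobian_measurable:
  "(jacobian A g p :: ('m \<Rightarrow> real^'k) \<Rightarrow> real) \<in> borel_measurable (C1_borel A)"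
  by (rule continuous_map_borel_measurable[OF A continuous_map_jacobian[OF A g]])

context
  fixes M :: "('m \<Rightarrow> real^'k) measure"
  assumes M: "sets M = sets (C1_borel A)"
begin

lemma space_C1_measure: "space M = C1_maps A"
  using sets_eq_imp_space_eq[OF M] space_C1_borel[OF A] by simp

lemma continuous_map_measurable_C1_measure:
  fixes \<Psi> :: "('m \<Rightarrow> real^'k) \<Rightarrow> real"
  assumes "continuous_map (weak_C1_topology A) euclideanreal \<Psi>"
  shows "\<Psi> \<in> borel_measurable M"
  using continuous_map_borel_measurable[OF A assms] measurable_cong_sets[OF M refl] by blast

lemma AE_jacobian_nonneg: "AE f in M. 0 \<le> jacobian A g p f"
  using jacobian_nonneg[OF A g] by (intro AE_I2) (simp add: space_C1_measure)

lemma integral_J_measure: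
  fixes \<Psi> :: "('m \<Rightarrow> real^'k) \<Rightarrow> real"
  assumes "continuous_map (weak_C1_topology A) euclideanreal \<Psi>"
  shows "(\<integral>f. \<Psi> f \<partial>J_measure A g p M) = (\<integral>f. jacobian A g p f * \<Psi> f \<partial>M)"
  unfolding J_measure_def
  using integral_density[OF continuous_map_measurable_C1_measure[OF assms]
      continuous_map_measurable_C1_measure[OF continuous_map_jacobian[OF A g]] AE_jacobian_nonneg]
  by simp

lemma nn_integral_J_measure:
  assumes "\<phi> \<in> borel_measurable (C1_borel A)"
  shows "(\<integral>\<^sup>+f. \<phi> f \<partial>J_measure A g p M) = (\<integral>\<^sup>+f. ennreal (jacobian A g p f) * \<phi> f \<partial>M)"
  unfolding J_measure_def
proof (rule nn_integral_density)
  show "(\<lambda>f. ennreal (jacobian A g p f)) \<in> borel_measurable M"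
    using continuous_map_measurable_C1_measure[OF continuous_map_jacobian[OF A g]] by measurable
  show "\<phi> \<in> borel_measurable M" using assms measurable_cong_sets[OF M refl] by blast
qed

lemma finite_J_measure_iff:
  "finite_measure (J_measure A g p M) \<longleftrightarrow> (\<integral>\<^sup>+f. ennreal (jacobian A g p f) \<partial>M) < \<infinity>"
proof -
  have "emeasure (J_measure A g p M) (space (J_measure A g p M)) = (\<integral>\<^sup>+f. 1 \<partial>J_measure A g p M)"
    by simp
  also have "\<dots> = (\<integral>\<^sup>+f. ennreal (jacobian A g p f) \<partial>M)"
    by (subst nn_integral_J_measure) simp_all
  finally have *: "emeasure (J_measure A g p M) (space (J_measure A g p M)) = (\<integral>\<^sup>+f. ennreal (jacobian A g p f) \<partial>M)" .
  show ?thesis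
  proof
    assume "finite_measure (J_measure A g p M)"
    from finite_measure.emeasure_finite[OF this, of "space (J_measure A g p M)"]
    show "(\<integral>\<^sup>+f. ennreal (jacobian A g p f) \<partial>M) < \<infinity>" unfolding * by (simp add: less_top)
  next
    assume "(\<integral>\<^sup>+f. ennreal (jacobian A g p f) \<partial>M) < \<infinity>"
    then show "finite_measure (J_measure A g p M)" by (intro finite_measureI) (simp add: * less_top)
  qed
qed

context
  fixes p assumes fin: "finite_measure (J_measure A g p M)"
begin

lemma jacobian_integrable: "integrable M (jacobian A g p)"
  using fin unfolding finite_J_measure_iff
  by (intro integrableI_nonneg continuous_map_measurable_C1_measure
      continuous_map_jacobian[OF A g] AE_jacobian_nonneg)

lemma J_dominated_integrable:
  fixes F :: "('m \<Rightarrow> real^'k) \<Rightarrow> real"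
  assumes F: "continuous_map (weak_C1_topology A) euclideanreal F"
    and C: "\<And>f. f \<in> C1_maps A \<Longrightarrow> \<bar>F f\<bar> \<le> C * jacobian A g p f"
  shows "integrable M F"
proof (rule Bochner_Integration.integrable_bound)
  show "integrable M (\<lambda>f. C * jacobian A g p f)" by (intro integrable_mult_right jacobian_integrable)
  show "F \<in> borel_measurable M" by (rule continuous_map_measurable_C1_measure[OF F])
  have "\<bar>F f\<bar> \<le> \<bar>C * jacobian A g p f\<bar>" if "f \<in> C1_maps A" for f using C[OF that] by linarith
  then show "AE f in M. norm (F f) \<le> norm (C * jacobian A g p f)"
    by (intro AE_I2) (simp add: space_C1_measure)
qed

text \<open>
  The quotient \<open>F / J\<close> is bounded but discontinuous where \<open>J = 0\<close>; truncating the denominator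
  gives bounded continuous test functions.
\<close>

lemma J_dominated_limit:
  fixes F :: "('m \<Rightarrow> real^'k) \<Rightarrow> real"
  assumes F: "continuous_map (weak_C1_topology A) euclideanreal F"
    and C: "\<And>f. f \<in> C1_maps A \<Longrightarrow> \<bar>F f\<bar> \<le> C * jacobian A g p f"
  shows "(\<lambda>n. \<integral>f. F f / max (jacobian A g p f) (1 / Suc n) \<partial>J_measure A g p M) \<longlonglongrightarrow> (\<integral>f. F f \<partial>M)"
proof -
  let ?J = "jacobian A g p :: ('m \<Rightarrow> real^'k) \<Rightarrow> real"
  have cont: "continuous_map (weak_C1_topology A) euclideanreal (\<lambda>f. F f / max (?J f) (1 / Suc n))" for n
    by (intro continuous_map_real_divide continuous_map_real_max F continuous_map_jacobian[OF A g])
       (auto simp: max_def not_le)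
  have "(\<lambda>n. \<integral>f. ?J f * (F f / max (?J f) (1 / Suc n)) \<partial>M) \<longlonglongrightarrow> (\<integral>f. F f \<partial>M)"
  proof (rule integral_dominated_convergence)
    show "integrable M (\<lambda>f. \<bar>F f\<bar>)" using J_dominated_integrable[OF F C] by simp
    show "F \<in> borel_measurable M" by (rule continuous_map_measurable_C1_measure[OF F])
    show "(\<lambda>f. ?J f * (F f / max (?J f) (1 / Suc n))) \<in> borel_measurable M" for n
      by (intro borel_measurable_times continuous_map_measurable_C1_measure cont continuous_map_jacobian[OF A g])
    show "AE f in M. norm (?J f * (F f / max (?J f) (1 / Suc n))) \<le> \<bar>F f\<bar>" for n
    proof (rule AE_mp[OF AE_jacobian_nonneg[of p]], intro AE_I2 impI)
      fix f assume J: "0 \<le> ?J f"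
      have "?J f / max (?J f) (1 / Suc n) \<le> 1"
        by (subst divide_le_eq_1_pos) (auto simp: less_max_iff_disj)
      moreover have "0 \<le> ?J f / max (?J f) (1 / Suc n)" using J by simp
      ultimately have "\<bar>F f\<bar> * \<bar>?J f / max (?J f) (1 / Suc n)\<bar> \<le> \<bar>F f\<bar> * 1"
        by (intro mult_left_mono) auto
      then show "norm (?J f * (F f / max (?J f) (1 / Suc n))) \<le> \<bar>F f\<bar>"
        by (simp add: abs_mult mult.commute)
    qed
    show "AE f in M. (\<lambda>n. ?J f * (F f / max (?J f) (1 / Suc n))) \<longlonglongrightarrow> F f"
    proof (rule AE_I2)
      fix f assume "f \<in> space M"
      then have f: "f \<in> C1_maps A" by (simp add: space_C1_measure)
      show "(\<lambda>n. ?J f * (F f / max (?J f) (1 / Suc n))) \<longlonglongrightarrow> F f"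
      proof (cases "?J f = 0")
        \<comment> \<open>Where the Jacobian vanishes, the bound forces \<open>F f = 0\<close>, so
          the sequence and its limit are both 0.\<close>
        case True
        then show ?thesis using C[OF f] by simp
      next
        case False
        then have J: "?J f > 0" using jacobian_nonneg[OF A g f] by (simp add: less_le)
        have "(\<lambda>n. 1 / real (Suc n)) \<longlonglongrightarrow> 0" using LIMSEQ_inverse_real_of_nat by (simp add: inverse_eq_divide)
        then have "eventually (\<lambda>n. 1 / real (Suc n) < ?J f) sequentially"
          using J by (rule order_tendstoD(2))
        \<comment> \<open>The truncation is eventually inactive, and then the Jacobian cancels
          exactly.\<close>
        then have "eventually (\<lambda>n. F f = ?J f * (F f / max (?J f) (1 / Suc n))) sequentially"
          by eventually_elim (use J in simp)
        then show ?thesis by (rule Lim_transform_eventually[OF tendsto_const])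
      qed
    qed
  qed
  then show ?thesis by (simp only: integral_J_measure[OF cont])
qed

lemma wedge_integrable: "integrable M (\<lambda>f. wedge A p (d_component A p f) v)"
  using wedge_le_jacobian[OF A g, of p v] J_dominated_integrable[OF continuous_map_wedge[OF A g]] by blast

end

end

lemma zKROK_unique:
  fixes X :: "'w \<Rightarrow> 'm \<Rightarrow> real^'k"
  assumes P: "prob_space P" and z: "zKROK_with A g P X \<rho> \<mu>" and z': "zKROK_with A g P X \<rho>' \<mu>'"
  shows "\<rho> p 0 = \<rho>' p 0"
    and "continuous_map (weak_C1_topology A) euclideanreal F \<Longrightarrow>
      (\<And>f. f \<in> C1_maps A \<Longrightarrow> \<bar>F f\<bar> \<le> C * jacobian A g p f) \<Longrightarrow>
      \<rho> p 0 * (\<integral>f. F f \<partial>\<mu> p 0) = \<rho>' p 0 * (\<integral>f. F f \<partial>\<mu>' p 0)"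
proof -
  have "AE x in lborel. ennreal (\<rho> p x) = ennreal (\<rho>' p x)"
    by (rule prob_space.distributed_unique[OF P zKROK_withD(4)[OF z] zKROK_withD(4)[OF z']])
  then have "AE x in lborel. \<rho> p x - \<rho>' p x = 0"
    by eventually_elim (simp add: zKROK_withD(3)[OF z] zKROK_withD(3)[OF z'])
  moreover have cont: "isCont (\<rho> p) 0" "isCont (\<rho>' p) 0"
    by (rule isCont_slice[OF zKROK_withD(5)[OF z]], rule isCont_slice[OF zKROK_withD(5)[OF z']])
  ultimately have "\<rho> p 0 - \<rho>' p 0 = 0"
    by (intro isCont_AE_zero[OF continuous_diff])
  then show \<rho>: "\<rho> p 0 = \<rho>' p 0" by simp
  note rcp = zKROK_withD(6)[OF z, of p] and rcp' = zKROK_withD(6)[OF z', of p]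
  have X: "(\<lambda>w. X w p) \<in> borel_measurable P"
    using measurable_compose[OF zKROK_withD(1)[OF z] measurable_evaluation[OF A]] .
  \<comment> \<open>The factor \<open>\<rho> p\<close> turns equality where the density is positive
    into almost everywhere vanishing of a function continuous at 0, so \<open>isCont_AE_zero\<close>
    applies without a neighbourhood of positive density.\<close>
  have test: "\<rho> p 0 * ((\<integral>f. \<Psi> f \<partial>J_measure A g p (\<mu> p 0)) - (\<integral>f. \<Psi> f \<partial>J_measure A g p (\<mu>' p 0))) = 0"
    if \<Psi>: "continuous_map (weak_C1_topology A) euclideanreal \<Psi>" and b: "bounded (\<Psi> ` C1_maps A)"
    for \<Psi> :: "('m \<Rightarrow> real^'k) \<Rightarrow> real"
  proof -
    have [measurable]: "jacobian A g p \<in> borel_measurable (C1_borel A)" "\<Psi> \<in> borel_measurable (C1_borel A)"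
      by (rule jacobian_measurable, rule continuous_map_borel_measurable[OF A \<Psi>])
    obtain c where c: "\<And>f. f \<in> C1_maps A \<Longrightarrow> norm (\<Psi> f) \<le> c"
      using b unfolding bounded_iff by blast
    have int: "integrable (J_measure A g p M) \<Psi>"
      if fin: "finite_measure (J_measure A g p M)" and M: "sets M = sets (C1_borel A)" for M
    proof (rule finite_measure.integrable_const_bound[OF fin, of _ c])
      show "AE f in J_measure A g p M. norm (\<Psi> f) \<le> c"
        using c space_C1_measure[OF M] by (intro AE_I2) (simp add: J_measure_def)
      show "\<Psi> \<in> borel_measurable (J_measure A g p M)"
        using continuous_map_measurable_C1_measure[OF M \<Psi>] by (simp add: J_measure_def)
    qed
    \<comment> \<open>Uniqueness of conditional laws is available for nonnegative integrands, so the
      positive and negative parts of \<Psi> are kept apart.\<close>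
    have eq: "(\<integral>f. \<Psi> f \<partial>J_measure A g p M) =
        enn2real (\<integral>\<^sup>+f. ennreal (jacobian A g p f) * ennreal (\<Psi> f) \<partial>M) -
        enn2real (\<integral>\<^sup>+f. ennreal (jacobian A g p f) * ennreal (- \<Psi> f) \<partial>M)"
      if fin: "finite_measure (J_measure A g p M)" and M: "sets M = sets (C1_borel A)" for M
      unfolding real_lebesgue_integral_def[OF int[OF that]]
      by (subst (1 2) nn_integral_J_measure[OF M]) simp_all
    note un = regular_cond_prob_unique[OF P X rcp rcp']
    have "AE x in distr P borel (\<lambda>w. X w p).
        (\<integral>\<^sup>+f. ennreal (jacobian A g p f) * ennreal (\<Psi> f) \<partial>\<mu> p x) =
        (\<integral>\<^sup>+f. ennreal (jacobian A g p f) * ennreal (\<Psi> f) \<partial>\<mu>' p x)"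
      by (rule un) measurable
    moreover have "AE x in distr P borel (\<lambda>w. X w p).
        (\<integral>\<^sup>+f. ennreal (jacobian A g p f) * ennreal (- \<Psi> f) \<partial>\<mu> p x) =
        (\<integral>\<^sup>+f. ennreal (jacobian A g p f) * ennreal (- \<Psi> f) \<partial>\<mu>' p x)"
      by (rule un) measurable
    ultimately have "AE x in distr P borel (\<lambda>w. X w p).
        (\<integral>f. \<Psi> f \<partial>J_measure A g p (\<mu> p x)) = (\<integral>f. \<Psi> f \<partial>J_measure A g p (\<mu>' p x))"
      by eventually_elim (simp only: eq[OF zKROK_withD(7)[OF z] regular_cond_probD(2)[OF rcp]]
          eq[OF zKROK_withD(7)[OF z'] regular_cond_probD(2)[OF rcp']])
    from AE_distr_density[OF zKROK_withD(4)[OF z] this]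
    have "AE x in lborel. \<rho> p x * ((\<integral>f. \<Psi> f \<partial>J_measure A g p (\<mu> p x)) - (\<integral>f. \<Psi> f \<partial>J_measure A g p (\<mu>' p x))) = 0"
      by eventually_elim (use zKROK_withD(3)[OF z, of p] in \<open>auto simp: less_le\<close>)
    with isCont_AE_zero[OF continuous_mult[OF cont(1) continuous_diff[OF
        isCont_slice[OF zKROK_withD(8)[OF z \<Psi> b]] isCont_slice[OF zKROK_withD(8)[OF z' \<Psi> b]]]]]
    show ?thesis .
  qed
  assume F: "continuous_map (weak_C1_topology A) euclideanreal F"
    and C: "\<And>f. f \<in> C1_maps A \<Longrightarrow> \<bar>F f\<bar> \<le> C * jacobian A g p f"
  have "(\<integral>f. F f \<partial>\<mu> p 0) = (\<integral>f. F f \<partial>\<mu>' p 0)" if pos: "\<rho> p 0 \<noteq> 0"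
  proof (rule LIMSEQ_unique)
    let ?\<Psi> = "\<lambda>n f. F f / max (jacobian A g p f) (1 / Suc n)"
    show "(\<lambda>n. \<integral>f. ?\<Psi> n f \<partial>J_measure A g p (\<mu> p 0)) \<longlonglongrightarrow> (\<integral>f. F f \<partial>\<mu> p 0)"
      by (rule J_dominated_limit[OF regular_cond_probD(2)[OF rcp] zKROK_withD(7)[OF z] F C])
    have "(\<integral>f. ?\<Psi> n f \<partial>J_measure A g p (\<mu> p 0)) = (\<integral>f. ?\<Psi> n f \<partial>J_measure A g p (\<mu>' p 0))" for n
    proof -
      have "continuous_map (weak_C1_topology A) euclideanreal (?\<Psi> n)"
        by (intro continuous_map_real_divide continuous_map_real_max F continuous_map_jacobian[OF A g])
           (auto simp: max_def not_le)
      moreover have "bounded (?\<Psi> n ` C1_maps A)"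
        unfolding bounded_iff
      proof (intro exI ballI)
        fix y assume "y \<in> ?\<Psi> n ` C1_maps A"
        then obtain f where f: "f \<in> C1_maps A" "y = ?\<Psi> n f" by blast
        let ?m = "max (jacobian A g p f) (1 / Suc n)"
        have m: "0 < ?m" by (simp add: less_max_iff_disj)
        \<comment> \<open>\<open>C\<close> carries no sign, hence the absolute value.\<close>
        have "\<bar>F f\<bar> \<le> \<bar>C\<bar> * jacobian A g p f"
          using C[OF f(1)] mult_right_mono[OF abs_ge_self[of C] jacobian_nonneg[OF A g f(1)]]
          by (rule order_trans)
        also have "\<dots> \<le> \<bar>C\<bar> * ?m" by (intro mult_left_mono) auto
        finally show "norm y \<le> \<bar>C\<bar>"
          using m by (simp add: f(2) pos_divide_le_eq)
      qed
      ultimately show ?thesis using test[of "?\<Psi> n"] pos by simp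
    qed
    then show "(\<lambda>n. \<integral>f. ?\<Psi> n f \<partial>J_measure A g p (\<mu> p 0)) \<longlonglongrightarrow> (\<integral>f. F f \<partial>\<mu>' p 0)"
      using J_dominated_limit[OF regular_cond_probD(2)[OF rcp'] zKROK_withD(7)[OF z'] F C] by simp
  qed
  \<comment> \<open>If the density vanishes at 0 both sides are 0, whatever the conditional laws at
    0 are.\<close>
  then show "\<rho> p 0 * (\<integral>f. F f \<partial>\<mu> p 0) = \<rho>' p 0 * (\<integral>f. F f \<partial>\<mu>' p 0)"
    unfolding \<rho>[symmetric] by (cases "\<rho> p 0 = 0") simp_all
qed

lemma zonoid_sectionI:
  assumes "convex_body A p K"
    and "\<And>u. u \<in> multivectors A p \<Longrightarrow>
      support_function K u = \<rho> p 0 * (\<integral>f. max 0 (u (wedge A p (d_component A p f))) \<partial>\<mu> p 0)"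
  shows "zonoid_section A \<rho> \<mu> p = K"
  unfolding zonoid_section_def
proof (rule the_equality)
  show "convex_body A p K \<and> (\<forall>u\<in>multivectors A p.
      support_function K u = \<rho> p 0 * (\<integral>f. max 0 (u (wedge A p (d_component A p f))) \<partial>\<mu> p 0))"
    using assms by blast
  fix L assume L: "convex_body A p L \<and> (\<forall>u\<in>multivectors A p.
      support_function L u = \<rho> p 0 * (\<integral>f. max 0 (u (wedge A p (d_component A p f))) \<partial>\<mu> p 0))"
  show "L = K"
    by (rule convex_body_eqI[of A p]) (use assms L in auto)
qed

text \<open>Existence is what gives the definite description a value. The integrability that it
  requires comes from the finiteness of \<open>J_measure\<close>.\<close>

lemma zonoid_section_support:
  fixes X :: "'w \<Rightarrow> 'm \<Rightarrow> real^'k" and u :: "('m, 'e, 'k) kform \<Rightarrow> real"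
  assumes z: "zKROK_with A g P X \<rho> \<mu>"
  shows "convex_body A p (zonoid_section A \<rho> \<mu> p)"
    and "u \<in> multivectors A p \<Longrightarrow> support_function (zonoid_section A \<rho> \<mu> p) u =
      \<rho> p 0 * (\<integral>f. max 0 (u (wedge A p (d_component A p f))) \<partial>\<mu> p 0)"
proof -
  note s = regular_cond_probD(2)[OF zKROK_withD(6)[OF z], of p 0]
  have "\<exists>K. convex_body A p K \<and> (\<forall>u\<in>multivectors A p.
      support_function K u = \<rho> p 0 * (\<integral>f. max 0 (u (wedge A p (d_component A p f))) \<partial>\<mu> p 0))"
  proof (rule zonoid_exists)
    show "wedge A p (d_component A p f) \<in> alternating_forms A p" if "f \<in> space (\<mu> p 0)" for f
      using that wedge_alternating[OF A] by (simp add: space_C1_measure[OF s])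
    show "integrable (\<mu> p 0) (\<lambda>f. wedge A p (d_component A p f) v)" for v
      by (rule wedge_integrable[OF s zKROK_withD(7)[OF z]])
    show "0 \<le> \<rho> p 0" by (rule zKROK_withD(3)[OF z])
  qed
  then obtain K where K: "convex_body A p K" "\<And>u. u \<in> multivectors A p \<Longrightarrow>
      support_function K u = \<rho> p 0 * (\<integral>f. max 0 (u (wedge A p (d_component A p f))) \<partial>\<mu> p 0)"
    by blast
  have "zonoid_section A \<rho> \<mu> p = K" by (intro zonoid_sectionI K)
  then show "convex_body A p (zonoid_section A \<rho> \<mu> p)"
    and "u \<in> multivectors A p \<Longrightarrow> support_function (zonoid_section A \<rho> \<mu> p) u =
      \<rho> p 0 * (\<integral>f. max 0 (u (wedge A p (d_component A p f))) \<partial>\<mu> p 0)"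
    using K by simp_all
qed

end

subsection \<open>Switching between two fields\<close>

text \<open>For two-valued \<epsilon> the combination is a selection between the fields, so
  measurability is obtained without measurability of addition and scaling in
  \<open>N\<close>.\<close>

lemma switched_measurable:
  assumes \<epsilon>: "\<epsilon> \<in> borel_measurable P" "\<forall>w\<in>space P. \<epsilon> w \<in> {0, 1 :: real}"
    and X: "X0 \<in> measurable P N" "X1 \<in> measurable P N"
  shows "(\<lambda>w p. \<epsilon> w *\<^sub>R X0 w p + (1 - \<epsilon> w) *\<^sub>R (X1 w p :: real^'k)) \<in> measurable P N"
proof -
  have "(\<lambda>w. if \<epsilon> w = 1 then X0 w else X1 w) \<in> measurable P N"
    by (rule measurable_If[OF X]) (use \<epsilon>(1) in measurable)
  moreover have "(\<lambda>p. \<epsilon> w *\<^sub>R X0 w p + (1 - \<epsilon> w) *\<^sub>R (X1 w p :: real^'k)) = (if \<epsilon> w = 1 then X0 w else X1 w)"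
    if "w \<in> space P" for w using \<epsilon>(2) that by auto
  ultimately show ?thesis by (simp cong: measurable_cong)
qed

text \<open>The event splits along the value of \<epsilon> into two disjoint parts, each involving
  one field only, so independence of \<epsilon> from each field separately gives the product
  formula. The value 1 selects \<open>X0\<close> and has probability \<open>1 - t\<close>, whence
  the weights.\<close>

lemma switched_law:
  assumes P: "prob_space P" and \<epsilon>: "\<epsilon> \<in> borel_measurable P" "\<forall>w\<in>space P. \<epsilon> w \<in> {0, 1 :: real}"
    and X: "X0 \<in> measurable P N" "X1 \<in> measurable P N"
    and indep: "independent_of P \<epsilon> borel X0 N" "independent_of P \<epsilon> borel X1 N"
    and t: "measure P {w \<in> space P. \<epsilon> w = 0} = t" "measure P {w \<in> space P. \<epsilon> w = 1} = 1 - t"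
      "0 \<le> t" "t \<le> 1"
    and C: "C \<in> sets N"
  shows "emeasure P {w \<in> space P. (\<lambda>p. \<epsilon> w *\<^sub>R X0 w p + (1 - \<epsilon> w) *\<^sub>R (X1 w p :: real^'k)) \<in> C} =
    ennreal (1 - t) * emeasure P {w \<in> space P. X0 w \<in> C} + ennreal t * emeasure P {w \<in> space P. X1 w \<in> C}"
proof -
  interpret prob_space P by (rule P)
  have prod: "prob ({w \<in> space P. \<epsilon> w = s} \<inter> {w \<in> space P. Y w \<in> C}) =
      prob {w \<in> space P. \<epsilon> w = s} * prob {w \<in> space P. Y w \<in> C}"
    if "independent_of P \<epsilon> borel Y N" for Y s
  proof -
    have "{w \<in> space P. \<epsilon> w = s} = \<epsilon> -` {s} \<inter> space P" "{w \<in> space P. Y w \<in> C} = Y -` C \<inter> space P"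
      by auto
    moreover have "\<epsilon> -` {s} \<inter> space P \<in> sets (vimage_algebra (space P) \<epsilon> borel)"
      by (rule in_vimage_algebra) simp
    moreover have "Y -` C \<inter> space P \<in> sets (vimage_algebra (space P) Y N)"
      by (rule in_vimage_algebra[OF C])
    ultimately show ?thesis
      using indep_setD[OF that[unfolded independent_of_def]] by simp
  qed
  have ev: "{w \<in> space P. \<epsilon> w = s} \<in> events" for s using \<epsilon>(1) by measurable
  have Yev: "{w \<in> space P. Y w \<in> C} \<in> events" if "Y \<in> measurable P N" for Y
    using measurable_sets[OF that C] by (simp add: vimage_def Int_def conj_commute)
  let ?S1 = "{w \<in> space P. \<epsilon> w = 1} \<inter> {w \<in> space P. X0 w \<in> C}"
    and ?S0 = "{w \<in> space P. \<epsilon> w = 0} \<inter> {w \<in> space P. X1 w \<in> C}"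
  have "w \<in> space P \<Longrightarrow> (\<lambda>p. \<epsilon> w *\<^sub>R X0 w p + (1 - \<epsilon> w) *\<^sub>R X1 w p) = (if \<epsilon> w = 1 then X0 w else X1 w)" for w
    using \<epsilon>(2) by auto
  then have split: "{w \<in> space P. (\<lambda>p. \<epsilon> w *\<^sub>R X0 w p + (1 - \<epsilon> w) *\<^sub>R X1 w p) \<in> C} = ?S1 \<union> ?S0"
    using \<epsilon>(2) by (auto split: if_splits)
  have "prob (?S1 \<union> ?S0) = prob ?S1 + prob ?S0"
    by (rule finite_measure_Union) (use ev Yev[OF X(1)] Yev[OF X(2)] in auto)
  also have "\<dots> = (1 - t) * prob {w \<in> space P. X0 w \<in> C} + t * prob {w \<in> space P. X1 w \<in> C}"
    by (simp only: prod[OF indep(1)] prod[OF indep(2)] t)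
  finally show ?thesis
    using t(3,4) by (simp add: split emeasure_eq_measure ennreal_mult)
qed

text \<open>
  The posterior weight of the component with density \<open>r0\<close>, by Bayes' formula. For \<open>t \<in> {0, 1}\<close> it
  has to be constant, since \<open>r0\<close> or \<open>r1\<close> alone may vanish and the quotient need not extend
  continuously.
\<close>

definition bayes_weight :: "real \<Rightarrow> real \<Rightarrow> real \<Rightarrow> real" where
  "bayes_weight t r0 r1 = (if t = 0 then 1 else if t = 1 then 0
     else if (1 - t) * r0 + t * r1 = 0 then 1 else (1 - t) * r0 / ((1 - t) * r0 + t * r1))"

lemma bayes_weight:
  assumes "0 \<le> t" "t \<le> 1" "0 \<le> r0" "0 \<le> r1"
  shows "0 \<le> bayes_weight t r0 r1" "bayes_weight t r0 r1 \<le> 1"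
    "bayes_weight t r0 r1 * ((1 - t) * r0 + t * r1) = (1 - t) * r0"
proof -
  have nn: "0 \<le> (1 - t) * r0" "0 \<le> t * r1" using assms by simp_all
  show "0 \<le> bayes_weight t r0 r1" using nn by (simp add: bayes_weight_def)
  show "bayes_weight t r0 r1 \<le> 1" using nn by (simp add: bayes_weight_def divide_le_eq)
  \<comment> \<open>If the denominator vanishes, so do both nonnegative summands, and the default
    weight satisfies the identity.\<close>
  show "bayes_weight t r0 r1 * ((1 - t) * r0 + t * r1) = (1 - t) * r0"
    using nn by (auto simp: bayes_weight_def add_nonneg_eq_0_iff)
qed

text \<open>For \<open>0 < t < 1\<close> the absence of a common zero makes the denominator nonzero
  at \<open>z\<close> and, by continuity, nearby, so only the quotient branch of the definition is
  met.\<close>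

lemma isCont_bayes_weight:
  fixes r0 r1 :: "'a::t2_space \<Rightarrow> real"
  assumes t: "0 \<le> t" "t \<le> 1" and r: "isCont r0 z" "isCont r1 z" "0 \<le> r0 z" "0 \<le> r1 z"
    and ne: "\<not> (r0 z = 0 \<and> r1 z = 0)"
  shows "isCont (\<lambda>x. bayes_weight t (r0 x) (r1 x)) z"
proof (cases "t = 0 \<or> t = 1")
  case True
  then show ?thesis by (auto simp: bayes_weight_def)
next
  case False
  let ?r = "\<lambda>x. (1 - t) * r0 x + t * r1 x"
  have "(1 - t) * r0 z \<ge> 0" "t * r1 z \<ge> 0" "(1 - t) * r0 z \<noteq> 0 \<or> t * r1 z \<noteq> 0"
    using t r ne False by auto
  then have rz: "?r z \<noteq> 0" by linarith
  have rc: "isCont ?r z" using r(1,2) by (intro continuous_intros)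
  then have "(?r \<longlongrightarrow> ?r z) (nhds z)"
    unfolding isCont_def by (rule tendsto_at_iff_tendsto_nhds[of ?r, THEN iffD1])
  then have "eventually (\<lambda>x. ?r x \<noteq> 0) (nhds z)" using rz by (rule tendsto_imp_eventually_ne)
  then have "eventually (\<lambda>x. bayes_weight t (r0 x) (r1 x) = (1 - t) * r0 x / ?r x) (nhds z)"
    by eventually_elim (use False in \<open>simp add: bayes_weight_def\<close>)
  moreover have "isCont (\<lambda>x. (1 - t) * r0 x / ?r x) z"
    using r(1,2) rz by (intro continuous_intros) auto
  ultimately show ?thesis by (simp add: isCont_cong)
qed

lemma zKROK_with_mixture:
  fixes A :: "('m::{t2_space,second_countable_topology}, 'e::euclidean_space) chart set"
    and X0 X1 Xt :: "'w \<Rightarrow> 'm \<Rightarrow> real^'k"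
  assumes A: "smooth_atlas A" and g: "riemannian_metric A g" and P: "prob_space P"
    and z0: "zKROK_with A g P X0 \<rho>0 \<mu>0" and z1: "zKROK_with A g P X1 \<rho>1 \<mu>1"
    and t: "0 \<le> t" "t \<le> 1" and ne: "\<And>p. \<not> (\<rho>0 p 0 = 0 \<and> \<rho>1 p 0 = 0)"
    and Xt: "Xt \<in> measurable P (C1_borel A)" "\<And>w. w \<in> space P \<Longrightarrow> Xt w = X0 w \<or> Xt w = X1 w"
    and law: "\<And>C. C \<in> sets (C1_borel A) \<Longrightarrow> emeasure P {w \<in> space P. Xt w \<in> C} =
      ennreal (1 - t) * emeasure P {w \<in> space P. X0 w \<in> C} + ennreal t * emeasure P {w \<in> space P. X1 w \<in> C}"
  shows "zKROK_with A g P Xt (\<lambda>p x. (1 - t) * \<rho>0 p x + t * \<rho>1 p x)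
    (\<lambda>p x. mixture (bayes_weight t (\<rho>0 p x) (\<rho>1 p x)) (\<mu>0 p x) (\<mu>1 p x))"
proof -
  let ?a = "\<lambda>p x. bayes_weight t (\<rho>0 p x) (\<rho>1 p x)"
  let ?\<mu> = "\<lambda>p x. mixture (?a p x) (\<mu>0 p x) (\<mu>1 p x)"
  let ?r = "\<lambda>p x. (1 - t) * \<rho>0 p x + t * \<rho>1 p x"
  note b = bayes_weight[OF t zKROK_withD(3)[OF z0] zKROK_withD(3)[OF z1]]
  note r0 = zKROK_withD(6)[OF z0] and r1 = zKROK_withD(6)[OF z1]
  note mix = b(1,2) regular_cond_probD(1)[OF r0] regular_cond_probD(1)[OF r1]
    regular_cond_probD(2)[OF r0] regular_cond_probD(2)[OF r1]
  have am: "?a p \<in> borel_measurable borel" for p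
  proof -
    have [measurable]: "\<rho>0 p \<in> borel_measurable borel" "\<rho>1 p \<in> borel_measurable borel"
      using distributed_real_measurable[OF zKROK_withD(3)[OF z0] zKROK_withD(4)[OF z0]]
        distributed_real_measurable[OF zKROK_withD(3)[OF z1] zKROK_withD(4)[OF z1]] by simp_all
    show ?thesis unfolding bayes_weight_def by measurable
  qed
  note rcp = regular_cond_prob_mixture[OF A P zKROK_withD(1)[OF z0] zKROK_withD(1)[OF z1] Xt(1) law t
      r0 r1 zKROK_withD(4)[OF z0] zKROK_withD(3)[OF z0] zKROK_withD(4)[OF z1] zKROK_withD(3)[OF z1]
      b(1,2) am b(3)]
  have sets_mix: "sets (?\<mu> p x) = sets (C1_borel A)" for p x by (rule sets_mixture[OF mix])
  note f0 = zKROK_withD(7)[OF z0] and f1 = zKROK_withD(7)[OF z1]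
  note s0 = regular_cond_probD(2)[OF r0] and s1 = regular_cond_probD(2)[OF r1]
  have fin: "finite_measure (J_measure A g p (?\<mu> p x))" for p x
  proof -
    have "(\<integral>\<^sup>+f. ennreal (jacobian A g p f) \<partial>?\<mu> p x) =
        ennreal (?a p x) * (\<integral>\<^sup>+f. ennreal (jacobian A g p f) \<partial>\<mu>0 p x) +
        ennreal (1 - ?a p x) * (\<integral>\<^sup>+f. ennreal (jacobian A g p f) \<partial>\<mu>1 p x)"
      by (rule nn_integral_mixture[OF mix]) (use jacobian_measurable[OF A g, of p] in measurable)
    also have "\<dots> < \<infinity>"
      using f0[of p x] f1[of p x] unfolding finite_J_measure_iff[OF A g s0] finite_J_measure_iff[OF A g s1]
      by (simp add: ennreal_mult_less_top)
    finally show ?thesis by (simp only: finite_J_measure_iff[OF A g sets_mix])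
  qed
  show ?thesis
    unfolding zKROK_with_def
  proof (intro conjI allI impI Xt(1) rcp fin; (elim conjE)?)
    \<comment> \<open>Each realisation of \<open>Xt\<close> is one of \<open>X0\<close> or
      \<open>X1\<close>, so discarding two null sets is enough.\<close>
    show "AE w in P. regular_value A (Xt w) 0"
      using zKROK_withD(2)[OF z0] zKROK_withD(2)[OF z1] AE_space
      by eventually_elim (use Xt(2) in metis)
    show "0 \<le> ?r p x" for p x using t zKROK_withD(3)[OF z0, of p x] zKROK_withD(3)[OF z1, of p x] by simp
    show "isCont (\<lambda>(q, x). ?r q x) (p, 0)" for p
      using zKROK_withD(5)[OF z0, of p] zKROK_withD(5)[OF z1, of p] unfolding split_beta
      by (intro continuous_intros)
    fix \<Psi> :: "('m \<Rightarrow> real^'k) \<Rightarrow> real" and p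
    assume \<Psi>: "continuous_map (weak_C1_topology A) euclideanreal \<Psi>" and bd: "bounded (\<Psi> ` C1_maps A)"
    obtain c where c: "\<And>f. f \<in> C1_maps A \<Longrightarrow> \<bar>\<Psi> f\<bar> \<le> c"
      using bd unfolding bounded_iff by auto
    have J\<Psi>: "continuous_map (weak_C1_topology A) euclideanreal (\<lambda>f. jacobian A g q f * \<Psi> f)" for q
      by (intro continuous_map_real_mult continuous_map_jacobian[OF A g] \<Psi>)
    have bound: "\<bar>jacobian A g q f * \<Psi> f\<bar> \<le> c * jacobian A g q f" if "f \<in> C1_maps A" for q f
      using mult_left_mono[OF c[OF that] jacobian_nonneg[OF A g that, of q]] jacobian_nonneg[OF A g that, of q]
      by (simp add: abs_mult mult.commute)
    \<comment> \<open>With the Jacobian moved into the integrand the mixture formula applies;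
      continuity then reduces to that of the weight and of the two given integrals.\<close>
    have eq: "(\<integral>f. \<Psi> f \<partial>J_measure A g q (?\<mu> q x)) =
        ?a q x * (\<integral>f. \<Psi> f \<partial>J_measure A g q (\<mu>0 q x)) + (1 - ?a q x) * (\<integral>f. \<Psi> f \<partial>J_measure A g q (\<mu>1 q x))"
      for q x
      unfolding integral_J_measure[OF A g sets_mix \<Psi>] integral_J_measure[OF A g s0 \<Psi>] integral_J_measure[OF A g s1 \<Psi>]
      by (intro integrable_mixture(2)[OF mix] J_dominated_integrable[OF A g s0 f0 J\<Psi> bound]
          J_dominated_integrable[OF A g s1 f1 J\<Psi> bound])
    have "isCont (\<lambda>z. bayes_weight t (case z of (q, x) \<Rightarrow> \<rho>0 q x) (case z of (q, x) \<Rightarrow> \<rho>1 q x)) (p, 0)"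
      by (rule isCont_bayes_weight[OF t zKROK_withD(5)[OF z0] zKROK_withD(5)[OF z1]])
         (use zKROK_withD(3)[OF z0, of p 0] zKROK_withD(3)[OF z1, of p 0] ne[of p] in auto)
    then show "isCont (\<lambda>(q, x). \<integral>f. \<Psi> f \<partial>J_measure A g q (?\<mu> q x)) (p, 0)"
      using zKROK_withD(8)[OF z0 \<Psi> bd, of p] zKROK_withD(8)[OF z1 \<Psi> bd, of p]
      unfolding eq split_beta by (intro continuous_intros)
  qed
qed

theorem proposition5p3:
  fixes A :: "('m::{t2_space,second_countable_topology}, 'e::euclidean_space) chart set"
    and g :: "'m \<Rightarrow> ('m, 'e) tvec \<Rightarrow> ('m, 'e) tvec \<Rightarrow> real"
    and P :: "'w measure"
    and X0 X1 Xt :: "'w \<Rightarrow> 'm \<Rightarrow> real^'k"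
    and \<rho>0 \<rho>1 :: "'m \<Rightarrow> real^'k \<Rightarrow> real"
    and \<mu>0 \<mu>1 :: "'m \<Rightarrow> real^'k \<Rightarrow> ('m \<Rightarrow> real^'k) measure"
    and \<epsilon> :: "'w \<Rightarrow> real"
    and t :: real
  assumes "smooth_atlas A"
    and "riemannian_metric A g"
    and "prob_space P"
    and "zKROK_with A g P X0 \<rho>0 \<mu>0"
    and "zKROK_with A g P X1 \<rho>1 \<mu>1"
    and "t \<in> {0..1}"
    and "\<epsilon> \<in> borel_measurable P"
    and "\<forall>w\<in>space P. \<epsilon> w \<in> {0, 1}"
    and "independent_of P \<epsilon> borel X0 (C1_borel A)"
    and "independent_of P \<epsilon> borel X1 (C1_borel A)"
    and "measure P {w \<in> space P. \<epsilon> w = 0} = t"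
    and "measure P {w \<in> space P. \<epsilon> w = 1} = 1 - t"
    and "\<not> (\<exists>p. \<rho>0 p 0 = 0 \<and> \<rho>1 p 0 = 0)"
    and "Xt = (\<lambda>w p. \<epsilon> w *\<^sub>R X0 w p + (1 - \<epsilon> w) *\<^sub>R X1 w p)"
  shows "zKROK A g P Xt \<and>
    (\<forall>\<rho> \<mu>. zKROK_with A g P Xt \<rho> \<mu> \<longrightarrow>
      (\<forall>p. zonoid_section A \<rho> \<mu> p =
        minkowski_sum (dilate (1 - t) (zonoid_section A \<rho>0 \<mu>0 p))
                      (dilate t (zonoid_section A \<rho>1 \<mu>1 p))))"
proof -
  note A = assms(1) and g = assms(2) and P = assms(3) and z0 = assms(4) and z1 = assms(5)
  have t: "0 \<le> t" "t \<le> 1" using assms(6) by auto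
  let ?\<rho> = "\<lambda>p x. (1 - t) * \<rho>0 p x + t * \<rho>1 p x"
  let ?a = "\<lambda>p x. bayes_weight t (\<rho>0 p x) (\<rho>1 p x)"
  let ?\<mu> = "\<lambda>p x. mixture (?a p x) (\<mu>0 p x) (\<mu>1 p x)"
  have zt: "zKROK_with A g P Xt ?\<rho> ?\<mu>"
  proof (rule zKROK_with_mixture[OF A g P z0 z1 t])
    show "\<not> (\<rho>0 p 0 = 0 \<and> \<rho>1 p 0 = 0)" for p using assms(13) by blast
    show "Xt \<in> measurable P (C1_borel A)"
      unfolding assms(14) by (rule switched_measurable[OF assms(7,8) zKROK_withD(1)[OF z0] zKROK_withD(1)[OF z1]])
    show "Xt w = X0 w \<or> Xt w = X1 w" if "w \<in> space P" for w
      using assms(8) that by (auto simp: assms(14))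
    show "emeasure P {w \<in> space P. Xt w \<in> C} =
      ennreal (1 - t) * emeasure P {w \<in> space P. X0 w \<in> C} + ennreal t * emeasure P {w \<in> space P. X1 w \<in> C}"
      if "C \<in> sets (C1_borel A)" for C
      unfolding assms(14)
      by (rule switched_law[OF P assms(7,8) zKROK_withD(1)[OF z0] zKROK_withD(1)[OF z1] assms(9-12) t that])
  qed
  have "zonoid_section A \<rho> \<mu> p = minkowski_sum (dilate (1 - t) (zonoid_section A \<rho>0 \<mu>0 p))
      (dilate t (zonoid_section A \<rho>1 \<mu>1 p))" if z: "zKROK_with A g P Xt \<rho> \<mu>" for \<rho> \<mu> p
  proof (rule zonoid_sectionI[OF A g])
    note K0 = zonoid_section_support[OF A g z0, where p = p] and K1 = zonoid_section_support[OF A g z1, where p = p]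
    show "convex_body A p (minkowski_sum (dilate (1 - t) (zonoid_section A \<rho>0 \<mu>0 p))
        (dilate t (zonoid_section A \<rho>1 \<mu>1 p)))"
      by (rule convex_body_minkowski_comb[OF K0(1) K1(1)])
    fix u :: "('m, 'e, 'k) kform \<Rightarrow> real" assume u: "u \<in> multivectors A p"
    let ?F = "\<lambda>f. max 0 (u (wedge A p (d_component A p f)))"
    have F: "continuous_map (weak_C1_topology A) euclideanreal ?F"
      by (intro continuous_map_real_max multivector_wedge(1)[OF A g u]) simp
    obtain C where C0: "\<And>f. f \<in> C1_maps A \<Longrightarrow> \<bar>u (wedge A p (d_component A p f))\<bar> \<le> C * jacobian A g p f"
      using multivector_wedge(2)[OF A g u] by blast
    have C: "\<bar>?F f\<bar> \<le> C * jacobian A g p f" if "f \<in> C1_maps A" for f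
      using C0[OF that] by linarith
    note r0 = zKROK_withD(6)[OF z0, of p] and r1 = zKROK_withD(6)[OF z1, of p]
    note b = bayes_weight[OF t zKROK_withD(3)[OF z0, of p 0] zKROK_withD(3)[OF z1, of p 0]]
    have int: "integrable (\<mu>0 p 0) ?F" "integrable (\<mu>1 p 0) ?F"
      by (rule J_dominated_integrable[OF A g regular_cond_probD(2)[OF r0] zKROK_withD(7)[OF z0] F C],
          assumption, rule J_dominated_integrable[OF A g regular_cond_probD(2)[OF r1] zKROK_withD(7)[OF z1] F C])
    \<comment> \<open>An arbitrary witness for \<open>Xt\<close> is exchanged for the constructed
      one, whose integrals are explicit.\<close>
    have "\<rho> p 0 * (\<integral>f. ?F f \<partial>\<mu> p 0) = ?\<rho> p 0 * (\<integral>f. ?F f \<partial>?\<mu> p 0)"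
      by (rule zKROK_unique(2)[OF A g P z zt F C])
    also have "(\<integral>f. ?F f \<partial>?\<mu> p 0) = ?a p 0 * (\<integral>f. ?F f \<partial>\<mu>0 p 0) + (1 - ?a p 0) * (\<integral>f. ?F f \<partial>\<mu>1 p 0)"
      by (rule integrable_mixture(2)[OF b(1,2) regular_cond_probD(1)[OF r0] regular_cond_probD(1)[OF r1]
            regular_cond_probD(2)[OF r0] regular_cond_probD(2)[OF r1] int])
    \<comment> \<open>The products of weight and density are isolated, since Bayes' identity
      \<open>b(3)\<close> evaluates exactly these and so removes the posterior weights.\<close>
    also have "?\<rho> p 0 * \<dots> = (?a p 0 * ?\<rho> p 0) * (\<integral>f. ?F f \<partial>\<mu>0 p 0)
        + (?\<rho> p 0 - ?a p 0 * ?\<rho> p 0) * (\<integral>f. ?F f \<partial>\<mu>1 p 0)"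
      by (simp only: algebra_simps)
    also have "\<dots> = (1 - t) * (\<rho>0 p 0 * (\<integral>f. ?F f \<partial>\<mu>0 p 0)) + t * (\<rho>1 p 0 * (\<integral>f. ?F f \<partial>\<mu>1 p 0))"
      unfolding b(3) by simp
    finally show "support_function (minkowski_sum (dilate (1 - t) (zonoid_section A \<rho>0 \<mu>0 p))
        (dilate t (zonoid_section A \<rho>1 \<mu>1 p))) u = \<rho> p 0 * (\<integral>f. ?F f \<partial>\<mu> p 0)"
      using support_function_minkowski_comb[OF K0(1) K1(1) u] K0(2)[OF u] K1(2)[OF u] t by simp
  qed
  then show ?thesis using zt unfolding zKROK_def by blast
qed

end
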